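(* Let $n\in\{0,1,2,3\}$, $d(n)=3\cdot 2^n+1$, and let $\varphi_n:P_n(C)\to S^{d(n)}$ be the map $\varphi_n(Z)=\rho\,\sigma_n(Z)/\|\sigma_n(Z)\|$. Then $\varphi_n$ is a fibration outside the branch locus $P_n\subset P_n(C)$ and the hypersurface $P_n(\infty)\subset P_n(C)$; that is, with $\tilde P_n=\{X-\frac13I: X\in P_n\}\subset S^{d(n)}$, it restricts to a fibration $$P_n(C)\setminus\bigl(P_n\cup P_n(\infty)\bigr)\longrightarrow S^{d(n)}\setminus\bigl(\tilde P_n\cup(-\tilde P_n)\bigr).$$ The hypersurface $P_n(\infty)$ gets mapped to the antipodal copy $-\tilde P_n$ of $P_n$. The fibres of this fibration are the sets $\Gamma_n$ of norm one elements of $A_n$, namely the spheres $S^0,S^1,S^3,S^7$ for $n=0,1,2,3$ respectively, and $\varphi_n$ commutes with the action of $G_n$, where $G_0=SO(3)$, $G_1=SU(3)$, $G_2=Sp(3)$, $G_3=F_4$.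
   Context: Let $A_0=\mathbb R$, $A_1=\mathbb C$, $A_2=\mathbb H$, $A_3=\mathbb O$ be the normed real division algebras. $H_n$ is the real vector space of $3\times3$ Hermitian matrices over $A_n$ ($\bar x_{ij}=x_{ji}$), with trace $\mathrm{tr}$, norm $\|X\|^2=\sum_{i,j}\|x_{ij}\|^2$ and Jordan product $X\circ Y=\frac12(XY+YX)$; the resulting Jordan algebra is $J_n$. $I$ is the unit matrix and $H_n(c)=\{X\in H_n:\mathrm{tr}\,X=c\}$. The group $G_n$ acts on $H_n$ with image the identity component of $\mathrm{Aut}(J_n)$ (for $n=0,1,2$ by $X\mapsto AXA^*$; $F_4=\mathrm{Aut}(J_3)$). The projective plane $P_n\subset H_n(1)$ is the $G_n$-orbit of $E=\mathrm{Diag}(1,0,0)$; it is $\mathbb RP^2,\mathbb CP^2,\mathbb HP^2,\mathbb OP^2$ for $n=0,1,2,3$. The complexified projective plane. Let $H_n(C)=H_n\otimes_{\mathbb R}\mathbb C$, and for $X\in H_n$ let $L_X:Y\mapsto X\circ Y$. The compact group $\hat G_n$ is $SU(3)$, $SU(3)\times SU(3)$, $SU(6)$, $E_6$ for $n=0,1,2,3$; it acts on $H_n(C)$ so that its Lie algebra is $$L(\hat G_n)=L(G_n)\oplus H_n(0),$$ where $L(G_n)=\mathrm{Der}(J_n)$ and $X\in H_n(0)$ corresponds to the operator $iL_X$ on $H_n(C)$. $P_n(C)$ is the $\hat G_n$-orbit of $[E]$ in the complex projective space of $H_n(C)$; it is a complex projective manifold of complex dimension $2^{n+1}$ (namely $\mathbb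 CP^2$, $\mathbb CP^2\times\mathbb CP^2$, $Gr_2(\mathbb C^6)$, $E_6/Spin(10)U(1)$), containing $P_n$ as the set of points $[X]$, $X\in P_n$. $P_n(\infty)=\{[Z]\in P_n(C):\mathrm{tr}\,Z=0\}$ is its hyperplane section at infinity ($\mathrm{tr}$ extended complex linearly). $P_n(C)$ is also embedded in $L(\hat G_n)$, $\hat G_n$-equivariantly, as the adjoint orbit of $E-\frac13I=\mathrm{Diag}(2/3,-1/3,-1/3)\in H_n(0)\subset L(\hat G_n)$, the point $g[E]$ corresponding to $\mathrm{Ad}(g)(E-\frac13I)$. The map $\sigma_n:P_n(C)\to H_n(0)$ is the restriction to this orbit of the projection $L(\hat G_n)=L(G_n)\oplus H_n(0)\to H_n(0)$; it is nowhere zero on $P_n(C)$. Put $\rho=\sqrt{2/3}$ and let $S^{d(n)}$ be the sphere of radius $\rho$ about $0$ in $H_n(0)$. On $P_n\subset P_n(C)$ the map $\varphi_n$ is the standard embedding $X\mapsto X-\frac13I$. The group $G_n$ acts on $P_n(C)$ via $G_n\subset\hat G_n$, and on $S^{d(n)}\subset H_n(0)$ via its action on $H_n$. *)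

theory Defs
  imports "HOL-Analysis.Analysis"
begin

text \<open>
  Quaternions and octonions are obtained from the complex numbers by Cayley--Dickson doubling.
  The product type supplies the real vector space structure, the topology and the norm, which
  is the multiplicative one.  All four algebras are realised inside the octonions, so that one
  type of matrices serves every \<open>n\<close>.
\<close>

type_synonym quat = "complex \<times> complex"
type_synonym oct = "quat \<times> quat"
type_synonym omat = "oct^3^3"

fun qcnj :: "quat \<Rightarrow> quat"
  where "qcnj (a, b) = (cnj a, - b)"

fun qmult :: "quat \<Rightarrow> quat \<Rightarrow> quat"
  where "qmult (a, b) (c, d) = (a * c - cnj d * b, d * a + b * cnj c)"

fun ocnj :: "oct \<Rightarrow> oct"
  where "ocnj (a, b) = (qcnj a, - b)"

fun omult :: "oct \<Rightarrow> oct \<Rightarrow> oct"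
  where "omult (a, b) (c, d) =
    (qmult a c - qmult (qcnj d) b, qmult d a + qmult b (qcnj c))"

definition oct_of_complex :: "complex \<Rightarrow> oct"
  where "oct_of_complex z = ((z, 0), (0, 0))"

definition oRe :: "oct \<Rightarrow> real"
  where "oRe x = Re (fst (fst x))"

definition Alg :: "nat \<Rightarrow> oct set"
  where "Alg n =
    (if n = 0 then range (\<lambda>r::real. oct_of_complex (of_real r))
     else if n = 1 then range oct_of_complex
     else if n = 2 then range (\<lambda>q::quat. (q, 0))
     else UNIV)"

definition unit_elements :: "nat \<Rightarrow> oct set"
  where "unit_elements n = {a \<in> Alg n. norm a = 1}"

definition mmult :: "omat \<Rightarrow> omat \<Rightarrow> omat"
  where "mmult A B = (\<chi> i j. \<Sum>k\<in>UNIV. omult (A $ i $ k) (B $ k $ j))"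

definition adj :: "omat \<Rightarrow> omat"
  where "adj A = (\<chi> i j. ocnj (A $ j $ i))"

definition one_mat :: omat
  where "one_mat = (\<chi> i j. if i = j then oct_of_complex 1 else 0)"

definition E_mat :: omat
  where "E_mat = (\<chi> i j. if i = 1 \<and> j = 1 then oct_of_complex 1 else 0)"

definition Herm :: "nat \<Rightarrow> omat set"
  where "Herm n = {X. (\<forall>i j. X $ i $ j \<in> Alg n) \<and> adj X = X}"

text \<open>Only used for Hermitian matrices, whose diagonal entries are real.\<close>

definition tr :: "omat \<Rightarrow> real"
  where "tr X = (\<Sum>i\<in>UNIV. oRe (X $ i $ i))"

definition Herm_tr :: "nat \<Rightarrow> real \<Rightarrow> omat set"
  where "Herm_tr n c = {X \<in> Herm n. tr X = c}"

definition jprod :: "omat \<Rightarrow> omat \<Rightarrow> omat"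
  where "jprod X Y = (1 / 2) *\<^sub>R (mmult X Y + mmult Y X)"

text \<open>
  Maps of \<open>H\<^sub>n\<close> are represented by functions on all matrices; only their values on \<open>H\<^sub>n\<close> matter.
\<close>

definition linear_on_Herm :: "nat \<Rightarrow> (omat \<Rightarrow> omat) \<Rightarrow> bool"
  where "linear_on_Herm n f \<longleftrightarrow> f \<in> Herm n \<rightarrow> Herm n \<and>
    (\<forall>X\<in>Herm n. \<forall>Y\<in>Herm n. f (X + Y) = f X + f Y) \<and>
    (\<forall>X\<in>Herm n. \<forall>c. f (c *\<^sub>R X) = c *\<^sub>R f X)"

definition Aut_J :: "nat \<Rightarrow> (omat \<Rightarrow> omat) set"
  where "Aut_J n = {f. linear_on_Herm n f \<and> bij_betw f (Herm n) (Herm n) \<and>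
    (\<forall>X\<in>Herm n. \<forall>Y\<in>Herm n. f (jprod X Y) = jprod (f X) (f Y))}"

definition Der_J :: "nat \<Rightarrow> (omat \<Rightarrow> omat) set"
  where "Der_J n = {f. linear_on_Herm n f \<and>
    (\<forall>X\<in>Herm n. \<forall>Y\<in>Herm n. f (jprod X Y) = jprod (f X) Y + jprod X (f Y))}"

definition SO3 :: "(real^3^3) set"
  where "SO3 = {A. rotation_matrix A}"

definition SU3 :: "(complex^3^3) set"
  where "SU3 = {A. A ** (\<chi> i j. cnj (A $ j $ i)) = mat 1 \<and> det A = 1}"

definition Sp3 :: "omat set"
  where "Sp3 = {A. (\<forall>i j. A $ i $ j \<in> Alg 2) \<and> mmult A (adj A) = one_mat}"

definition conj_action :: "omat \<Rightarrow> omat \<Rightarrow> omat"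
  where "conj_action A X = mmult (mmult A X) (adj A)"

text \<open>The groups \<open>SO(3)\<close>, \<open>SU(3)\<close>, \<open>Sp(3)\<close>, \<open>F\<^sub>4\<close>, given by the transformations of \<open>H\<^sub>n\<close> they induce.\<close>

definition Grp :: "nat \<Rightarrow> (omat \<Rightarrow> omat) set"
  where "Grp n =
    (if n = 0 then {conj_action (\<chi> i j. oct_of_complex (of_real (A $ i $ j))) | A. A \<in> SO3}
     else if n = 1 then {conj_action (\<chi> i j. oct_of_complex (A $ i $ j)) | A. A \<in> SU3}
     else if n = 2 then {conj_action A | A. A \<in> Sp3}
     else Aut_J 3)"

definition proj_plane :: "nat \<Rightarrow> omat set"
  where "proj_plane n = {g E_mat | g. g \<in> Grp n}"

text \<open>The pair \<open>(X, Y)\<close> stands for \<open>X + \<i>Y\<close> in the complexification.\<close>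

definition HermC :: "nat \<Rightarrow> (omat \<times> omat) set"
  where "HermC n = Herm n \<times> Herm n"

definition cscale :: "complex \<Rightarrow> omat \<times> omat \<Rightarrow> omat \<times> omat"
  where "cscale c Z =
    (Re c *\<^sub>R fst Z - Im c *\<^sub>R snd Z, Re c *\<^sub>R snd Z + Im c *\<^sub>R fst Z)"

definition trC :: "omat \<times> omat \<Rightarrow> complex"
  where "trC Z = Complex (tr (fst Z)) (tr (snd Z))"

definition complexify :: "(omat \<Rightarrow> omat) \<Rightarrow> omat \<times> omat \<Rightarrow> omat \<times> omat"
  where "complexify f = map_prod f f"

definition line :: "omat \<times> omat \<Rightarrow> (omat \<times> omat) set"
  where "line Z = range (\<lambda>c. cscale c Z)"

definition CProj :: "nat \<Rightarrow> (omat \<times> omat) set set"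
  where "CProj n = line ` (HermC n - {0})"

definition CProj_top :: "nat \<Rightarrow> (omat \<times> omat) set topology"
  where "CProj_top n = topology (\<lambda>U. U \<subseteq> CProj n \<and>
    openin (top_of_set (HermC n - {0})) {Z \<in> HermC n - {0}. line Z \<in> U})"

lemma openin_CProj_top:
  "openin (CProj_top n) U \<longleftrightarrow> U \<subseteq> CProj n \<and>
    openin (top_of_set (HermC n - {0})) {Z \<in> HermC n - {0}. line Z \<in> U}"
proof -
  define V where "V = HermC n - {0}"
  define P where "P = (\<lambda>U. U \<subseteq> CProj n \<and> openin (top_of_set V) {Z \<in> V. line Z \<in> U})"
  have "istopology P"
    unfolding istopology_def
  proof (rule conjI; intro allI impI)
    fix S T
    assume "P S" "P T"
    have "{Z \<in> V. line Z \<in> S \<inter> T} = {Z \<in> V. line Z \<in> S} \<inter> {Z \<in> V. line Z \<in> T}"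
      by blast
    moreover have "openin (top_of_set V) ({Z \<in> V. line Z \<in> S} \<inter> {Z \<in> V. line Z \<in> T})"
      using \<open>P S\<close> \<open>P T\<close> unfolding P_def by (intro openin_Int) (erule conjE, assumption)+
    ultimately show "P (S \<inter> T)"
      using \<open>P S\<close> unfolding P_def by (metis Int_lower1 order_trans)
  next
    fix K
    assume K: "\<forall>U\<in>K. P U"
    have "{Z \<in> V. line Z \<in> \<Union>K} = \<Union>((\<lambda>U. {Z \<in> V. line Z \<in> U}) ` K)"
      by blast
    moreover have "openin (top_of_set V) (\<Union>((\<lambda>U. {Z \<in> V. line Z \<in> U}) ` K))"
    proof (rule openin_Union)
      fix S
      assume "S \<in> (\<lambda>U. {Z \<in> V. line Z \<in> U}) ` K"
      then obtain U where "U \<in> K" and S: "S = {Z \<in> V. line Z \<in> U}"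
        by (rule imageE)
      have "P U"
        using K \<open>U \<in> K\<close> by (rule bspec)
      then show "openin (top_of_set V) S"
        unfolding P_def S by (rule conjunct2)
    qed
    moreover have "\<Union>K \<subseteq> CProj n"
    proof (rule Union_least)
      fix U
      assume "U \<in> K"
      with K have "P U"
        by (rule bspec)
      then show "U \<subseteq> CProj n"
        unfolding P_def by (rule conjunct1)
    qed
    ultimately show "P (\<Union>K)"
      unfolding P_def by metis
  qed
  then have "openin (topology P) U \<longleftrightarrow> P U"
    by (rule topology_inverse'[THEN fun_cong])
  then show ?thesis
    unfolding CProj_top_def P_def V_def .
qed

lemma topspace_CProj_top: "topspace (CProj_top n) = CProj n"
proof (rule subset_antisym)
  show "topspace (CProj_top n) \<subseteq> CProj n"
    using openin_topspace[of "CProj_top n"] unfolding openin_CProj_top by (rule conjunct1)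
  have *: "{Z \<in> HermC n - {0}. line Z \<in> CProj n} = HermC n - {0}"
    unfolding CProj_def by blast
  have "openin (CProj_top n) (CProj n)"
    unfolding openin_CProj_top * by (intro conjI subset_refl openin_subtopology_self)
  then show "CProj n \<subseteq> topspace (CProj_top n)"
    by (rule openin_subset)
qed

text \<open>
  The operator \<open>D + \<i>L\<^sub>X\<close> on the complexification.  With \<open>D\<close> in \<open>Der_J n\<close> and \<open>X\<close> in
  \<open>Herm_tr n 0\<close> these form the Lie algebra of the compact group \<open>SU(3)\<close>, \<open>SU(3) \<times> SU(3)\<close>,
  \<open>SU(6)\<close>, \<open>E\<^sub>6\<close>.
\<close>

definition lie_op :: "(omat \<Rightarrow> omat) \<Rightarrow> omat \<Rightarrow> omat \<times> omat \<Rightarrow> omat \<times> omat"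
  where "lie_op D X Z = complexify D Z + cscale \<i> (complexify (jprod X) Z)"

definition lie_Ghat :: "nat \<Rightarrow> (omat \<times> omat \<Rightarrow> omat \<times> omat) set"
  where "lie_Ghat n = {lie_op D X | D X. D \<in> Der_J n \<and> X \<in> Herm_tr n 0}"

definition op_exp ::
  "(omat \<times> omat \<Rightarrow> omat \<times> omat) \<Rightarrow> omat \<times> omat \<Rightarrow> omat \<times> omat"
  where "op_exp \<xi> Z = (\<Sum>k. (\<xi> ^^ k) Z /\<^sub>R fact k)"

text \<open>
  A connected Lie group is generated by the exponentials of its Lie algebra; this determines
  the transformations of the complexification induced by the compact group.  The series of
  \<open>op_exp\<close> converges on \<open>HermC n\<close>, and only the values there matter.
\<close>

inductive_set Ghat :: "nat \<Rightarrow> (omat \<times> omat \<Rightarrow> omat \<times> omat) set" for n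
  where
    Ghat_id: "id \<in> Ghat n"
  | Ghat_exp: "\<xi> \<in> lie_Ghat n \<Longrightarrow> g \<in> Ghat n \<Longrightarrow> op_exp \<xi> \<circ> g \<in> Ghat n"

definition planeC :: "nat \<Rightarrow> (omat \<times> omat) set set"
  where "planeC n = {line (g (E_mat, 0)) | g. g \<in> Ghat n}"

definition planeC_top :: "nat \<Rightarrow> (omat \<times> omat) set topology"
  where "planeC_top n = subtopology (CProj_top n) (planeC n)"

definition real_points :: "nat \<Rightarrow> (omat \<times> omat) set set"
  where "real_points n = {line (X, 0) | X. X \<in> proj_plane n}"

definition infinity_points :: "nat \<Rightarrow> (omat \<times> omat) set set"
  where "infinity_points n = {line Z | Z. line Z \<in> planeC n \<and> trC Z = 0}"

text \<open>Elements of the Lie algebra are compared as operators restricted to \<open>HermC n\<close>.\<close>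

definition Ad ::
  "nat \<Rightarrow> (omat \<times> omat \<Rightarrow> omat \<times> omat) \<Rightarrow> (omat \<times> omat \<Rightarrow> omat \<times> omat) \<Rightarrow>
    omat \<times> omat \<Rightarrow> omat \<times> omat"
  where "Ad n g \<xi> = (\<lambda>Z\<in>HermC n. g (\<xi> (inv_into (HermC n) g Z)))"

definition adjoint_embedding ::
  "nat \<Rightarrow> (omat \<times> omat) set \<Rightarrow> omat \<times> omat \<Rightarrow> omat \<times> omat"
  where "adjoint_embedding n p = (THE \<xi>. \<exists>g\<in>Ghat n.
    p = line (g (E_mat, 0)) \<and> \<xi> = Ad n g (lie_op (\<lambda>_. 0) (E_mat - (1 / 3) *\<^sub>R one_mat)))"

definition Herm0_part :: "nat \<Rightarrow> (omat \<times> omat \<Rightarrow> omat \<times> omat) \<Rightarrow> omat"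
  where "Herm0_part n \<xi> = (THE X. X \<in> Herm_tr n 0 \<and>
    (\<exists>D\<in>Der_J n. \<forall>Z\<in>HermC n. \<xi> Z = lie_op D X Z))"

definition sigma_map :: "nat \<Rightarrow> (omat \<times> omat) set \<Rightarrow> omat"
  where "sigma_map n p = Herm0_part n (adjoint_embedding n p)"

definition rho :: real
  where "rho = sqrt (2 / 3)"

definition phi_map :: "nat \<Rightarrow> (omat \<times> omat) set \<Rightarrow> omat"
  where "phi_map n p = (rho / norm (sigma_map n p)) *\<^sub>R sigma_map n p"

definition Herm_sphere :: "nat \<Rightarrow> omat set"
  where "Herm_sphere n = {X \<in> Herm_tr n 0. norm X = rho}"

definition plane_tilde :: "nat \<Rightarrow> omat set"
  where "plane_tilde n = {X - (1 / 3) *\<^sub>R one_mat | X. X \<in> proj_plane n}"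

text \<open>Locally trivial fibration with typical fibre \<open>F\<close>.\<close>

definition fibration_with_fibre ::
  "'a topology \<Rightarrow> 'b topology \<Rightarrow> ('a \<Rightarrow> 'b) \<Rightarrow> 'c topology \<Rightarrow> bool"
  where "fibration_with_fibre X Y f F \<longleftrightarrow> continuous_map X Y f \<and>
    (\<forall>y\<in>topspace Y. \<exists>U. openin Y U \<and> y \<in> U \<and>
      (\<exists>h. homeomorphic_map (subtopology X {x \<in> topspace X. f x \<in> U})
              (prod_topology (subtopology Y U) F) h \<and>
           (\<forall>x\<in>topspace X. f x \<in> U \<longrightarrow> fst (h x) = f x)))"

end

theory Submission
  imports Defs
begin

text \<open>
  Rotations in two coordinates diagonalize every Hermitian matrix (move a maximum of the linear form
  \<open>\<langle>X, -\<rangle>\<close> on the compact set of primitive idempotents to \<open>E\<close>, then rotate the complementary block).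
  Hence identities of the Jordan algebra that are linear in one variable need only be checked with
  that variable equal to \<open>E\<close>, where they are immediate even over the octonions.

  The compact group preserves the cone \<open>Z\<^sup>2 = tr Z Z\<close>.  On it, multiply a unit vector by a phase such
  that its trace is real and nonnegative and diagonalize its real part: up to a rotation
  \<open>Z = diag(\<alpha>, 0, -\<beta>) + \<i> b\<close> with \<open>b\<close> in the position 13, \<open>\<alpha> \<ge> \<beta> \<ge> 0\<close>, \<open>\<alpha> + \<beta> = 1\<close> and \<open>|b|\<^sup>2 = \<alpha>\<beta>\<close>.
  A one-parameter group carries this to \<open>\<i>\<close> times a real idempotent, so the cone is a single orbit up to
  scalars.  The element of the Lie algebra attached to a unit vector \<open>Z\<close> is \<open>\<i>\<close> times
  \<open>{Z Z* -} - 1/3\<close>, whose component in \<open>H\<^sub>n(0)\<close> is \<open>Z Z* - 1/3\<close>, with eigenvalues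
  \<open>\<alpha> - 1/3\<close>, \<open>-1/3\<close>, \<open>\<beta> - 1/3\<close>.  The real points are those with \<open>\<beta> = 0\<close>, the points at infinity those with
  \<open>\<alpha> = \<beta>\<close>.  Otherwise the three eigenvalues are distinct and determine the real part of \<open>Z\<close>, while \<open>b\<close>
  varies over a sphere in a Peirce space isomorphic to \<open>A\<^sub>n\<close>.

  Near a base point, project the imaginary part of \<open>Z\<close> linearly to the Peirce space of that
  point and normalize.  Together with \<open>\<phi>\<^sub>n\<close> this is a continuous bijection onto a product, and it is a
  homeomorphism because \<open>\<phi>\<^sub>n\<close> is proper, its source being compact.
\<close>

text \<open>Products of octonionic matrices do not associate, so conjugation by matrices gives no
  group acting on \<open>Herm 3\<close>. The replacement for all \<open>n\<close> is
  \<open>rotations\<close>, generated by explicit one-parameter groups of automorphisms and a cyclic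
  permutation; matrices return only for \<open>n \<le> 2\<close>, for the comparison with
  \<open>Grp n\<close>.

  \<open>Ghat n\<close> is known only through exponentials, and \<open>adjoint_embedding\<close> and
  \<open>Herm0_part\<close> are definite descriptions. No stabilizer is computed: identities between
  exponentials come from uniqueness for linear differential equations, and
  \<open>adjoint_embedding\<close> is single-valued because \<open>xi W\<close> depends on the unit
  vector \<open>W\<close> only up to a phase.

  In the normal form, \<open>|b|^2 = \<alpha> \<beta>\<close> is the vanishing of a corner minor of
  \<open>Z\<close>, and \<open>\<alpha> + \<beta> = 1\<close> is the unit norm.

  Eigenframes of points of the base would have to be chosen continuously to build a trivialization
  from them. This is avoided: only the frame of the base point enters the formula for the
  trivialization, and the frames of nearby points occur only in the pointwise proof that it is
  bijective.\<close>

section \<open>Octonions\<close>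

lemma oct_cases [cases type]:
  obtains a b c d where "x = (((a, b), (c, d)) :: oct)"
  by (metis surj_pair)

lemma bilinear_omult: "bilinear omult"
  unfolding bilinear_def
  by (auto intro!: linearI simp: split_paired_all algebra_simps scaleR_conv_of_real)

lemma bounded_bilinear_omult: "bounded_bilinear omult"
  using bilinear_omult by (simp add: bilinear_conv_bounded_bilinear)

interpretation omult: bounded_bilinear omult
  by (rule bounded_bilinear_omult)

lemma linear_ocnj: "linear ocnj"
  by (auto intro!: linearI simp: split_paired_all scaleR_conv_of_real)

lemmas ocnj_add = linear_add[OF linear_ocnj]
  and ocnj_diff = linear_diff[OF linear_ocnj]
  and ocnj_minus = linear_neg[OF linear_ocnj]
  and ocnj_scaleR = linear_scale[OF linear_ocnj]
  and ocnj_zero [simp] = linear_0[OF linear_ocnj]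

lemma ocnj_ocnj [simp]: "ocnj (ocnj x) = x"
  by (cases x) simp

lemma ocnj_omult: "ocnj (omult x y) = omult (ocnj y) (ocnj x)"
  by (cases x; cases y) (simp add: algebra_simps)

lemma inner_ocnj [simp]: "inner (ocnj x) (ocnj y) = inner x y"
  by (cases x; cases y) (simp add: inner_complex_def)

lemma norm_ocnj [simp]: "norm (ocnj x) = norm x"
  by (simp add: norm_eq_sqrt_inner)

text \<open>A remnant of associativity that survives for octonions. With its mirror image and the
  polarizations below it gives the multiplicativity of the norm and the derivation property of
  \<open>rot_gen\<close>.\<close>

lemma omult_ocnj_left: "omult (ocnj x) (omult x y) = (norm x)\<^sup>2 *\<^sub>R y"
  unfolding power2_norm_eq_inner
  by (cases x; cases y) (simp add: complex_eq_iff inner_complex_def algebra_simps)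

lemma omult_ocnj_right: "omult (omult y x) (ocnj x) = (norm x)\<^sup>2 *\<^sub>R y"
proof -
  have "ocnj (omult (omult y x) (ocnj x)) = omult (ocnj (ocnj x)) (omult (ocnj x) (ocnj y))"
    by (simp add: ocnj_omult)
  also have "\<dots> = ocnj ((norm x)\<^sup>2 *\<^sub>R y)"
    by (simp only: omult_ocnj_left norm_ocnj ocnj_scaleR)
  finally show ?thesis by (metis ocnj_ocnj)
qed

lemma inner_omult_left: "inner (omult x y) z = inner y (omult (ocnj x) z)"
  by (cases x; cases y; cases z) (simp add: inner_complex_def algebra_simps)

lemma inner_omult_right: "inner (omult x y) z = inner x (omult z (ocnj y))"
  by (metis inner_ocnj inner_omult_left ocnj_ocnj ocnj_omult)

lemma omult_ocnj_left2:
  "omult (ocnj x) (omult z y) + omult (ocnj z) (omult x y) = (2 * inner x z) *\<^sub>R y"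
  using omult_ocnj_left[of "x + z" y] omult_ocnj_left[of x y] omult_ocnj_left[of z y]
  by (simp add: omult.add_left omult.add_right ocnj_add power2_norm_eq_inner inner_add_left
      inner_add_right inner_commute[of z x] algebra_simps)

lemma omult_ocnj_right2:
  "omult (omult y z) (ocnj x) + omult (omult y x) (ocnj z) = (2 * inner x z) *\<^sub>R y"
  using omult_ocnj_right[of y "x + z"] omult_ocnj_right[of y x] omult_ocnj_right[of y z]
  by (simp add: omult.add_left omult.add_right ocnj_add power2_norm_eq_inner inner_add_left
      inner_add_right inner_commute[of z x] algebra_simps)

lemma norm_omult: "norm (omult x y) = norm x * norm y"
proof -
  have "(norm (omult x y))\<^sup>2 = (norm x * norm y)\<^sup>2"
    by (simp add: power2_norm_eq_inner inner_omult_left[of x y] omult_ocnj_left[unfolded power2_norm_eq_inner] power_mult_distrib)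
  then show ?thesis by (simp add: power2_eq_iff_nonneg)
qed

definition oreal :: "real \<Rightarrow> oct"
  where "oreal r = oct_of_complex (complex_of_real r)"

lemma omult_oreal [simp]: "omult (oreal r) x = r *\<^sub>R x" "omult x (oreal r) = r *\<^sub>R x"
  by (cases x; simp add: oreal_def oct_of_complex_def scaleR_conv_of_real)+

lemma ocnj_oreal [simp]: "ocnj (oreal r) = oreal r"
  by (simp add: oreal_def oct_of_complex_def)

lemma oRe_oreal [simp]: "oRe (oreal r) = r"
  by (simp add: oreal_def oct_of_complex_def oRe_def)

lemma oreal_simps [simp]: "oreal 0 = 0" "oreal r + oreal s = oreal (r + s)"
  "oreal r - oreal s = oreal (r - s)" "s *\<^sub>R oreal r = oreal (s * r)" "- oreal r = oreal (- r)"
  "oreal r = oreal s \<longleftrightarrow> r = s"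
  "oreal r = 0 \<longleftrightarrow> r = 0"
  by (auto simp: oreal_def oct_of_complex_def zero_prod_def scaleR_conv_of_real)

lemma inner_oreal [simp]: "inner (oreal r) (oreal s) = r * s"
  by (simp add: oreal_def oct_of_complex_def inner_complex_def)

lemma norm_oreal [simp]: "norm (oreal r) = \<bar>r\<bar>"
  by (simp add: norm_eq_sqrt_inner)

lemma ocnj_eq_self_iff: "ocnj x = x \<longleftrightarrow> x = oreal (oRe x)"
  by (cases x) (auto simp: oreal_def oct_of_complex_def oRe_def complex_eq_iff zero_prod_def)

lemma add_ocnj: "x + ocnj x = oreal (2 * oRe x)"
  by (cases x) (auto simp: oreal_def oct_of_complex_def oRe_def complex_eq_iff zero_prod_def)

lemma oRe_omult_ocnj: "oRe (omult x (ocnj y)) = inner x y"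
  by (cases x; cases y) (simp add: oRe_def inner_complex_def)

lemma oRe_omult_ocnj': "oRe (omult (ocnj x) y) = inner x y"
  by (cases x; cases y) (simp add: oRe_def inner_complex_def)

lemma linear_oRe: "linear oRe"
  by (auto intro!: linearI simp: oRe_def)

lemmas oRe_add = linear_add[OF linear_oRe]
  and oRe_scaleR = linear_scale[OF linear_oRe]
  and oRe_zero [simp] = linear_0[OF linear_oRe]

lemma add_omult_ocnj: "omult x (ocnj y) + omult y (ocnj x) = oreal (2 * inner x y)"
  using add_ocnj[of "omult x (ocnj y)"] by (simp add: ocnj_omult oRe_omult_ocnj)

lemma add_omult_ocnj': "omult (ocnj x) y + omult (ocnj y) x = oreal (2 * inner x y)"
  using add_ocnj[of "omult (ocnj x) y"] by (simp add: ocnj_omult oRe_omult_ocnj')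

lemma mem_Alg_iff:
  "((a, b), (c, d)) \<in> Alg n \<longleftrightarrow>
    (n \<le> 2 \<longrightarrow> c = 0 \<and> d = 0) \<and> (n \<le> 1 \<longrightarrow> b = 0) \<and> (n = 0 \<longrightarrow> Im a = 0)"
proof -
  have "Im a = 0 \<longleftrightarrow> a \<in> range complex_of_real"
    by (metis Reals_def complex_is_Real_iff)
  then show ?thesis
    by (auto simp: Alg_def oreal_def oct_of_complex_def zero_prod_def image_iff)
qed

lemma subspace_Alg: "subspace (Alg n)"
  by (auto simp: subspace_def split_paired_all mem_Alg_iff zero_prod_def[where 'a=quat and 'b=quat]
      zero_prod_def[where 'a=complex and 'b=complex])

lemma oreal_Alg [simp]: "oreal r \<in> Alg n"
  by (simp add: mem_Alg_iff oreal_def oct_of_complex_def)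

lemma omult_Alg: "x \<in> Alg n \<Longrightarrow> y \<in> Alg n \<Longrightarrow> omult x y \<in> Alg n"
  by (cases x; cases y) (auto simp: mem_Alg_iff)

lemma ocnj_Alg_iff [simp]: "ocnj x \<in> Alg n \<longleftrightarrow> x \<in> Alg n"
  by (cases x) (auto simp: mem_Alg_iff)

text \<open>Feeds the associativity of matrix products over the first three algebras, hence the
  conjugation actions; for octonions the group is \<open>Aut_J 3\<close> instead.\<close>

lemma omult_assoc_Alg:
  assumes "n \<le> 2" "x \<in> Alg n" "y \<in> Alg n" "z \<in> Alg n"
  shows "omult (omult x y) z = omult x (omult y z)"
  using assms by (cases x; cases y; cases z) (simp add: mem_Alg_iff algebra_simps)

section \<open>Hermitian matrices in coordinates\<close>

text \<open>The off-diagonal entries are indexed cyclically: \<open>a\<close>, \<open>b\<close>, \<open>c\<close> stand at the positions 23, 31, 12.\<close>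

definition mk :: "real \<Rightarrow> real \<Rightarrow> real \<Rightarrow> oct \<Rightarrow> oct \<Rightarrow> oct \<Rightarrow> omat"
  where "mk x y z a b c = vector [vector [oreal x, c, ocnj b], vector [ocnj c, oreal y, a],
    vector [b, ocnj a, oreal z]]"

lemma mk_nth [simp]:
  "mk x y z a b c $ 1 $ 1 = oreal x" "mk x y z a b c $ 1 $ 2 = c" "mk x y z a b c $ 1 $ 3 = ocnj b"
  "mk x y z a b c $ 2 $ 1 = ocnj c" "mk x y z a b c $ 2 $ 2 = oreal y" "mk x y z a b c $ 2 $ 3 = a"
  "mk x y z a b c $ 3 $ 1 = b" "mk x y z a b c $ 3 $ 2 = ocnj a" "mk x y z a b c $ 3 $ 3 = oreal z"
  by (simp_all add: mk_def vector_3)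

lemma omat_eq_iff: "(A::omat) = B \<longleftrightarrow> (\<forall>i j. A $ i $ j = B $ i $ j)"
  by (auto simp: vec_eq_iff)

lemma mk_add: "mk x y z a b c + mk x' y' z' a' b' c' = mk (x+x') (y+y') (z+z') (a+a') (b+b') (c+c')"
  by (simp add: omat_eq_iff forall_3 ocnj_add)

lemma mk_diff: "mk x y z a b c - mk x' y' z' a' b' c' = mk (x-x') (y-y') (z-z') (a-a') (b-b') (c-c')"
  by (simp add: omat_eq_iff forall_3 ocnj_diff)

lemma mk_minus: "- mk x y z a b c = mk (-x) (-y) (-z) (-a) (-b) (-c)"
  by (simp add: omat_eq_iff forall_3 ocnj_minus)

lemma mk_scaleR: "r *\<^sub>R mk x y z a b c = mk (r*x) (r*y) (r*z) (r *\<^sub>R a) (r *\<^sub>R b) (r *\<^sub>R c)"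
  by (simp add: omat_eq_iff forall_3 ocnj_scaleR)

lemma mk_zero: "mk 0 0 0 0 0 0 = 0"
  by (simp add: omat_eq_iff forall_3)

lemma mk_eq_iff [simp]: "mk x y z a b c = mk x' y' z' a' b' c' \<longleftrightarrow>
    x = x' \<and> y = y' \<and> z = z' \<and> a = a' \<and> b = b' \<and> c = c'"
  by (auto simp: omat_eq_iff forall_3)

lemma mk_eq_0_iff [simp]: "mk x y z a b c = 0 \<longleftrightarrow> x = 0 \<and> y = 0 \<and> z = 0 \<and> a = 0 \<and> b = 0 \<and> c = 0"
  unfolding mk_zero[symmetric] mk_eq_iff ..

lemmas mk_arith = mk_add mk_diff mk_minus mk_scaleR

lemma mk_Herm_iff [simp]: "mk x y z a b c \<in> Herm n \<longleftrightarrow> a \<in> Alg n \<and> b \<in> Alg n \<and> c \<in> Alg n"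
  by (auto simp: Herm_def omat_eq_iff forall_3 adj_def)

lemma Herm_cases [consumes 1]:
  assumes "X \<in> Herm n"
  obtains x y z a b c where "X = mk x y z a b c" "a \<in> Alg n" "b \<in> Alg n" "c \<in> Alg n"
proof (rule that)
  have "ocnj (X $ j $ i) = X $ i $ j" for i j
    using assms by (simp add: Herm_def omat_eq_iff adj_def)
  then show "X = mk (oRe (X $ 1 $ 1)) (oRe (X $ 2 $ 2)) (oRe (X $ 3 $ 3))
      (X $ 2 $ 3) (X $ 3 $ 1) (X $ 1 $ 2)"
    by (simp add: omat_eq_iff forall_3 flip: ocnj_eq_self_iff)
qed (use assms in \<open>auto simp: Herm_def\<close>)

lemma oct_of_complex_1: "oct_of_complex 1 = oreal 1"
  by (simp add: oreal_def)

lemma one_mat_mk: "one_mat = mk 1 1 1 0 0 0"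
  by (simp add: one_mat_def oct_of_complex_1 omat_eq_iff forall_3)

lemma E_mat_mk: "E_mat = mk 1 0 0 0 0 0"
  by (simp add: E_mat_def oct_of_complex_1 omat_eq_iff forall_3)

lemma E_mat_Herm [simp]: "E_mat \<in> Herm n" and one_mat_Herm [simp]: "one_mat \<in> Herm n"
  by (simp_all add: E_mat_mk one_mat_mk subspace_0[OF subspace_Alg])

lemma subspace_Herm: "subspace (Herm n)"
proof (unfold subspace_def, safe)
  show "0 \<in> Herm n"
    using mk_Herm_iff[of 0 0 0 0 0 0 n] by (simp add: mk_zero subspace_0[OF subspace_Alg])
next
  fix X Y assume "X \<in> Herm n" "Y \<in> Herm n"
  then show "X + Y \<in> Herm n"
    by (elim Herm_cases) (simp add: mk_add subspace_add[OF subspace_Alg])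
next
  fix r X assume "X \<in> Herm n"
  then show "r *\<^sub>R X \<in> Herm n"
    by (elim Herm_cases) (simp add: mk_scaleR subspace_scale[OF subspace_Alg])
qed

lemmas Herm_add = subspace_add[OF subspace_Herm]
  and Herm_diff = subspace_diff[OF subspace_Herm]
  and Herm_minus = subspace_neg[OF subspace_Herm]
  and Herm_scaleR = subspace_scale[OF subspace_Herm]
  and Herm_0 [simp] = subspace_0[OF subspace_Herm]

lemmas Alg_add = subspace_add[OF subspace_Alg]
  and Alg_diff = subspace_diff[OF subspace_Alg]
  and Alg_minus = subspace_neg[OF subspace_Alg]
  and Alg_scaleR = subspace_scale[OF subspace_Alg]
  and Alg_0 [simp] = subspace_0[OF subspace_Alg]

lemma linear_tr: "linear tr"
  by (auto intro!: linearI simp: tr_def oRe_add oRe_scaleR sum.distrib sum_distrib_left)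

lemmas tr_add = linear_add[OF linear_tr]
  and tr_diff = linear_diff[OF linear_tr]
  and tr_minus = linear_neg[OF linear_tr]
  and tr_scaleR = linear_scale[OF linear_tr]
  and tr_zero [simp] = linear_0[OF linear_tr]

lemma tr_mk [simp]: "tr (mk x y z a b c) = x + y + z"
  by (simp add: tr_def sum_3)

lemma inner_mk: "inner (mk x y z a b c) (mk x' y' z' a' b' c') =
    x * x' + y * y' + z * z' + 2 * (inner a a' + inner b b' + inner c c')"
  by (simp add: inner_vec_def sum_3)

lemma norm_mk: "(norm (mk x y z a b c))\<^sup>2 =
    x\<^sup>2 + y\<^sup>2 + z\<^sup>2 + 2 * ((norm a)\<^sup>2 + (norm b)\<^sup>2 + (norm c)\<^sup>2)"
  unfolding power2_norm_eq_inner inner_mk by (simp add: power2_eq_square)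

lemma bilinear_mmult: "bilinear mmult"
  unfolding bilinear_def
  by (auto intro!: linearI simp: mmult_def vec_eq_iff omult.add_left omult.add_right
      omult.scaleR_left omult.scaleR_right sum.distrib scaleR_sum_right)

lemma bilinear_jprod: "bilinear jprod"
  unfolding bilinear_def
  by (auto intro!: linearI simp: jprod_def bilinear_ladd[OF bilinear_mmult] bilinear_radd[OF bilinear_mmult]
     bilinear_lmul[OF bilinear_mmult] bilinear_rmul[OF bilinear_mmult] algebra_simps)

lemma bounded_bilinear_jprod: "bounded_bilinear jprod"
  using bilinear_jprod by (simp add: bilinear_conv_bounded_bilinear)

declare omult.zero_left [simp] omult.zero_right [simp]

interpretation jprod: bounded_bilinear jprod
  by (rule bounded_bilinear_jprod)

lemmas jprod_linear = jprod.add_left jprod.add_right jprod.diff_left jprod.diff_right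
  jprod.scaleR_left jprod.scaleR_right jprod.minus_left jprod.minus_right

lemma jprod_commute: "jprod X Y = jprod Y X"
  by (simp add: jprod_def add.commute)

lemma half_add_ocnj: "(1/2) *\<^sub>R (x + ocnj x) = oreal (oRe x)"
  by (simp add: add_ocnj)

text \<open>Because the off-diagonal entries are numbered cyclically, the formula is invariant under
  a simultaneous shift of diagonal and off-diagonal entries. This makes \<open>cyc\<close> an
  automorphism.\<close>

lemma jprod_mk: "jprod (mk x y z a b c) (mk x' y' z' a' b' c') =
  mk (x * x' + inner b b' + inner c c') (y * y' + inner a a' + inner c c') (z * z' + inner a a' + inner b b')
    ((1/2) *\<^sub>R ((y + z) *\<^sub>R a' + (y' + z') *\<^sub>R a + ocnj (omult b c') + ocnj (omult b' c)))
    ((1/2) *\<^sub>R ((z + x) *\<^sub>R b' + (z' + x') *\<^sub>R b + ocnj (omult c a') + ocnj (omult c' a)))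
    ((1/2) *\<^sub>R ((x + y) *\<^sub>R c' + (x' + y') *\<^sub>R c + ocnj (omult a b') + ocnj (omult a' b)))"
  (is "jprod ?X ?Y = ?Z")
proof -
  \<comment> \<open>On the diagonal the entries of the two products are conjugate, so their mean is
    a real part, and real parts of products are inner products.\<close>
  have diag: "jprod ?X ?Y $ i $ i = oreal (oRe (mmult ?X ?Y $ i $ i))" for i
  proof -
    have "mmult ?Y ?X $ i $ i = ocnj (mmult ?X ?Y $ i $ i)"
      using exhaust_3[of i] by (auto simp: mmult_def sum_3 ocnj_add ocnj_scaleR ocnj_omult)
    then show ?thesis by (simp add: jprod_def half_add_ocnj)
  qed
  have "jprod ?X ?Y $ i $ j = ?Z $ i $ j" if "i \<noteq> j" for i j
    using that exhaust_3[of i] exhaust_3[of j]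
    by (elim disjE) (simp_all add: jprod_def mmult_def sum_3 ocnj_add ocnj_scaleR ocnj_omult algebra_simps)
  moreover have "jprod ?X ?Y $ i $ i = ?Z $ i $ i" for i
    unfolding diag using exhaust_3[of i]
    by (auto simp: mmult_def sum_3 oRe_add oRe_scaleR oRe_omult_ocnj oRe_omult_ocnj' inner_commute)
  ultimately show ?thesis
    unfolding omat_eq_iff by metis
qed

lemma jprod_Herm: "X \<in> Herm n \<Longrightarrow> Y \<in> Herm n \<Longrightarrow> jprod X Y \<in> Herm n"
  by (elim Herm_cases) (simp add: jprod_mk omult_Alg Alg_add Alg_scaleR)

lemma jprod_one [simp]: "X \<in> Herm n \<Longrightarrow> jprod one_mat X = X" "X \<in> Herm n \<Longrightarrow> jprod X one_mat = X"
  by (elim Herm_cases; simp add: one_mat_mk jprod_mk)+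

text \<open>The inner product is expressed by Jordan product and trace, so a trace-preserving
  automorphism is orthogonal.\<close>

lemma tr_jprod: "X \<in> Herm n \<Longrightarrow> Y \<in> Herm n \<Longrightarrow> tr (jprod X Y) = inner X Y"
  by (elim Herm_cases) (simp add: jprod_mk inner_mk)

lemma norm_sq_Herm: "X \<in> Herm n \<Longrightarrow> (norm X)\<^sup>2 = tr (jprod X X)"
  by (simp add: tr_jprod power2_norm_eq_inner)

section \<open>Basic automorphisms and derivations\<close>

text \<open>Conjugation by the permutation matrix \<open>cyc_mat\<close>, written in entries so that
  it makes sense for all \<open>n\<close>. It brings any pair of coordinates to the position where
  \<open>rot\<close> acts.\<close>

definition cyc :: "omat \<Rightarrow> omat"
  where "cyc X = vector [vector [X $ 2 $ 2, X $ 2 $ 3, X $ 2 $ 1],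
    vector [X $ 3 $ 2, X $ 3 $ 3, X $ 3 $ 1], vector [X $ 1 $ 2, X $ 1 $ 3, X $ 1 $ 1]]"

lemma cyc_mk [simp]: "cyc (mk x y z a b c) = mk y z x b c a"
  by (simp add: cyc_def omat_eq_iff forall_3 vector_3)

lemma linear_cyc: "linear cyc"
  by (auto intro!: linearI simp: cyc_def omat_eq_iff forall_3 vector_3)

text \<open>Up to the factor \<open>-1/4\<close> this is the commutator of the multiplications by \<open>E_mat\<close> and
  \<open>mk 0 0 0 0 0 u\<close>, that is, the infinitesimal rotation in the first two coordinates.\<close>

definition rot_gen :: "oct \<Rightarrow> omat \<Rightarrow> omat"
  where "rot_gen u X = mk (- 2 * inner u (X $ 1 $ 2)) (2 * inner u (X $ 1 $ 2)) 0
    (ocnj (omult (X $ 3 $ 1) u)) (- ocnj (omult u (X $ 2 $ 3)))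
    ((oRe (X $ 1 $ 1) - oRe (X $ 2 $ 2)) *\<^sub>R u)"

lemma rot_gen_mk [simp]: "rot_gen u (mk x y z a b c) =
    mk (- 2 * inner u c) (2 * inner u c) 0 (ocnj (omult b u)) (- ocnj (omult u a)) ((x - y) *\<^sub>R u)"
  by (simp add: rot_gen_def)

lemma linear_rot_gen: "linear (rot_gen u)"
  by (auto intro!: linearI simp: rot_gen_def mk_arith inner_add_right omult.add_left omult.add_right
      omult.scaleR_left omult.scaleR_right ocnj_add ocnj_scaleR oRe_add oRe_scaleR algebra_simps)

lemma rot_gen_Herm: "u \<in> Alg n \<Longrightarrow> X \<in> Herm n \<Longrightarrow> rot_gen u X \<in> Herm n"
  by (elim Herm_cases) (simp add: omult_Alg Alg_minus Alg_scaleR)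

text \<open>Squares involve a single matrix, which keeps the octonion identities to be checked
  short.\<close>

lemma polarize_derivation:
  assumes "linear D" "\<And>X. X \<in> Herm n \<Longrightarrow> D (jprod X X) = 2 *\<^sub>R jprod X (D X)"
    and "X \<in> Herm n" "Y \<in> Herm n"
  shows "D (jprod X Y) = jprod (D X) Y + jprod X (D Y)"
proof -
  have "jprod (X + Y) (X + Y) = jprod X X + jprod Y Y + 2 *\<^sub>R jprod X Y"
    by (simp add: jprod_linear jprod_commute[of Y X] scaleR_2)
  then have "D (jprod (X + Y) (X + Y)) = D (jprod X X) + D (jprod Y Y) + 2 *\<^sub>R D (jprod X Y)"
    by (simp add: linear_add[OF assms(1)] linear_scale[OF assms(1)])
  moreover have "2 *\<^sub>R jprod (X + Y) (D (X + Y)) =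
      2 *\<^sub>R jprod X (D X) + 2 *\<^sub>R jprod Y (D Y) + 2 *\<^sub>R (jprod (D X) Y + jprod X (D Y))"
    by (simp add: jprod_linear linear_add[OF assms(1)] jprod_commute[of Y] algebra_simps)
  ultimately have "2 *\<^sub>R D (jprod X Y) = 2 *\<^sub>R (jprod (D X) Y + jprod X (D Y))"
    using assms(2)[of X] assms(2)[of Y] assms(2)[of "X + Y"] assms(3,4) by (simp add: Herm_add)
  then show ?thesis
    by (metis scaleR_cancel_left zero_neq_numeral)
qed

lemma jprod_mk_self: "jprod (mk x y z a b c) (mk x y z a b c) =
  mk (x\<^sup>2 + (norm b)\<^sup>2 + (norm c)\<^sup>2) (y\<^sup>2 + (norm a)\<^sup>2 + (norm c)\<^sup>2) (z\<^sup>2 + (norm a)\<^sup>2 + (norm b)\<^sup>2)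
    ((y + z) *\<^sub>R a + ocnj (omult b c)) ((z + x) *\<^sub>R b + ocnj (omult c a)) ((x + y) *\<^sub>R c + ocnj (omult a b))"
proof -
  have *: "(1/2) *\<^sub>R (p + p + q + q) = p + q" for p q :: oct
    by (simp add: algebra_simps flip: scaleR_2)
  show ?thesis
    unfolding jprod_mk mk_eq_iff * power2_norm_eq_inner by (simp add: power2_eq_square)
qed

text \<open>The form Re((ab)c) is cyclically invariant although the product is not associative; this
  rests on the adjunction of multiplications by conjugate elements.\<close>

lemma inner_omult_cyc:
  "inner (omult a b) (ocnj c) = inner (omult b c) (ocnj a)"
  "inner (omult a b) (ocnj c) = inner (omult c a) (ocnj b)"
proof -
  show "inner (omult a b) (ocnj c) = inner (omult b c) (ocnj a)" for a b c
    by (metis inner_commute inner_ocnj inner_omult_left inner_omult_right ocnj_ocnj)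
  from this[of c a b] show "inner (omult a b) (ocnj c) = inner (omult c a) (ocnj b)" by simp
qed

lemma rot_gen_jprod:
  assumes "X \<in> Herm n" "Y \<in> Herm n"
  shows "rot_gen u (jprod X Y) = jprod (rot_gen u X) Y + jprod X (rot_gen u Y)"
proof (rule polarize_derivation[OF linear_rot_gen _ assms])
  fix X assume "X \<in> Herm n"
  then show "rot_gen u (jprod X X) = 2 *\<^sub>R jprod X (rot_gen u X)"
  proof (elim Herm_cases)
    fix x y z a b c assume X: "X = mk x y z a b c"
    have 1: "inner u (ocnj (omult a b)) = inner a (ocnj (omult b u))"
      "inner b (ocnj (omult u a)) = inner a (ocnj (omult b u))"
      using inner_omult_cyc[of a b u] by (metis inner_commute inner_ocnj ocnj_ocnj)+
    \<comment> \<open>The polarized cancellation law moves \<open>u\<close> past \<open>c\<close> at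
      the price of a real multiple of \<open>a\<close>; nothing is reassociated.\<close>
    have 2: "ocnj (omult (ocnj (omult c a)) u) = (2 * inner u c) *\<^sub>R a - omult (ocnj c) (omult u a)"
      using omult_ocnj_left2[of u c a] by (simp add: ocnj_omult eq_diff_eq)
    have 4: "ocnj (omult u (ocnj (omult b c))) = (2 * inner u c) *\<^sub>R b - omult (omult b u) (ocnj c)"
      using omult_ocnj_right2[of b c u] by (simp add: ocnj_omult eq_diff_eq)
    have 5: "ocnj (omult (ocnj (omult u a)) c) = omult (ocnj c) (omult u a)"
      "ocnj (omult c (ocnj (omult b u))) = omult (omult b u) (ocnj c)"
      "ocnj (omult a (ocnj (omult u a))) = (norm a)\<^sup>2 *\<^sub>R u"
      "ocnj (omult (ocnj (omult b u)) b) = (norm b)\<^sup>2 *\<^sub>R u"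
      by (simp_all add: ocnj_omult omult_ocnj_left omult_ocnj_right)
    show ?thesis
      unfolding X jprod_mk_self jprod_mk rot_gen_mk mk_scaleR mk_eq_iff
      by (intro conjI; simp add: 1 2 4 5 inner_add_right inner_commute[of c u] omult.add_left omult.add_right omult.scaleR_left omult.scaleR_right omult.minus_left omult.minus_right ocnj_add ocnj_minus ocnj_scaleR;
        (simp add: algebra_simps power2_eq_square)?)
  qed
qed

section \<open>Exponentials of linear maps\<close>

text \<open>Stated for an arbitrary subspace so that \<open>Herm n\<close> and
  \<open>HermC n\<close> share the results on flows.\<close>

definition linear_within :: "'a::real_vector set \<Rightarrow> ('a \<Rightarrow> 'a) \<Rightarrow> bool"
  where "linear_within V f \<longleftrightarrow> f \<in> V \<rightarrow> V \<and> (\<forall>x\<in>V. \<forall>y\<in>V. f (x + y) = f x + f y) \<and>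
    (\<forall>x\<in>V. \<forall>c. f (c *\<^sub>R x) = c *\<^sub>R f x)"

text \<open>Outside \<open>V\<close> the map is arbitrary; a linear extension is bounded, which is
  what the estimates and power series below require.\<close>

lemma linear_within_extend:
  fixes f :: "'a::real_vector \<Rightarrow> 'a"
  assumes "subspace V" "linear_within V f"
  obtains L where "linear L" "\<And>x. x \<in> V \<Longrightarrow> L x = f x"
proof -
  obtain B where B: "B \<subseteq> V" "independent B" "V \<subseteq> span B"
    by (rule maximal_independent_subset)
  have sp: "span B = V"
    using B span_minimal[OF B(1) assms(1)] by (intro subset_antisym)
  obtain L where L: "linear L" "\<forall>x\<in>B. L x = f x"
    using linear_independent_extend[OF B(2), of f] by blast
  have add: "f (x + y) = f x + f y" if "x \<in> V" "y \<in> V" for x y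
    using assms(2) that by (simp add: linear_within_def)
  have scale: "f (c *\<^sub>R x) = c *\<^sub>R f x" if "x \<in> V" for c x
    using assms(2) that by (simp add: linear_within_def)
  note V0 = subspace_0[OF assms(1)]
  have "x \<in> V \<and> L x = f x" if "x \<in> span B" for x
    using that
  proof (induction rule: span_induct_alt)
    case base
    show ?case using scale[OF V0, of 0] by (simp add: linear_0[OF L(1)] V0)
  next
    case (step c x y)
    have x: "x \<in> V" "c *\<^sub>R x \<in> V" using step(1) B(1) subspace_scale[OF assms(1)] by auto
    show ?case
      using L(2) step x
      by (simp add: add scale linear_add[OF L(1)] linear_scale[OF L(1)] subspace_add[OF assms(1)])
  qed
  then show ?thesis using that[OF L(1)] sp by simp
qed

definition flow :: "('a::real_normed_vector \<Rightarrow> 'a) \<Rightarrow> 'a set \<Rightarrow> (real \<Rightarrow> 'a) \<Rightarrow> bool"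
  where "flow \<xi> V f \<longleftrightarrow> (\<forall>t. f t \<in> V \<and> (f has_vector_derivative \<xi> (f t)) (at t))"

section \<open>Uniqueness for linear differential equations\<close>

lemma linear_ode_zero_pos:
  fixes L :: "'a::euclidean_space \<Rightarrow> 'a"
  assumes "linear L" "\<And>t. (h has_vector_derivative L (h t)) (at t)" "h 0 = 0" "t \<ge> 0"
  shows "h t = 0"
proof -
  obtain B where B: "\<And>x. norm (L x) \<le> B * norm x"
    using linear_bounded[OF assms(1)] by blast
  \<comment> \<open>Gronwall's argument: with the exponential weight the squared norm cannot
    increase.\<close>
  define m where "m = (\<lambda>t. inner (h t) (h t) * exp (- 2 * B * t))"
  have "m t \<le> m 0"
  proof (rule DERIV_nonpos_imp_nonincreasing[OF assms(4)])
    fix s :: real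
    have h: "(h has_derivative (\<lambda>r. r *\<^sub>R L (h s))) (at s)"
      using assms(2) unfolding has_vector_derivative_def by blast
    have "((\<lambda>t. inner (h t) (h t)) has_real_derivative 2 * inner (h s) (L (h s))) (at s)"
      by (rule has_derivative_imp_has_field_derivative[OF has_derivative_inner[OF h h]])
        (simp add: inner_commute)
    then have "(m has_real_derivative
        (2 * inner (h s) (L (h s)) - 2 * B * inner (h s) (h s)) * exp (- 2 * B * s)) (at s)"
      unfolding m_def by (auto intro!: derivative_eq_intros simp: left_diff_distrib)
    moreover have "inner (h s) (L (h s)) \<le> B * inner (h s) (h s)"
    proof -
      have "inner (h s) (L (h s)) \<le> norm (h s) * norm (L (h s))"
        by (rule norm_cauchy_schwarz)
      also have "\<dots> \<le> norm (h s) * (B * norm (h s))"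
        by (intro mult_left_mono B) auto
      finally show ?thesis
        by (simp add: dot_square_norm power2_eq_square mult_ac)
    qed
    then have "(2 * inner (h s) (L (h s)) - 2 * B * inner (h s) (h s)) * exp (- 2 * B * s) \<le> 0"
      by (intro mult_nonpos_nonneg) simp_all
    ultimately show "\<exists>y. (m has_real_derivative y) (at s) \<and> y \<le> 0"
      by blast
  qed
  then have "inner (h t) (h t) * exp (- 2 * B * t) \<le> 0"
    using assms(3) by (simp add: m_def)
  then have "\<not> 0 < inner (h t) (h t)"
    by (metis exp_gt_zero linorder_not_less mult_pos_pos)
  then show ?thesis
    by (simp only: inner_gt_zero_iff not_not)
qed

lemma linear_ode_zero:
  fixes L :: "'a::euclidean_space \<Rightarrow> 'a"
  assumes "linear L" "\<And>t. (h has_vector_derivative L (h t)) (at t)" "h 0 = 0"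
  shows "h t = 0"
proof (cases "t \<ge> 0")
  case True
  then show ?thesis using linear_ode_zero_pos[OF assms] by blast
next
  case False
  have "((h \<circ> uminus) has_vector_derivative - L ((h \<circ> uminus) s)) (at s)" for s
  proof -
    have "(uminus has_vector_derivative - 1) (at s)"
      by (auto intro!: derivative_eq_intros)
    from vector_diff_chain_at[OF this assms(2)] show ?thesis by simp
  qed
  from linear_ode_zero_pos[OF linear_compose_neg[OF assms(1)] this, of "- t"] False assms(3)
  show ?thesis by simp
qed

text \<open>The principle behind all statements on exponentials: two curves built from group
  elements agree once they solve the same linear equation with the same initial value.\<close>

lemma flow_unique:
  fixes \<xi> :: "'a::euclidean_space \<Rightarrow> 'a"
  assumes "subspace V" "linear_within V \<xi>" "flow \<xi> V f" "flow \<xi> V g" "f 0 = g 0"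
  shows "f t = g t"
proof -
  obtain L where L: "linear L" "\<And>x. x \<in> V \<Longrightarrow> L x = \<xi> x"
    using linear_within_extend[OF assms(1,2)] by blast
  have "((\<lambda>t. f t - g t) has_vector_derivative L (f t - g t)) (at t)" for t
  proof -
    have "L (f t - g t) = \<xi> (f t) - \<xi> (g t)"
      using assms(3,4) L(2) by (simp add: linear_diff[OF L(1)] flow_def)
    then show ?thesis using assms(3,4) by (simp add: flow_def has_vector_derivative_diff)
  qed
  from linear_ode_zero[OF L(1) this] assms(5) show ?thesis by simp
qed

section \<open>The exponential series as a solution\<close>

lemma linear_exp_series:
  fixes L :: "'a::euclidean_space \<Rightarrow> 'a"
    and x :: 'a
  assumes "linear L"
  defines "F \<equiv> \<lambda>t. \<Sum>k. (t ^ k) *\<^sub>R ((L ^^ k) x /\<^sub>R fact k)"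
  shows "summable (\<lambda>k. (t ^ k) *\<^sub>R ((L ^^ k) x /\<^sub>R fact k))"
    and "(F has_vector_derivative L (F t)) (at t)"
proof -
  obtain B where B: "B > 0" "\<And>x. norm (L x) \<le> B * norm x"
    using linear_bounded_pos[OF assms(1)] by blast
  have pw: "norm ((L ^^ k) x) \<le> B ^ k * norm x" for k x
  proof (induction k)
    case (Suc k)
    have "norm ((L ^^ Suc k) x) \<le> B * norm ((L ^^ k) x)" using B(2) by simp
    also have "\<dots> \<le> B * (B ^ k * norm x)" using Suc B(1) by simp
    finally show ?case by (simp add: mult_ac)
  qed simp
  have sm: "summable (\<lambda>k. (t ^ k) *\<^sub>R ((L ^^ k) x /\<^sub>R fact k))" for t x
  proof (rule summable_comparison_test')
    show "summable (\<lambda>k. norm x * (inverse (fact k) * (\<bar>t\<bar> * B) ^ k))"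
      by (intro summable_mult summable_exp)
    fix k :: nat
    have "norm ((t ^ k) *\<^sub>R ((L ^^ k) x /\<^sub>R fact k)) = \<bar>t\<bar> ^ k * inverse (fact k) * norm ((L ^^ k) x)"
      by (simp add: power_abs abs_mult)
    also have "\<dots> \<le> \<bar>t\<bar> ^ k * inverse (fact k) * (B ^ k * norm x)"
      by (intro mult_left_mono pw) auto
    finally show "norm ((t ^ k) *\<^sub>R ((L ^^ k) x /\<^sub>R fact k)) \<le> norm x * (inverse (fact k) * (\<bar>t\<bar> * B) ^ k)"
      by (simp add: power_mult_distrib mult_ac)
  qed
  then show "summable (\<lambda>k. (t ^ k) *\<^sub>R ((L ^^ k) x /\<^sub>R fact k))" .
  have bl: "bounded_linear L" using assms(1) by (simp add: linear_conv_bounded_linear)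
  have LF: "L (F t) = (\<Sum>k. (t ^ k) *\<^sub>R ((L ^^ Suc k) x /\<^sub>R fact k))" for t
    using bounded_linear.suminf[OF bl sm[of t x]]
    unfolding F_def funpow.simps o_apply by (simp only: linear_scale[OF assms(1)])
  have comp: "inner (\<Sum>k. (t ^ k) *\<^sub>R (y k /\<^sub>R fact k)) b = (\<Sum>k. (inner (y k) b / fact k) * t ^ k)"
    if "summable (\<lambda>k. (t ^ k) *\<^sub>R (y k /\<^sub>R fact k))" for t b and y :: "nat \<Rightarrow> 'a"
    using bounded_linear.suminf[OF bounded_linear_inner_left[of b] that]
    by (simp add: divide_inverse mult_ac)
  have smb: "summable (\<lambda>k. (inner ((L ^^ k) x) b / fact k) * t ^ k)" for t b x
    using bounded_linear.summable[OF bounded_linear_inner_left[of b] sm[of t x]] by (simp add: divide_inverse mult_ac)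
  \<comment> \<open>Pairing with a fixed vector turns the series into a real power series, which can
    be differentiated termwise.\<close>
  have "((\<lambda>t. inner (F t) b) has_real_derivative inner (L (F t)) b) (at t)" for b
  proof -
    define c where "c = (\<lambda>k. inner ((L ^^ k) x) b / fact k)"
    have d: "diffs c = (\<lambda>k. inner ((L ^^ Suc k) x) b / fact k)"
      by (simp add: c_def diffs_def fun_eq_iff del: of_nat_Suc)
    have "((\<lambda>t. \<Sum>k. c k * t ^ k) has_real_derivative (\<Sum>k. diffs c k * t ^ k)) (at t)"
      by (rule termdiffs_strong_converges_everywhere) (simp only: c_def smb)
    moreover have "(\<lambda>t. \<Sum>k. c k * t ^ k) = (\<lambda>t. inner (F t) b)"
      unfolding F_def c_def by (intro ext comp[OF sm, symmetric])
    moreover have "(\<Sum>k. diffs c k * t ^ k) = inner (L (F t)) b"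
      unfolding d LF by (rule comp[symmetric]) (use sm[of t "L x"] in \<open>simp only: funpow.simps o_apply funpow_swap1\<close>)
    ultimately show ?thesis by simp
  qed
  then show "(F has_vector_derivative L (F t)) (at t)"
    unfolding has_vector_derivative_def has_field_derivative_def
      has_derivative_componentwise_within[of F] by (simp add: mult_commute_abs)
qed

lemma flow_op_exp:
  fixes \<xi> :: "omat \<times> omat \<Rightarrow> omat \<times> omat"
  assumes "subspace V" "linear_within V \<xi>" "x \<in> V"
  obtains f where "flow \<xi> V f" "f 0 = x" "f 1 = op_exp \<xi> x"
proof -
  obtain L where L: "linear L" "\<And>x. x \<in> V \<Longrightarrow> L x = \<xi> x"
    using linear_within_extend[OF assms(1,2)] by blast
  have pw: "(\<xi> ^^ k) x = (L ^^ k) x \<and> (L ^^ k) x \<in> V" for k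
    using assms(2,3) L(2) by (induction k) (auto simp: linear_within_def)
  define F where "F = (\<lambda>t. \<Sum>k. (t ^ k) *\<^sub>R ((L ^^ k) x /\<^sub>R fact k))"
  have mem: "F t \<in> V" for t
  proof -
    have "(\<lambda>m. \<Sum>k<m. (t ^ k) *\<^sub>R ((L ^^ k) x /\<^sub>R fact k)) \<longlonglongrightarrow> F t"
      unfolding F_def by (rule summable_LIMSEQ[OF linear_exp_series(1)[OF L(1)]])
    from closed_sequentially[OF closed_subspace[OF assms(1)] _ this] show ?thesis
      by (simp add: subspace_sum subspace_scale assms(1) pw)
  qed
  show ?thesis
  proof
    show "flow \<xi> V F"
      using mem linear_exp_series(2)[OF L(1), of x] L(2) unfolding flow_def F_def
      by simp
    \<comment> \<open>Only the constant term remains at time 0, by the convention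
      \<open>0 ^ 0 = 1\<close>.\<close>
    have "(\<lambda>k. (0 ^ k) *\<^sub>R ((L ^^ k) x /\<^sub>R fact k)) = (\<lambda>k. if k = 0 then x else 0)"
      by (auto simp: fun_eq_iff)
    then show "F 0 = x"
      unfolding F_def using suminf_finite[of "{0}" "\<lambda>k. if k = 0 then x else 0"] by simp
    show "F 1 = op_exp \<xi> x"
      by (simp add: F_def op_exp_def pw)
  qed
qed

lemma op_exp_eqI:
  assumes "subspace V" "linear_within V \<xi>" "flow \<xi> V f"
  shows "op_exp \<xi> (f 0) = f 1"
proof -
  have "f 0 \<in> V" using assms(3) by (simp add: flow_def)
  from flow_op_exp[OF assms(1,2) this] show ?thesis
    using flow_unique[OF assms(1,2,3)] by metis
qed

section \<open>Rotations and the spectral theorem\<close>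

text \<open>For a unit octonion \<open>u\<close> this is the exponential of \<open>t\<close> times
  \<open>rot_gen u\<close> in closed form. The pair formed by half the difference of the first two
  diagonal entries and the component of the entry 12 along \<open>u\<close> turns by
  \<open>2 * t\<close>, the entries 23 and 31 mix with angle \<open>t\<close>, and the rest of the
  entry 12 is fixed.\<close>

definition rot :: "real \<Rightarrow> oct \<Rightarrow> omat \<Rightarrow> omat"
  where "rot t u X =
    (let x = oRe (X $ 1 $ 1); y = oRe (X $ 2 $ 2); v = inner u (X $ 1 $ 2);
         w = (x - y) / 2 * cos (2 * t) - v * sin (2 * t)
     in mk ((x + y) / 2 + w) ((x + y) / 2 - w) (oRe (X $ 3 $ 3))
        (cos t *\<^sub>R X $ 2 $ 3 + sin t *\<^sub>R ocnj (omult (X $ 3 $ 1) u))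
        (cos t *\<^sub>R X $ 3 $ 1 - sin t *\<^sub>R ocnj (omult u (X $ 2 $ 3)))
        (X $ 1 $ 2 + (v * cos (2 * t) + (x - y) / 2 * sin (2 * t) - v) *\<^sub>R u))"

lemma rot_mk: "rot t u (mk x y z a b c) =
    mk ((x + y) / 2 + ((x - y) / 2 * cos (2 * t) - inner u c * sin (2 * t)))
       ((x + y) / 2 - ((x - y) / 2 * cos (2 * t) - inner u c * sin (2 * t))) z
       (cos t *\<^sub>R a + sin t *\<^sub>R ocnj (omult b u)) (cos t *\<^sub>R b - sin t *\<^sub>R ocnj (omult u a))
       (c + (inner u c * cos (2 * t) + (x - y) / 2 * sin (2 * t) - inner u c) *\<^sub>R u)"
  by (simp add: rot_def Let_def)

lemma linear_rot: "linear (rot t u)"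
  by (auto intro!: linearI simp: rot_def Let_def mk_arith oRe_add oRe_scaleR omult.add_left
      omult.add_right omult.scaleR_left omult.scaleR_right ocnj_add ocnj_scaleR inner_add_right
      algebra_simps add_divide_distrib diff_divide_distrib)

lemma rot_Herm: "u \<in> Alg n \<Longrightarrow> X \<in> Herm n \<Longrightarrow> rot t u X \<in> Herm n"
  by (elim Herm_cases) (simp add: rot_mk omult_Alg Alg_add Alg_scaleR Alg_diff)

lemma linear_mk: "linear (\<lambda>(x, y, z, a, b, c). mk x y z a b c)"
  by (auto intro!: linearI simp: mk_arith)

lemma has_vector_derivative_mk [derivative_intros]:
  assumes "(x has_vector_derivative x') (at s)" "(y has_vector_derivative y') (at s)" "(z has_vector_derivative z') (at s)"
    "(a has_vector_derivative a') (at s)" "(b has_vector_derivative b') (at s)" "(c has_vector_derivative c') (at s)"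
  shows "((\<lambda>t. mk (x t) (y t) (z t) (a t) (b t) (c t)) has_vector_derivative mk x' y' z' a' b' c') (at s)"
proof -
  have "bounded_linear (\<lambda>(x, y, z, a, b, c). mk x y z a b c)"
    using linear_mk by (simp add: linear_conv_bounded_linear)
  moreover have "((\<lambda>t. (x t, y t, z t, a t, b t, c t)) has_vector_derivative (x', y', z', a', b', c')) (at s)"
    using assms unfolding has_vector_derivative_def scaleR_Pair by (auto intro!: has_derivative_Pair)
  ultimately show ?thesis
    using bounded_linear.has_vector_derivative by fastforce
qed

lemma linear_within_linear: "linear f \<Longrightarrow> f \<in> V \<rightarrow> V \<Longrightarrow> linear_within V f"
  by (simp add: linear_within_def linear_add linear_scale)

lemma flow_shift: "flow \<xi> V f \<Longrightarrow> flow \<xi> V (\<lambda>t. f (t + s))"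
  unfolding flow_def
proof safe
  fix t assume *: "\<forall>t. f t \<in> V \<and> (f has_vector_derivative \<xi> (f t)) (at t)"
  show "f (t + s) \<in> V" using * by blast
  have "((\<lambda>t. t + s) has_vector_derivative 1) (at t)" by (auto intro!: derivative_eq_intros)
  from vector_diff_chain_at[OF this, of f] * show "((\<lambda>t. f (t + s)) has_vector_derivative \<xi> (f (t + s))) (at t)"
    by (simp add: o_def)
qed

lemma unit_elementsD: "u \<in> unit_elements n \<Longrightarrow> u \<in> Alg n" "u \<in> unit_elements n \<Longrightarrow> norm u = 1"
  by (auto simp: unit_elements_def)

lemma flow_rot:
  assumes u: "u \<in> unit_elements n" and X: "X \<in> Herm n"
  shows "flow (rot_gen u) (Herm n) (\<lambda>t. rot t u X)"
proof -
  have 1: "norm u = 1" "inner u u = 1" using u by (auto simp: unit_elements_def dot_square_norm)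
  obtain x y z a b c where X': "X = mk x y z a b c" using X by (elim Herm_cases)
  have 2: "omult (ocnj u) (omult u a) = a" "omult (omult b u) (ocnj u) = b"
    using omult_ocnj_left[of u a] omult_ocnj_right[of b u] 1 by simp_all
  have r: "((\<lambda>t. p + (w * cos (2 * t) - v * sin (2 * t))) has_vector_derivative
        - 2 * (v * cos (2 * t) + w * sin (2 * t))) (at t)"
    "((\<lambda>t. p - (w * cos (2 * t) - v * sin (2 * t))) has_vector_derivative
        2 * (v * cos (2 * t) + w * sin (2 * t))) (at t)"
    "((\<lambda>t. v * cos (2 * t) + w * sin (2 * t) - v) has_field_derivative
        2 * (w * cos (2 * t) - v * sin (2 * t))) (at t)" for p v w t :: real
    unfolding has_real_derivative_iff_has_vector_derivative[symmetric]
    by (auto intro!: derivative_eq_intros simp: algebra_simps)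
  have s: "((\<lambda>t. cos t *\<^sub>R p + sin t *\<^sub>R q) has_vector_derivative cos t *\<^sub>R q - sin t *\<^sub>R p) (at t)"
    "((\<lambda>t. cos t *\<^sub>R p - sin t *\<^sub>R q) has_vector_derivative - (cos t *\<^sub>R q + sin t *\<^sub>R p)) (at t)"
    for p q :: oct and t
    by (auto intro!: derivative_eq_intros simp: algebra_simps)
  have c: "((\<lambda>t. p + f t *\<^sub>R q) has_vector_derivative f' *\<^sub>R q) (at t)"
    if "(f has_field_derivative f') (at t)" for f f' t and p q :: oct
    using that by (auto intro!: derivative_eq_intros)
  have "((\<lambda>t. rot t u X) has_vector_derivative rot_gen u (rot t u X)) (at t)" for t
    unfolding X' rot_mk rot_gen_mk
    by (rule has_vector_derivative_eq_rhs, (rule has_vector_derivative_mk r s c has_vector_derivative_const)+)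
       (simp add: 1 2 inner_add_right ocnj_omult omult.add_left omult.add_right omult.diff_left omult.diff_right
          omult.scaleR_left omult.scaleR_right ocnj_add ocnj_diff ocnj_scaleR)
  then show ?thesis
    using u X by (auto simp: flow_def unit_elements_def intro: rot_Herm)
qed

lemma rot_0: "X \<in> Herm n \<Longrightarrow> rot 0 u X = X"
  by (elim Herm_cases) (simp add: rot_mk field_simps)

text \<open>Both sides solve the equation of \<open>rot_gen u\<close>, because
  \<open>rot_gen u\<close> is a derivation; trigonometric identities and octonion products never
  meet.\<close>

lemma rot_jprod:
  assumes "u \<in> unit_elements n" "X \<in> Herm n" "Y \<in> Herm n"
  shows "rot t u (jprod X Y) = jprod (rot t u X) (rot t u Y)"
proof -
  note u = unit_elementsD[OF assms(1)]
  show ?thesis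
  proof (rule flow_unique[OF subspace_Herm linear_within_linear[OF linear_rot_gen]])
    show "rot_gen u \<in> Herm n \<rightarrow> Herm n" using rot_gen_Herm u by blast
    show "flow (rot_gen u) (Herm n) (\<lambda>t. rot t u (jprod X Y))"
      by (intro flow_rot jprod_Herm assms)
    show "flow (rot_gen u) (Herm n) (\<lambda>t. jprod (rot t u X) (rot t u Y))"
      unfolding flow_def
    proof safe
      fix t
      show "jprod (rot t u X) (rot t u Y) \<in> Herm n" by (intro rot_Herm jprod_Herm assms u)
      have "((\<lambda>t. jprod (rot t u X) (rot t u Y)) has_vector_derivative
         jprod (rot t u X) (rot_gen u (rot t u Y)) + jprod (rot_gen u (rot t u X)) (rot t u Y)) (at t)"
        using flow_rot[OF assms(1,2)] flow_rot[OF assms(1,3)] unfolding flow_def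
        by (intro jprod.has_vector_derivative) auto
      then show "((\<lambda>t. jprod (rot t u X) (rot t u Y)) has_vector_derivative
         rot_gen u (jprod (rot t u X) (rot t u Y))) (at t)"
        by (simp add: rot_gen_jprod[OF rot_Herm[OF u(1) assms(2)] rot_Herm[OF u(1) assms(3)]] add.commute)
    qed
    show "rot 0 u (jprod X Y) = jprod (rot 0 u X) (rot 0 u Y)"
      by (simp add: rot_0[of _ n] assms jprod_Herm)
  qed
qed

lemma rot_rot:
  assumes "u \<in> unit_elements n" "X \<in> Herm n"
  shows "rot s u (rot t u X) = rot (s + t) u X"
proof -
  note u = unit_elementsD[OF assms(1)]
  have "rot_gen u \<in> Herm n \<rightarrow> Herm n" using rot_gen_Herm u by blast
  from flow_unique[OF subspace_Herm linear_within_linear[OF linear_rot_gen this]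
     flow_rot[OF assms(1) rot_Herm[OF u(1) assms(2), of t]] flow_shift[OF flow_rot[OF assms]]]
  show ?thesis by (simp add: rot_0[of _ n] rot_Herm u assms)
qed


lemma cyc_Herm: "X \<in> Herm n \<Longrightarrow> cyc X \<in> Herm n"
  by (elim Herm_cases) simp

lemma cyc_jprod: "X \<in> Herm n \<Longrightarrow> Y \<in> Herm n \<Longrightarrow> cyc (jprod X Y) = jprod (cyc X) (cyc Y)"
  by (elim Herm_cases) (simp add: jprod_mk add_ac)

lemma cyc_cyc_cyc: "X \<in> Herm n \<Longrightarrow> cyc (cyc (cyc X)) = X"
  by (elim Herm_cases) simp

inductive_set rotations :: "nat \<Rightarrow> (omat \<Rightarrow> omat) set" for n
  where
    rotations_id: "(\<lambda>X. X) \<in> rotations n"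
  | rotations_rot: "g \<in> rotations n \<Longrightarrow> u \<in> unit_elements n \<Longrightarrow> (\<lambda>X. rot t u (g X)) \<in> rotations n"
  | rotations_cyc: "g \<in> rotations n \<Longrightarrow> (\<lambda>X. cyc (g X)) \<in> rotations n"

lemma rotations_comp: "g \<in> rotations n \<Longrightarrow> h \<in> rotations n \<Longrightarrow> (\<lambda>X. g (h X)) \<in> rotations n"
  by (induction rule: rotations.induct) (auto intro: rotations.intros)

lemma linear_rotations: "g \<in> rotations n \<Longrightarrow> linear g"
  by (induction rule: rotations.induct)
    (auto intro: linear_id[unfolded id_def] linear_compose[OF _ linear_rot, unfolded o_def]
      linear_compose[OF _ linear_cyc, unfolded o_def])

lemma rotations_Herm: "g \<in> rotations n \<Longrightarrow> X \<in> Herm n \<Longrightarrow> g X \<in> Herm n"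
  by (induction rule: rotations.induct) (auto intro: rot_Herm cyc_Herm unit_elementsD)

lemma rotations_jprod:
  "g \<in> rotations n \<Longrightarrow> X \<in> Herm n \<Longrightarrow> Y \<in> Herm n \<Longrightarrow> g (jprod X Y) = jprod (g X) (g Y)"
  by (induction rule: rotations.induct) (auto simp: rot_jprod cyc_jprod[of _ n] rotations_Herm)

lemma rotations_tr: "g \<in> rotations n \<Longrightarrow> X \<in> Herm n \<Longrightarrow> tr (g X) = tr X"
proof (induction rule: rotations.induct)
  case (rotations_rot g u t)
  have "tr (rot t u Y) = tr Y" if "Y \<in> Herm n" for Y
    using that by (elim Herm_cases) (simp add: rot_mk)
  then show ?case using rotations_rot by (simp add: rotations_Herm)
next
  case (rotations_cyc g)
  have "tr (cyc Y) = tr Y" if "Y \<in> Herm n" for Y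
    using that by (elim Herm_cases) simp
  then show ?case using rotations_cyc by (simp add: rotations_Herm)
qed simp

lemma rotations_inner:
  "g \<in> rotations n \<Longrightarrow> X \<in> Herm n \<Longrightarrow> Y \<in> Herm n \<Longrightarrow> inner (g X) (g Y) = inner X Y"
  by (metis rotations_Herm rotations_jprod rotations_tr tr_jprod jprod_Herm)

lemma rotations_one: "g \<in> rotations n \<Longrightarrow> g one_mat = one_mat"
proof (induction rule: rotations.induct)
  case (rotations_rot g u t)
  then show ?case by (simp add: one_mat_mk rot_mk)
next
  case (rotations_cyc g)
  then show ?case by (simp add: one_mat_mk)
qed simp

text \<open>Negative angles are allowed and \<open>cyc\<close> has order three, so inverses stay
  inside. They are inverse only on \<open>Herm n\<close>, since \<open>rot\<close> reads just six of
  the nine entries.\<close>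

lemma rotations_inverse:
  assumes "g \<in> rotations n"
  obtains h where "h \<in> rotations n" "\<And>X. X \<in> Herm n \<Longrightarrow> h (g X) = X" "\<And>X. X \<in> Herm n \<Longrightarrow> g (h X) = X"
proof -
  have "\<exists>h\<in>rotations n. \<forall>X\<in>Herm n. h (g X) = X \<and> g (h X) = X"
    using assms
  proof (induction rule: rotations.induct)
    case rotations_id
    show ?case by (rule bexI[OF _ rotations.rotations_id]) simp
  next
    case (rotations_rot g u t)
    then obtain h where h: "h \<in> rotations n" "\<forall>X\<in>Herm n. h (g X) = X \<and> g (h X) = X" by blast
    have k: "(\<lambda>X. rot (- t) u X) \<in> rotations n"
      by (rule rotations.rotations_rot[OF rotations.rotations_id]) fact
    show ?case
      using h rotations_rot.hyps rotations_Herm[OF k]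
      by (intro bexI[OF _ rotations_comp[OF h(1) k]])
       (auto simp: rot_rot[of _ n] rot_0[of _ n] rotations_Herm)
  next
    case (rotations_cyc g)
    then obtain h where h: "h \<in> rotations n" "\<forall>X\<in>Herm n. h (g X) = X \<and> g (h X) = X" by blast
    have k: "(\<lambda>X. cyc (cyc X)) \<in> rotations n"
      by (rule rotations.rotations_cyc[OF rotations.rotations_cyc[OF rotations.rotations_id]])
    show ?case
      using h rotations_cyc.hyps rotations_Herm[OF k]
      by (intro bexI[OF _ rotations_comp[OF h(1) k]])
       (auto simp: cyc_cyc_cyc[of _ n] rotations_Herm)
  qed
  then show ?thesis using that by blast
qed

lemma rotate_to_diagonal:
  assumes "c \<in> Alg n"
  obtains t u where "u \<in> unit_elements n"
    "\<And>z a b. \<exists>a' b'. rot t u (mk x y z a b c) =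
      mk ((x + y) / 2 + sqrt (((x - y) / 2)\<^sup>2 + (norm c)\<^sup>2))
         ((x + y) / 2 - sqrt (((x - y) / 2)\<^sup>2 + (norm c)\<^sup>2)) z a' b' 0 \<and> (a = 0 \<longrightarrow> b = 0 \<longrightarrow> a' = 0 \<and> b' = 0)"
proof -
  \<comment> \<open>The rotation takes place along the direction of \<open>c\<close>; for
    \<open>c = 0\<close> any unit serves, and 1 lies in every algebra.\<close>
  define u where "u = (if c = 0 then oreal 1 else c /\<^sub>R norm c)"
  define w where "w = (x - y) / 2"
  have u: "u \<in> unit_elements n" "norm c *\<^sub>R u = c" "inner u c = norm c"
    using assms by (auto simp: u_def unit_elements_def Alg_scaleR dot_square_norm power2_eq_square)
  define r where "r = sqrt (w\<^sup>2 + (norm c)\<^sup>2)"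
  obtain \<phi> where phi: "w = r * cos \<phi>" "norm c = r * sin \<phi>"
  proof -
    show thesis
    proof (cases "r = 0")
      case True
      then have "w\<^sup>2 + (norm c)\<^sup>2 = 0" by (simp add: r_def)
      then have "w = 0" "norm c = 0" by (simp_all add: add_nonneg_eq_0_iff)
      then show thesis using that True by simp
    next
      case False
      have "(w / r)\<^sup>2 + (norm c / r)\<^sup>2 = (w\<^sup>2 + (norm c)\<^sup>2) / r\<^sup>2"
        by (simp add: power_divide add_divide_distrib)
      also have "\<dots> = 1"
        using False by (simp add: r_def)
      finally obtain \<phi> where "w / r = cos \<phi>" "norm c / r = sin \<phi>"
        using sincos_total_2pi by metis
      then show thesis using that[of \<phi>] False by (simp add: field_simps)
    qed
  qed
  have "w * cos \<phi> + norm c * sin \<phi> = r * ((cos \<phi>)\<^sup>2 + (sin \<phi>)\<^sup>2)"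
    unfolding phi by (simp only: power2_eq_square distrib_left mult_ac)
  then have 1: "w * cos \<phi> + norm c * sin \<phi> = r"
    by simp
  have 2: "norm c * cos \<phi> - w * sin \<phi> = 0"
    unfolding phi by (simp add: algebra_simps)
  have 3: "c + (norm c * cos \<phi> - w * sin \<phi> - norm c) *\<^sub>R u = 0"
    by (simp add: 2 u(2))
  show ?thesis
  proof (rule that[OF u(1)])
    fix z a b
    \<comment> \<open>The half angle appears because the upper block turns with twice the parameter.
      The sign puts the larger eigenvalue first.\<close>
    show "\<exists>a' b'. rot (- \<phi> / 2) u (mk x y z a b c) = mk ((x + y) / 2 + sqrt (((x - y) / 2)\<^sup>2 + (norm c)\<^sup>2))
         ((x + y) / 2 - sqrt (((x - y) / 2)\<^sup>2 + (norm c)\<^sup>2)) z a' b' 0 \<and> (a = 0 \<longrightarrow> b = 0 \<longrightarrow> a' = 0 \<and> b' = 0)"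
      unfolding rot_mk u(3) w_def[symmetric] r_def[symmetric] using 1 3 by (simp add: diff_conv_add_uminus del: add_uminus_conv_diff) (simp add: algebra_simps)?
  qed
qed

section \<open>Primitive idempotents, which will turn out to be the projective plane\<close>

definition idem1 :: "nat \<Rightarrow> omat set"
  where "idem1 n = {X \<in> Herm n. jprod X X = X \<and> tr X = 1}"

lemma idem1_rotations: "g \<in> rotations n \<Longrightarrow> X \<in> idem1 n \<Longrightarrow> g X \<in> idem1 n"
  unfolding idem1_def by (auto simp: rotations_Herm rotations_tr simp flip: rotations_jprod)

lemma E_mat_idem1: "E_mat \<in> idem1 n"
  unfolding idem1_def by (simp add: E_mat_mk jprod_mk_self)

lemma rotations_cyc2: "g \<in> rotations n \<Longrightarrow> (\<lambda>X. cyc (cyc (g X))) \<in> rotations n"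
  by (intro rotations.intros)

lemma omult_eq_0_iff [simp]: "omult x y = 0 \<longleftrightarrow> x = 0 \<or> y = 0"
  by (metis mult_eq_0_iff norm_eq_zero norm_omult)

lemma ocnj_eq_0_iff [simp]: "ocnj x = 0 \<longleftrightarrow> x = 0"
  by (metis norm_eq_zero norm_ocnj)

lemma idem1_diagonal:
  assumes "mk x y z 0 0 0 \<in> idem1 n"
  obtains g where "g \<in> rotations n" "g (mk x y z 0 0 0) = E_mat"
proof -
  have *: "x * x = x" "y * y = y" "z * z = z" "x + y + z = 1"
    using assms by (auto simp: idem1_def jprod_mk_self power2_eq_square)
  then have "x = 0 \<or> x = 1" "y = 0 \<or> y = 1" "z = 0 \<or> z = 1" by auto
  then consider "x = 1" "y = 0" "z = 0" | "x = 0" "y = 1" "z = 0" | "x = 0" "y = 0" "z = 1"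
    using *(4) by auto
  then show thesis
  proof cases
    case 1
    with that[OF rotations_id] show thesis by (simp add: E_mat_mk)
  next
    case 2
    with that[OF rotations_cyc[OF rotations_id]] show thesis by (simp add: E_mat_mk)
  next
    case 3
    with that[OF rotations_cyc2[OF rotations_id]] show thesis by (simp add: E_mat_mk)
  qed
qed

lemma idem1_block:
  assumes "mk x y z 0 0 c \<in> idem1 n"
  obtains g where "g \<in> rotations n" "g (mk x y z 0 0 c) = E_mat"
proof -
  have "c \<in> Alg n" using assms by (simp add: idem1_def)
  then obtain t u where u: "u \<in> unit_elements n" "\<exists>x' y'. rot t u (mk x y z 0 0 c) = mk x' y' z 0 0 0"
    using rotate_to_diagonal[of c n x y] by metis
  then obtain x' y' where r: "rot t u (mk x y z 0 0 c) = mk x' y' z 0 0 0" by blast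
  have k: "(\<lambda>X. rot t u X) \<in> rotations n" by (intro rotations.intros u)
  have "mk x' y' z 0 0 0 \<in> idem1 n" using idem1_rotations[OF k assms] r by simp
  then obtain g where "g \<in> rotations n" "g (mk x' y' z 0 0 0) = E_mat" by (rule idem1_diagonal)
  then show thesis using that rotations_comp[OF _ k] r by metis
qed

text \<open>Once a rotation has removed the entry 12, idempotency makes the product of the other two
  off-diagonal entries zero. There are no zero divisors, so one of them vanishes, and a rotation of
  the remaining 2 x 2 block completes the diagonalization.\<close>

lemma idem1_transitive:
  assumes "p \<in> idem1 n"
  obtains g where "g \<in> rotations n" "g p = E_mat"
proof -
  obtain x0 y0 z0 a0 b0 c0 where p: "p = mk x0 y0 z0 a0 b0 c0" "c0 \<in> Alg n"
    using assms by (auto simp: idem1_def elim: Herm_cases)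
  obtain t u x y z a b where u: "u \<in> unit_elements n" and r: "rot t u p = mk x y z a b 0"
    using rotate_to_diagonal[of c0 n x0 y0] p by metis
  have k: "(\<lambda>X. rot t u X) \<in> rotations n" by (intro rotations.intros u)
  have q: "mk x y z a b 0 \<in> idem1 n" using idem1_rotations[OF k assms] r by simp
  then have *: "x\<^sup>2 + (norm b)\<^sup>2 = x" "omult a b = 0" "(y + z) *\<^sub>R a = a" "(z + x) *\<^sub>R b = b" "x + y + z = 1"
    by (auto simp: idem1_def jprod_mk_self)
  have "a = 0 \<or> b = 0" using *(2) by simp
  then obtain h where "h \<in> rotations n" "h (mk x y z a b 0) = E_mat"
  proof
    assume "a = 0"
    have "(\<lambda>X. cyc (cyc X)) \<in> rotations n" by (intro rotations.intros)
    with q \<open>a = 0\<close> have "mk z x y 0 0 b \<in> idem1 n" using idem1_rotations by fastforce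
    then obtain g where "g \<in> rotations n" "g (mk z x y 0 0 b) = E_mat" by (rule idem1_block)
    then show thesis
      using that[OF rotations_comp[OF _ rotations_cyc2[OF rotations_id]]] \<open>a = 0\<close> by simp
  next
    assume "b = 0"
    have "(\<lambda>X. cyc X) \<in> rotations n" by (intro rotations.intros)
    with q \<open>b = 0\<close> have "mk y z x 0 0 a \<in> idem1 n" using idem1_rotations by fastforce
    then obtain g where "g \<in> rotations n" "g (mk y z x 0 0 a) = E_mat" by (rule idem1_block)
    then show thesis
      using that[OF rotations_comp[OF _ rotations_cyc[OF rotations_id]]] \<open>b = 0\<close> by simp
  qed
  then show thesis using that rotations_comp[OF _ k] r by metis
qed

section \<open>Diagonalization by maximizing a linear form\<close>

lemma closed_Herm: "closed (Herm n)"
  by (rule closed_subspace[OF subspace_Herm])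

lemma continuous_on_tr [continuous_intros]: "continuous_on S f \<Longrightarrow> continuous_on S (\<lambda>x. tr (f x))"
  using linear_tr by (simp add: linear_conv_bounded_linear bounded_linear.continuous_on)

lemmas continuous_on_jprod [continuous_intros] = jprod.continuous_on

lemma compact_idem1: "compact (idem1 n)"
proof -
  have "norm X = 1" if "X \<in> idem1 n" for X
  proof -
    have "(norm X)\<^sup>2 = 1" using that norm_sq_Herm[of X n] by (simp add: idem1_def)
    then show ?thesis
      using norm_ge_zero[of X] by (metis one_power2 power2_eq_imp_eq zero_le_one)
  qed
  then have "bounded (idem1 n)" by (auto simp: bounded_iff)
  moreover have "idem1 n = Herm n \<inter> {X. jprod X X = X} \<inter> {X. tr X = 1}"
    by (auto simp: idem1_def)
  moreover have "closed {X. jprod X X = X}" "closed {X. tr X = 1}"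
    by (intro closed_Collect_eq continuous_on_jprod continuous_on_tr continuous_on_id continuous_on_const)+
  ultimately show ?thesis
    using closed_Herm by (simp add: compact_eq_bounded_closed closed_Int)
qed

lemma maximal_corner:
  assumes "X \<in> Herm n"
  obtains g where "g \<in> rotations n" "\<And>h. h \<in> rotations n \<Longrightarrow> inner (h (g X)) E_mat \<le> inner (g X) E_mat"
proof -
  have "\<exists>p\<in>idem1 n. \<forall>q\<in>idem1 n. inner X q \<le> inner X p"
  proof (rule continuous_attains_sup[OF compact_idem1])
    show "idem1 n \<noteq> {}" using E_mat_idem1 by blast
    show "continuous_on (idem1 n) (inner X)"
      by (rule continuous_on_inner[OF continuous_on_const continuous_on_id])
  qed
  then obtain p where p: "p \<in> idem1 n" "\<And>q. q \<in> idem1 n \<Longrightarrow> inner X q \<le> inner X p" by blast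
  obtain g where g: "g \<in> rotations n" "g p = E_mat" using idem1_transitive[OF p(1)] by metis
  have gX: "inner (g X) E_mat = inner X p"
    using rotations_inner[OF g(1) assms, of p] p(1) g(2) by (simp add: idem1_def)
  show thesis
  proof (rule that[OF g(1)])
    fix h assume h: "h \<in> rotations n"
    have hg: "(\<lambda>X. h (g X)) \<in> rotations n" by (rule rotations_comp[OF h g(1)])
    \<comment> \<open>Pulling \<open>E_mat\<close> back by the inverse of the composite gives
      another primitive idempotent, which competes with the maximizer \<open>p\<close>.\<close>
    obtain k where k: "k \<in> rotations n" "\<And>X. X \<in> Herm n \<Longrightarrow> h (g (k X)) = X"
      by (rule rotations_inverse[OF hg]) (rule that)
    have "inner (h (g X)) E_mat = inner (h (g X)) (h (g (k E_mat)))" by (simp only: k(2)[OF E_mat_Herm])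
    also have "\<dots> = inner X (k E_mat)"
      by (rule rotations_inner[OF hg assms rotations_Herm[OF k(1) E_mat_Herm]])
    also have "\<dots> \<le> inner X p" by (rule p(2)[OF idem1_rotations[OF k(1) E_mat_idem1]])
    finally show "inner (h (g X)) E_mat \<le> inner (g X) E_mat" using gX by simp
  qed
qed

theorem spectral:
  assumes "X \<in> Herm n"
  obtains g x y z where "g \<in> rotations n" "g X = mk x y z 0 0 0" "x \<ge> y" "y \<ge> z"
proof -
  obtain g where g: "g \<in> rotations n" "\<And>h. h \<in> rotations n \<Longrightarrow> inner (h (g X)) E_mat \<le> inner (g X) E_mat"
    by (rule maximal_corner[OF assms]) (rule that)
  obtain x y z a b c where gX: "g X = mk x y z a b c" and alg: "a \<in> Alg n" "b \<in> Alg n" "c \<in> Alg n"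
    using rotations_Herm[OF g(1) assms] by (rule Herm_cases)
  have max: "x' \<le> x" if "h \<in> rotations n" "h (g X) = mk x' y' z' a' b' c'" for h x' y' z' a' b' c'
    using g(2)[OF that(1)] that(2) gX by (simp add: E_mat_mk inner_mk)
  \<comment> \<open>The larger eigenvalue of a 2 x 2 block with corner \<open>x\<close> exceeds
    \<open>x\<close> strictly unless the off-diagonal entry is zero. Maximality of the corner
    therefore kills the entries 12 and 31.\<close>
  have sq: "e = 0" if "(x + y) / 2 + sqrt (((x - y) / 2)\<^sup>2 + (norm e)\<^sup>2) \<le> x \<or>
      (y + x) / 2 + sqrt (((y - x) / 2)\<^sup>2 + (norm e)\<^sup>2) \<le> x" for y :: real and e :: oct
  proof -
    have "((y - x) / 2)\<^sup>2 = ((x - y) / 2)\<^sup>2"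
      by (simp add: power2_eq_square algebra_simps)
    then have "sqrt (((x - y) / 2)\<^sup>2 + (norm e)\<^sup>2) \<le> (x - y) / 2"
      using that by (auto simp: field_simps)
    then have "((x - y) / 2)\<^sup>2 + (norm e)\<^sup>2 \<le> ((x - y) / 2)\<^sup>2"
      by (metis add_nonneg_nonneg order_trans real_sqrt_ge_zero real_sqrt_le_iff' sqrt_le_D zero_le_power2)
    then show ?thesis by simp
  qed
  have c: "c = 0"
  proof -
    obtain t u x' y' z' a' b' where u: "u \<in> unit_elements n"
      and r: "rot t u (mk x y z a b c) = mk ((x + y) / 2 + sqrt (((x - y) / 2)\<^sup>2 + (norm c)\<^sup>2)) y' z' a' b' 0"
      using rotate_to_diagonal[OF alg(3), of x y] by metis
    have "(\<lambda>X. rot t u X) \<in> rotations n" by (intro rotations.intros u)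
    from max[OF this] r gX have "(x + y) / 2 + sqrt (((x - y) / 2)\<^sup>2 + (norm c)\<^sup>2) \<le> x" by simp
    then show ?thesis using sq by blast
  qed
  have b: "b = 0"
  proof -
    obtain t u y' z' a' b' where u: "u \<in> unit_elements n"
      and r: "rot t u (mk z x y c a b) = mk ((z + x) / 2 + sqrt (((z - x) / 2)\<^sup>2 + (norm b)\<^sup>2)) y' z' a' b' 0"
      using rotate_to_diagonal[OF alg(2), of z x] by metis
    have "(\<lambda>X. rot t u (cyc (cyc X))) \<in> rotations n" by (intro rotations.intros u)
    from max[OF this] r gX have "(z + x) / 2 + sqrt (((z - x) / 2)\<^sup>2 + (norm b)\<^sup>2) \<le> x" by simp
    then show ?thesis using sq by blast
  qed
  \<comment> \<open>The entry 23 is invisible to the corner; it is moved into the upper block by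
    \<open>cyc\<close> and rotated away there.\<close>
  obtain t u where u: "u \<in> unit_elements n"
    and r: "\<exists>y' z'. y' \<ge> z' \<and> rot t u (mk y z x 0 0 a) = mk y' z' x 0 0 0"
  proof -
    obtain t u where u: "u \<in> unit_elements n" and "rot t u (mk y z x 0 0 a) =
        mk ((y + z) / 2 + sqrt (((y - z) / 2)\<^sup>2 + (norm a)\<^sup>2)) ((y + z) / 2 - sqrt (((y - z) / 2)\<^sup>2 + (norm a)\<^sup>2)) x 0 0 0"
      using rotate_to_diagonal[OF alg(1), of y z] by metis
    then show thesis using that[OF u] by fastforce
  qed
  then obtain y' z' where r: "y' \<ge> z'" "rot t u (cyc (g X)) = mk y' z' x 0 0 0"
    using gX b c by auto
  have k: "(\<lambda>X. rot t u (cyc X)) \<in> rotations n" by (intro rotations.intros u)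
  \<comment> \<open>Maximality is used once more: the rotated matrix has \<open>y'\<close> in its
    corner.\<close>
  have "y' \<le> x" using max[OF k r(2)] .
  moreover have "cyc (cyc (rot t u (cyc (g X)))) = mk x y' z' 0 0 0" using r by simp
  ultimately show thesis
    using that[OF rotations_comp[OF rotations_comp[OF rotations_cyc2[OF rotations_id] k] g(1)]] r(1) by blast
qed

text \<open>\<open>E_mat\<close>, \<open>cyc E_mat\<close> and \<open>cyc (cyc E_mat)\<close> are
  the three diagonal idempotents. In applications all further variables are quantified inside
  \<open>P\<close>, so that the step for rotations can transport them.\<close>

lemma spectral_induct [consumes 1, case_names add scale rot E]:
  assumes X: "X \<in> Herm n"
    and add: "\<And>X Y. X \<in> Herm n \<Longrightarrow> Y \<in> Herm n \<Longrightarrow> P X \<Longrightarrow> P Y \<Longrightarrow> P (X + Y)"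
    and scale: "\<And>r X. X \<in> Herm n \<Longrightarrow> P X \<Longrightarrow> P (r *\<^sub>R X)"
    and rot: "\<And>g X. g \<in> rotations n \<Longrightarrow> X \<in> Herm n \<Longrightarrow> P X \<Longrightarrow> P (g X)"
    and E: "P E_mat"
  shows "P X"
proof -
  obtain g x y z where g: "g \<in> rotations n" "g X = mk x y z 0 0 0" using spectral[OF X] by metis
  obtain h where h: "h \<in> rotations n" "\<And>X. X \<in> Herm n \<Longrightarrow> h (g X) = X"
    using rotations_inverse[OF g(1)] by metis
  have c: "(\<lambda>X. cyc X) \<in> rotations n" "(\<lambda>X. cyc (cyc X)) \<in> rotations n" by (intro rotations.intros)+
  have "mk x y z 0 0 0 = x *\<^sub>R E_mat + (y *\<^sub>R cyc (cyc E_mat) + z *\<^sub>R cyc E_mat)"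
    by (simp add: E_mat_mk mk_arith)
  moreover have "P (x *\<^sub>R E_mat + (y *\<^sub>R cyc (cyc E_mat) + z *\<^sub>R cyc E_mat))"
    using rot[OF c(1) E_mat_Herm E] rot[OF c(2) E_mat_Herm E] E
      rotations_Herm[OF c(1)] rotations_Herm[OF c(2)]
    by (intro add scale Herm_add Herm_scaleR E_mat_Herm) auto
  ultimately have "P (g X)" using g(2) by simp
  from rot[OF h(1) rotations_Herm[OF g(1) X] this] show ?thesis using h(2) X by simp
qed

section \<open>Jordan identities\<close>

lemma oct_eq_iff_inner: "(v :: oct) = w \<longleftrightarrow> (\<forall>e. inner v e = inner w e)"
  by (metis vector_eq_rdot)

lemmas oct_arith = oct_eq_iff_inner inner_add_left inner_diff_left inner_scaleR_left inner_minus_left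

text \<open>The Peirce decomposition of \<open>E_mat\<close>, with eigenvalues 1, 0 and 1/2.\<close>

lemma jprod_E: "jprod E_mat (mk x y z a b c) = mk x 0 0 0 (b /\<^sub>R 2) (c /\<^sub>R 2)"
  by (simp add: E_mat_mk jprod_mk)

lemma rotations_surj:
  assumes "g \<in> rotations n" "A \<in> Herm n"
  obtains A' where "A' \<in> Herm n" "A = g A'"
  using rotations_inverse[OF assms(1)] rotations_Herm assms(2) by metis

lemma inner_jprod:
  assumes "X \<in> Herm n" "A \<in> Herm n" "B \<in> Herm n"
  shows "inner (jprod X A) B = inner A (jprod X B)"
proof -
  have "\<forall>A\<in>Herm n. \<forall>B\<in>Herm n. inner (jprod X A) B = inner A (jprod X B)"
    using assms(1)
  proof (induction rule: spectral_induct)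
    case (rot g X)
    show ?case
    proof (intro ballI)
      fix A B assume "A \<in> Herm n" "B \<in> Herm n"
      then obtain A' B' where "A' \<in> Herm n" "A = g A'" "B' \<in> Herm n" "B = g B'"
        using rotations_surj[OF rot(1)] by metis
      then show "inner (jprod (g X) A) B = inner A (jprod (g X) B)"
        using rot by (simp flip: rotations_jprod add: rotations_inner jprod_Herm)
    qed
  next
    case E
    show ?case
      by (intro ballI, elim Herm_cases) (simp add: jprod_E inner_mk)
  qed (simp_all add: jprod_linear inner_add_left inner_add_right)
  then show ?thesis using assms by blast
qed

text \<open>The commutator of two Jordan multiplications, an inner derivation by
  \<open>jcomm_derivation\<close>.\<close>

definition jcomm :: "omat \<Rightarrow> omat \<Rightarrow> omat \<Rightarrow> omat"
  where "jcomm X Y A = jprod X (jprod Y A) - jprod Y (jprod X A)"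

lemma jcomm_linear:
  "jcomm (X + X') Y A = jcomm X Y A + jcomm X' Y A"
  "jcomm X (Y + Y') A = jcomm X Y A + jcomm X Y' A"
  "jcomm X Y (A + A') = jcomm X Y A + jcomm X Y A'"
  "jcomm (r *\<^sub>R X) Y A = r *\<^sub>R jcomm X Y A"
  "jcomm X (r *\<^sub>R Y) A = r *\<^sub>R jcomm X Y A"
  "jcomm X Y (r *\<^sub>R A) = r *\<^sub>R jcomm X Y A"
  "jcomm (- X) Y A = - jcomm X Y A"
  "jcomm X (- Y) A = - jcomm X Y A"
  "jcomm (X - X') Y A = jcomm X Y A - jcomm X' Y A"
  "jcomm X (Y - Y') A = jcomm X Y A - jcomm X Y' A"
  "jcomm X Y (A - A') = jcomm X Y A - jcomm X Y A'"
  by (simp_all add: jcomm_def jprod_linear scaleR_diff_right)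

lemma jcomm_Herm: "X \<in> Herm n \<Longrightarrow> Y \<in> Herm n \<Longrightarrow> A \<in> Herm n \<Longrightarrow> jcomm X Y A \<in> Herm n"
  by (simp add: jcomm_def Herm_diff jprod_Herm)

lemma jcomm_rotations:
  "g \<in> rotations n \<Longrightarrow> X \<in> Herm n \<Longrightarrow> Y \<in> Herm n \<Longrightarrow> A \<in> Herm n \<Longrightarrow> jcomm (g X) (g Y) (g A) = g (jcomm X Y A)"
  by (simp add: jcomm_def linear_diff[OF linear_rotations] rotations_jprod jprod_Herm)

text \<open>With \<open>E_mat\<close> the commutator is a combination of two infinitesimal
  rotations, in the coordinates 31 and 12, and these are already known to be derivations.\<close>

lemma jcomm_E: "A \<in> Herm n \<Longrightarrow>
  jcomm E_mat (mk x y z a b c) A = (1/4) *\<^sub>R (cyc (rot_gen b (cyc (cyc A))) - rot_gen c A)"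
  by (elim Herm_cases)
    (simp add: jcomm_def jprod_E jprod_mk mk_arith ocnj_scaleR omult.scaleR_left omult.scaleR_right inner_commute;
     simp add: oct_arith field_simps)

lemma jcomm_derivation:
  assumes "X \<in> Herm n" "Y \<in> Herm n" "A \<in> Herm n" "B \<in> Herm n"
  shows "jcomm X Y (jprod A B) = jprod (jcomm X Y A) B + jprod A (jcomm X Y B)"
proof -
  have "\<forall>Y\<in>Herm n. \<forall>A\<in>Herm n. \<forall>B\<in>Herm n.
      jcomm X Y (jprod A B) = jprod (jcomm X Y A) B + jprod A (jcomm X Y B)"
    using assms(1)
  proof (induction rule: spectral_induct)
    case (rot g X)
    show ?case
    proof (intro ballI)
      fix Y A B assume "Y \<in> Herm n" "A \<in> Herm n" "B \<in> Herm n"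
      then obtain Y' A' B' where "A' \<in> Herm n" "A = g A'" "B' \<in> Herm n" "B = g B'" "Y' \<in> Herm n" "Y = g Y'"
        using rotations_surj[OF rot(1)] by metis
      then show "jcomm (g X) Y (jprod A B) = jprod (jcomm (g X) Y A) B + jprod A (jcomm (g X) Y B)"
        using rot by (simp flip: rotations_jprod linear_add[OF linear_rotations]
            add: jcomm_rotations jprod_Herm jcomm_Herm)
    qed
  next
    case E
    show ?case
    proof (intro ballI)
      fix Y A B assume *: "Y \<in> Herm n" "A \<in> Herm n" "B \<in> Herm n"
      obtain x y z a b c where Y: "Y = mk x y z a b c" "b \<in> Alg n" "c \<in> Alg n"
        using *(1) by (elim Herm_cases)
      have "cyc (rot_gen b (cyc (cyc (jprod A B)))) =
          jprod (cyc (rot_gen b (cyc (cyc A)))) B + jprod A (cyc (rot_gen b (cyc (cyc B))))"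
        using * Y by (simp add: cyc_jprod[of _ n] rot_gen_jprod[of _ n] rot_gen_Herm cyc_Herm jprod_Herm
            linear_add[OF linear_cyc] cyc_cyc_cyc[of _ n])
      moreover have "rot_gen c (jprod A B) = jprod (rot_gen c A) B + jprod A (rot_gen c B)"
        by (rule rot_gen_jprod) fact+
      ultimately show "jcomm E_mat Y (jprod A B) = jprod (jcomm E_mat Y A) B + jprod A (jcomm E_mat Y B)"
        using * unfolding Y(1) by (simp add: jcomm_E[of _ n] jprod_Herm jprod_linear algebra_simps)
    qed
  qed (simp_all add: jprod_linear jcomm_linear algebra_simps)
  then show ?thesis using assms by blast
qed

text \<open>The identity is quadratic in \<open>X\<close>, so induction over spectral pieces does
  not apply. Instead \<open>X\<close> itself is diagonalized, and then every product with it is a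
  real scaling of entries.\<close>

lemma jordan_identity_linearized:
  assumes "X \<in> Herm n" "A \<in> Herm n" "B \<in> Herm n"
  shows "jcomm (jprod X X) A B = 2 *\<^sub>R jcomm X (jprod A X) B"
proof -
  obtain g x y z where g: "g \<in> rotations n" "g X = mk x y z 0 0 0" using spectral[OF assms(1)] by metis
  obtain h where h: "h \<in> rotations n" "\<And>X. X \<in> Herm n \<Longrightarrow> h (g X) = X"
    using rotations_inverse[OF g(1)] by metis
  have gH: "g A \<in> Herm n" "g B \<in> Herm n" "g X \<in> Herm n" using assms by (simp_all add: rotations_Herm[OF g(1)])
  have "jcomm (jprod (g X) (g X)) A B = 2 *\<^sub>R jcomm (g X) (jprod A (g X)) B"
    if "A \<in> Herm n" "B \<in> Herm n" for A B
    using that unfolding g(2)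
    by (elim Herm_cases)
      (simp add: jcomm_def jprod_mk mk_arith ocnj_scaleR ocnj_add omult.scaleR_left omult.scaleR_right
        omult.add_left omult.add_right inner_add_right inner_add_left; simp add: oct_arith field_simps)
  from this[OF gH(1,2)] have "h (jcomm (jprod (g X) (g X)) (g A) (g B)) = h (2 *\<^sub>R jcomm (g X) (jprod (g A) (g X)) (g B))"
    by simp
  then show ?thesis
    using assms gH by (simp add: linear_scale[OF linear_rotations[OF h(1)]] rotations_jprod[OF h(1)] h(2) jprod_Herm
       flip: jcomm_rotations[OF h(1)])
qed

section \<open>The adjoint of a Hermitian matrix\<close>

text \<open>The polarized adjugate.  Unlike \<open>Z\<^sup>2 = tr Z Z\<close>, the equivalent equation \<open>freud Z Z = 0\<close> is
  visibly preserved by the compact group: its left side satisfies a linear differential equation along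
  one-parameter subgroups.\<close>

definition freud :: "omat \<Rightarrow> omat \<Rightarrow> omat"
  where "freud A B = jprod A B - (1/2) *\<^sub>R (tr A *\<^sub>R B + tr B *\<^sub>R A)
    + ((1/2) * (tr A * tr B - tr (jprod A B))) *\<^sub>R one_mat"

lemma freud_Herm: "A \<in> Herm n \<Longrightarrow> B \<in> Herm n \<Longrightarrow> freud A B \<in> Herm n"
  by (simp add: freud_def Herm_add Herm_diff Herm_scaleR jprod_Herm)

lemma freud_commute: "freud A B = freud B A"
  by (simp add: freud_def jprod_commute[of A B] mult.commute[of "tr A"] add.commute)

lemma bilinear_freud: "bilinear freud"
  unfolding bilinear_def
  by (auto intro!: linearI simp: freud_def jprod_linear tr_add tr_scaleR algebra_simps
      add_divide_distrib simp flip: scaleR_add_left)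

lemma bounded_bilinear_freud: "bounded_bilinear freud"
  using bilinear_freud by (simp add: bilinear_conv_bounded_bilinear)

interpretation freud: bounded_bilinear freud
  by (rule bounded_bilinear_freud)

lemmas freud_linear = freud.add_left freud.add_right freud.diff_left freud.diff_right
  freud.scaleR_left freud.scaleR_right freud.minus_left freud.minus_right

lemma freud_rotations:
  "g \<in> rotations n \<Longrightarrow> A \<in> Herm n \<Longrightarrow> B \<in> Herm n \<Longrightarrow> freud (g A) (g B) = g (freud A B)"
  by (simp add: freud_def linear_add[OF linear_rotations] linear_diff[OF linear_rotations]
      linear_scale[OF linear_rotations] rotations_tr rotations_one Herm_add Herm_scaleR jprod_Herm
      flip: rotations_jprod)

text \<open>The infinitesimal form of the rule that the adjugate transforms under the dual
  representation. For a traceless \<open>X\<close> only the sign of the multiplication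
  changes.\<close>

lemma freud_mult:
  assumes "X \<in> Herm n" "A \<in> Herm n" "B \<in> Herm n"
  shows "freud (jprod X A) B + freud A (jprod X B) = tr X *\<^sub>R freud A B - jprod X (freud A B)"
proof -
  have "\<forall>A\<in>Herm n. \<forall>B\<in>Herm n.
      freud (jprod X A) B + freud A (jprod X B) = tr X *\<^sub>R freud A B - jprod X (freud A B)"
    using assms(1)
  proof (induction rule: spectral_induct)
    case (rot g X)
    show ?case
    proof (intro ballI)
      fix A B assume "A \<in> Herm n" "B \<in> Herm n"
      then obtain A' B' where "A' \<in> Herm n" "A = g A'" "B' \<in> Herm n" "B = g B'"
        using rotations_surj[OF rot(1)] by metis
      then show "freud (jprod (g X) A) B + freud A (jprod (g X) B) =
          tr (g X) *\<^sub>R freud A B - jprod (g X) (freud A B)"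
        using rot by (simp flip: rotations_jprod linear_add[OF linear_rotations] linear_diff[OF linear_rotations]
             linear_scale[OF linear_rotations]
            add: freud_rotations jprod_Herm rotations_tr freud_Herm)
    qed
  next
    case E
    show ?case
      by (intro ballI, elim Herm_cases)
        (simp add: freud_def jprod_E, simp add: jprod_mk one_mat_mk E_mat_mk mk_arith ocnj_scaleR ocnj_add
           omult.scaleR_left omult.scaleR_right, simp add: oct_arith field_simps)
  next
    case (add X Y)
    have "freud (jprod (X + Y) A) B + freud A (jprod (X + Y) B) =
       (freud (jprod X A) B + freud A (jprod X B)) + (freud (jprod Y A) B + freud A (jprod Y B))" for A B
      by (simp add: jprod_linear freud_linear)
    then show ?case
      using add.IH by (simp add: jprod_linear tr_add scaleR_add_left)
  next
    case (scale r X)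
    have "freud (jprod (r *\<^sub>R X) A) B + freud A (jprod (r *\<^sub>R X) B) =
       r *\<^sub>R (freud (jprod X A) B + freud A (jprod X B))" for A B
      by (simp add: jprod_linear freud_linear scaleR_add_right)
    then show ?case
      using scale.IH by (simp add: jprod_linear tr_scaleR scaleR_diff_right)
  qed
  then show ?thesis using assms by blast
qed


section \<open>Automorphisms and derivations\<close>

lemma linear_on_Herm_iff: "linear_on_Herm n f \<longleftrightarrow> linear_within (Herm n) f"
  by (simp add: linear_on_Herm_def linear_within_def)

lemma linear_withinD:
  assumes "linear_within V f" 
  shows "x \<in> V \<Longrightarrow> f x \<in> V" "x \<in> V \<Longrightarrow> y \<in> V \<Longrightarrow> f (x + y) = f x + f y"
    "x \<in> V \<Longrightarrow> f (c *\<^sub>R x) = c *\<^sub>R f x"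
  using assms by (auto simp: linear_within_def)

lemma linear_within_diff:
  assumes "linear_within V f" "subspace V" "x \<in> V" "y \<in> V"
  shows "f (x - y) = f x - f y"
proof -
  obtain L where L: "linear L" "\<And>x. x \<in> V \<Longrightarrow> L x = f x"
    using linear_within_extend[OF assms(2,1)] by blast
  show ?thesis using L(2) linear_diff[OF L(1), of x y] assms by (simp add: subspace_diff)
qed

lemma Aut_JD:
  assumes "g \<in> Aut_J n"
  shows "linear_within (Herm n) g" "bij_betw g (Herm n) (Herm n)"
    "X \<in> Herm n \<Longrightarrow> Y \<in> Herm n \<Longrightarrow> g (jprod X Y) = jprod (g X) (g Y)"
  using assms by (auto simp: Aut_J_def linear_on_Herm_iff)

lemma Der_JD:
  assumes "D \<in> Der_J n"
  shows "linear_within (Herm n) D"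
    "X \<in> Herm n \<Longrightarrow> Y \<in> Herm n \<Longrightarrow> D (jprod X Y) = jprod (D X) Y + jprod X (D Y)"
  using assms by (auto simp: Der_J_def linear_on_Herm_iff)

lemma Aut_J_comp: "g \<in> Aut_J n \<Longrightarrow> h \<in> Aut_J n \<Longrightarrow> (\<lambda>X. g (h X)) \<in> Aut_J n"
proof -
  assume g: "g \<in> Aut_J n" and h: "h \<in> Aut_J n"
  have hH: "h X \<in> Herm n" if "X \<in> Herm n" for X
    using linear_withinD(1)[OF Aut_JD(1)[OF h] that] .
  have "bij_betw (\<lambda>X. g (h X)) (Herm n) (Herm n)"
    using bij_betw_trans[OF Aut_JD(2)[OF h] Aut_JD(2)[OF g]] by (simp add: o_def)
  then show ?thesis
    unfolding Aut_J_def linear_on_Herm_iff linear_within_def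
    using linear_withinD[OF Aut_JD(1)[OF g]] linear_withinD[OF Aut_JD(1)[OF h]] Aut_JD(3)[OF g] Aut_JD(3)[OF h] hH
    by simp
qed

lemma rotations_Aut_J: "g \<in> rotations n \<Longrightarrow> g \<in> Aut_J n"
proof -
  assume g: "g \<in> rotations n"
  then obtain h where h: "h \<in> rotations n" "\<And>X. X \<in> Herm n \<Longrightarrow> h (g X) = X" "\<And>X. X \<in> Herm n \<Longrightarrow> g (h X) = X"
    using rotations_inverse by metis
  have "bij_betw g (Herm n) (Herm n)"
    by (rule bij_betw_byWitness[where f' = h]) (use g h rotations_Herm in auto)
  then show ?thesis
    using linear_within_linear[OF linear_rotations[OF g], of "Herm n"] rotations_Herm[OF g] rotations_jprod[OF g]
    unfolding Aut_J_def linear_on_Herm_iff by auto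
qed

lemma rotations_Der_J:
  assumes "g \<in> rotations n" "h \<in> rotations n" "D \<in> Der_J n"
    "\<And>X. X \<in> Herm n \<Longrightarrow> h (g X) = X" "\<And>X. X \<in> Herm n \<Longrightarrow> g (h X) = X"
  shows "(\<lambda>X. h (D (g X))) \<in> Der_J n"
  unfolding Der_J_def linear_on_Herm_iff
  using assms rotations_Herm[OF assms(1)] rotations_Herm[OF assms(2)] Der_JD[OF assms(3)]
    linear_withinD[OF Der_JD(1)[OF assms(3)]]
  by (auto simp: linear_within_def linear_add[OF linear_rotations] linear_scale[OF linear_rotations]
      rotations_jprod jprod_Herm)

lemma tr_Der_J:
  assumes "D \<in> Der_J n" "X \<in> Herm n"
  shows "tr (D X) = 0"
proof -
  have "\<forall>D\<in>Der_J n. tr (D X) = 0"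
    using assms(2)
  proof (induction rule: spectral_induct)
    case (add X Y)
    then show ?case by (auto simp: linear_withinD[OF Der_JD(1)] tr_add)
  next
    case (scale r X)
    then show ?case by (auto simp: linear_withinD[OF Der_JD(1)] tr_scaleR)
  next
    case (rot g X)
    obtain h where h: "h \<in> rotations n" "\<And>X. X \<in> Herm n \<Longrightarrow> h (g X) = X" "\<And>X. X \<in> Herm n \<Longrightarrow> g (h X) = X"
      using rotations_inverse[OF rot(1)] by metis
    show ?case
    proof
      fix D assume D: "D \<in> Der_J n"
      have "(\<lambda>X. h (D (g X))) \<in> Der_J n" by (rule rotations_Der_J[OF rot(1) h(1) D h(2,3)])
      from bspec[OF rot.IH this] have "tr (h (D (g X))) = 0" by simp
      moreover have "D (g X) \<in> Herm n"
        by (rule linear_withinD(1)[OF Der_JD(1)[OF D] rotations_Herm[OF rot(1,2)]])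
      ultimately show "tr (D (g X)) = 0" by (simp add: rotations_tr[OF h(1)])
    qed
  next
    case E
    show ?case
    proof
      fix D assume D: "D \<in> Der_J n"
      have "D E_mat \<in> Herm n" by (intro linear_withinD(1)[OF Der_JD(1)[OF D]] E_mat_Herm)
      then obtain x y z a b c where DE: "D E_mat = mk x y z a b c" by (rule Herm_cases)
      \<comment> \<open>Differentiating the idempotent equation places \<open>D E_mat\<close> in the
        Peirce space for 1/2, which has zero diagonal.\<close>
      have "jprod E_mat E_mat = E_mat" by (simp add: E_mat_mk jprod_mk)
      then have "D E_mat = jprod (D E_mat) E_mat + jprod E_mat (D E_mat)"
        using Der_JD(2)[OF D E_mat_Herm E_mat_Herm] by simp
      then show "tr (D E_mat) = 0"
        unfolding DE jprod_commute[of _ E_mat] jprod_E mk_add by auto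
    qed
  qed
  then show ?thesis using assms by blast
qed

section \<open>Invariance of the trace and of the inner product\<close>

lemma Aut_J_one:
  assumes "g \<in> Aut_J n"
  shows "g one_mat = one_mat"
proof -
  note g = Aut_JD[OF assms]
  obtain U where U: "U \<in> Herm n" "g U = one_mat"
    using g(2) one_mat_Herm unfolding bij_betw_def by (metis imageE)
  have "g one_mat = jprod (g one_mat) (g U)"
    unfolding U(2) by (rule jprod_one(2)[symmetric, OF linear_withinD(1)[OF g(1) one_mat_Herm]])
  also have "\<dots> = g U" using g(3)[OF one_mat_Herm U(1)] U by simp
  finally show ?thesis using U(2) by simp
qed

lemma tr_idempotent:
  assumes "p \<in> Herm n" "jprod p p = p" "p \<noteq> 0"
  shows "tr p \<ge> 1"
proof -
  obtain g x y z where g: "g \<in> rotations n" "g p = mk x y z 0 0 0" using spectral[OF assms(1)] by metis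
  have "jprod (g p) (g p) = g p" using rotations_jprod[OF g(1) assms(1,1)] assms(2) by simp
  then have *: "x * x = x" "y * y = y" "z * z = z"
    unfolding g(2) jprod_mk_self by (simp_all add: power2_eq_square)
  have "g p \<noteq> 0"
    using assms rotations_inner[OF g(1) assms(1,1)] by (metis inner_eq_zero_iff)
  then have "x \<noteq> 0 \<or> y \<noteq> 0 \<or> z \<noteq> 0" unfolding g(2) by simp
  moreover have "x = 0 \<or> x = 1" "y = 0 \<or> y = 1" "z = 0 \<or> z = 1" using * by auto
  ultimately have "x + y + z \<ge> 1" by auto
  moreover have "tr p = x + y + z" using rotations_tr[OF g(1) assms(1)] g(2) by simp
  ultimately show ?thesis by simp
qed

text \<open>The three diagonal idempotents are mapped to nonzero idempotents, each of trace at least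
  1 by \<open>tr_idempotent\<close>, and the images add up to the identity, of trace 3. Hence every
  trace is exactly 1. This controls \<open>Aut_J 3\<close> without structure theory of the
  exceptional group.\<close>

lemma tr_Aut_J:
  assumes "g \<in> Aut_J n" "X \<in> Herm n"
  shows "tr (g X) = tr X"
proof -
  have "\<forall>g\<in>Aut_J n. tr (g X) = tr X"
    using assms(2)
  proof (induction rule: spectral_induct)
    case (add X Y)
    then show ?case by (auto simp: linear_withinD[OF Aut_JD(1)] tr_add)
  next
    case (scale r X)
    then show ?case by (auto simp: linear_withinD[OF Aut_JD(1)] tr_scaleR)
  next
    case (rot h X)
    show ?case
    proof
      fix g assume "g \<in> Aut_J n"
      then have "(\<lambda>X. g (h X)) \<in> Aut_J n" using rotations_Aut_J[OF rot(1)] by (rule Aut_J_comp)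
      then show "tr (g (h X)) = tr (h X)" using rot by (auto simp: rotations_tr)
    qed
  next
    case E
    show ?case
    proof
      fix g assume g: "g \<in> Aut_J n"
      have *: "tr (g p) \<ge> 1" if "p \<in> Herm n" "jprod p p = p" "p \<noteq> 0" for p
      proof (rule tr_idempotent)
        show "g p \<in> Herm n" by (intro linear_withinD(1)[OF Aut_JD(1)[OF g]] that)
        show "jprod (g p) (g p) = g p" using Aut_JD(3)[OF g that(1,1)] that(2) by simp
        have "g 0 = 0" using linear_withinD(3)[OF Aut_JD(1)[OF g] that(1), of 0]
          by simp
        then show "g p \<noteq> 0"
          using Aut_JD(2)[OF g] that unfolding bij_betw_def inj_on_def by (metis Herm_0)
      qed
      define F where "F = mk 0 1 0 0 0 0"
      define G where "G = mk 0 0 1 0 0 0"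
      have H: "F \<in> Herm n" "G \<in> Herm n" by (simp_all add: F_def G_def)
      have "one_mat = E_mat + (F + G)" by (simp add: one_mat_mk E_mat_mk F_def G_def mk_add)
      then have "g one_mat = g E_mat + (g F + g G)"
        using linear_withinD(2)[OF Aut_JD(1)[OF g] E_mat_Herm Herm_add[OF H]]
          linear_withinD(2)[OF Aut_JD(1)[OF g] H] by metis
      then have "tr one_mat = tr (g E_mat) + (tr (g F) + tr (g G))"
        unfolding Aut_J_one[OF g] by (metis tr_add)
      then have "3 = tr (g E_mat) + tr (g F) + tr (g G)"
        by (simp add: one_mat_mk)
      moreover have "tr (g E_mat) \<ge> 1" "tr (g F) \<ge> 1" "tr (g G) \<ge> 1"
        by (intro *; simp add: E_mat_mk F_def G_def jprod_mk)+
      ultimately show "tr (g E_mat) = tr E_mat" by (simp add: E_mat_mk)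
    qed
  qed
  then show ?thesis using assms by blast
qed

lemma inner_Aut_J:
  assumes "g \<in> Aut_J n" "X \<in> Herm n" "Y \<in> Herm n"
  shows "inner (g X) (g Y) = inner X Y"
  using assms by (metis Aut_JD(3) jprod_Herm linear_withinD(1)[OF Aut_JD(1)] tr_Aut_J tr_jprod)

lemma inner_Der_J:
  assumes "D \<in> Der_J n" "X \<in> Herm n"
  shows "inner (D X) X = 0"
proof -
  have DX: "D X \<in> Herm n" by (rule linear_withinD(1)[OF Der_JD(1)[OF assms(1)] assms(2)])
  have "0 = tr (D (jprod X X))" using tr_Der_J[OF assms(1) jprod_Herm[OF assms(2,2)]] by simp
  also have "\<dots> = 2 * inner (D X) X"
    using DX assms(2) by (simp add: Der_JD(2)[OF assms(1,2,2)] tr_add tr_jprod inner_commute)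
  finally show ?thesis by simp
qed

lemma Der_J_one:
  assumes "D \<in> Der_J n"
  shows "D one_mat = 0"
proof -
  have "D one_mat \<in> Herm n" by (intro linear_withinD(1)[OF Der_JD(1)[OF assms]] one_mat_Herm)
  then show ?thesis
    using Der_JD(2)[OF assms one_mat_Herm one_mat_Herm] by simp
qed

lemma jcomm_Der_J: "X \<in> Herm n \<Longrightarrow> Y \<in> Herm n \<Longrightarrow> jcomm X Y \<in> Der_J n"
  unfolding Der_J_def linear_on_Herm_iff linear_within_def
  by (auto simp: jcomm_linear jcomm_Herm jcomm_derivation)

lemma rot_gen_Der_J: "u \<in> Alg n \<Longrightarrow> rot_gen u \<in> Der_J n"
  unfolding Der_J_def linear_on_Herm_iff
  by (auto intro!: linear_within_linear linear_rot_gen rot_gen_Herm simp: rot_gen_jprod)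

lemma freud_Der_J:
  assumes "D \<in> Der_J n" "A \<in> Herm n" "B \<in> Herm n"
  shows "freud (D A) B + freud A (D B) = D (freud A B)"
proof -
  note D = Der_JD[OF assms(1)]
  note DH = linear_withinD(1)[OF D(1)]
  have "D (freud A B) = D (jprod A B) - (1/2) *\<^sub>R (tr A *\<^sub>R D B + tr B *\<^sub>R D A)"
    using assms by (simp add: freud_def linear_withinD[OF D(1)] linear_within_diff[OF D(1) subspace_Herm]
        Der_J_one Herm_add Herm_diff Herm_scaleR jprod_Herm)
  moreover have "tr (jprod (D A) B) + tr (jprod A (D B)) = 0"
    using tr_Der_J[OF assms(1) jprod_Herm[OF assms(2,3)]] by (simp add: D assms tr_add)
  ultimately show ?thesis
    using assms by (simp add: freud_def D tr_Der_J algebra_simps flip: scaleR_add_left add_divide_distrib)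
qed

section \<open>The compact group\<close>

lemma subspace_HermC: "subspace (HermC n)"
  unfolding HermC_def by (intro subspace_Times subspace_Herm)

lemma HermC_iff [simp]: "(X, Y) \<in> HermC n \<longleftrightarrow> X \<in> Herm n \<and> Y \<in> Herm n"
  by (simp add: HermC_def)

lemma HermC_cases [consumes 1]:
  assumes "Z \<in> HermC n"
  obtains X Y where "Z = (X, Y)" "X \<in> Herm n" "Y \<in> Herm n"
  using assms by (auto simp: HermC_def)

lemma cscale_Pair [simp]: "cscale c (X, Y) = (Re c *\<^sub>R X - Im c *\<^sub>R Y, Re c *\<^sub>R Y + Im c *\<^sub>R X)"
  by (simp add: cscale_def)

lemma lie_op_Pair [simp]: "lie_op D S (A, B) = (D A - jprod S B, D B + jprod S A)"
  by (simp add: lie_op_def complexify_def)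

lemma lie_GhatE:
  assumes "\<xi> \<in> lie_Ghat n"
  obtains D S where "\<xi> = lie_op D S" "D \<in> Der_J n" "S \<in> Herm n" "tr S = 0"
  using assms by (auto simp: lie_Ghat_def Herm_tr_def)

lemma lie_GhatI: "D \<in> Der_J n \<Longrightarrow> S \<in> Herm n \<Longrightarrow> tr S = 0 \<Longrightarrow> lie_op D S \<in> lie_Ghat n"
  unfolding lie_Ghat_def Herm_tr_def by blast

lemma lie_op_linear_within:
  assumes "D \<in> Der_J n" "S \<in> Herm n"
  shows "linear_within (HermC n) (lie_op D S)"
  using linear_withinD[OF Der_JD(1)[OF assms(1)]] assms(2)
  by (auto simp: linear_within_def jprod_linear Herm_add Herm_diff jprod_Herm HermC_def algebra_simps)

lemma lie_op_cscale:
  assumes "D \<in> Der_J n" "Z \<in> HermC n"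
  shows "lie_op D S (cscale c Z) = cscale c (lie_op D S Z)"
  using assms(2)
  by (elim HermC_cases)
    (simp add: linear_withinD[OF Der_JD(1)[OF assms(1)]] linear_within_diff[OF Der_JD(1)[OF assms(1)] subspace_Herm]
      Herm_scaleR jprod_linear algebra_simps)

lemma lie_op_skew:
  assumes "D \<in> Der_J n" "S \<in> Herm n" "Z \<in> HermC n"
  shows "inner (lie_op D S Z) Z = 0"
  using assms(3)
proof (elim HermC_cases)
  fix X Y assume "Z = (X, Y)" "X \<in> Herm n" "Y \<in> Herm n"
  then show ?thesis
    using inner_Der_J[OF assms(1), of X] inner_Der_J[OF assms(1), of Y] inner_jprod[OF assms(2), of Y X]
    by (simp add: inner_diff_left inner_add_left inner_diff_right inner_add_right inner_commute)
qed

text \<open>The complex bilinear extension of \<open>freud\<close>, evaluated at \<open>Z\<close>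
  twice and split into real and imaginary parts.\<close>

definition freudC :: "omat \<times> omat \<Rightarrow> omat \<times> omat"
  where "freudC Z = (freud (fst Z) (fst Z) - freud (snd Z) (snd Z), 2 *\<^sub>R freud (fst Z) (snd Z))"

lemma freudC_deriv:
  assumes "D \<in> Der_J n" "S \<in> Herm n" "tr S = 0" "(X, Y) \<in> HermC n" "(X', Y') = lie_op D S (X, Y)"
  shows "((freud X X' + freud X' X) - (freud Y Y' + freud Y' Y), 2 *\<^sub>R (freud X Y' + freud X' Y))
    = lie_op D (- S) (freudC (X, Y))"
proof -
  have H: "X \<in> Herm n" "Y \<in> Herm n" using assms(4) by auto
  have X': "X' = D X - jprod S Y" "Y' = D Y + jprod S X" using assms(5) by auto
  note m = freud_mult[OF assms(2), unfolded assms(3) scaleR_zero_left diff_0]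
  have 1: "freud (D A) B = D (freud A B) - freud A (D B)" if "A \<in> Herm n" "B \<in> Herm n" for A B
    using freud_Der_J[OF assms(1) that] by (simp add: eq_diff_eq)
  have 2: "freud (jprod S A) B = - jprod S (freud A B) - freud A (jprod S B)" if "A \<in> Herm n" "B \<in> Herm n" for A B
    using m[OF that] by (simp add: eq_diff_eq)
  have 3: "jprod S (freud X X) = - (freud X (jprod S X) + freud X (jprod S X))"
    "jprod S (freud Y Y) = - (freud Y (jprod S Y) + freud Y (jprod S Y))"
    using m[OF H(1,1)] m[OF H(2,2)] unfolding freud_commute[of "jprod S X" X] freud_commute[of "jprod S Y" Y]
    by (metis minus_minus)+
  have c: "freud Y X = freud X Y" "freud Y (D X) = freud (D X) Y" "freud Y (jprod S X) = freud (jprod S X) Y"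
    by (simp_all add: freud_commute)
  note Dl = linear_withinD[OF Der_JD(1)[OF assms(1)]] linear_within_diff[OF Der_JD(1)[OF assms(1)] subspace_Herm]
  show ?thesis
    using H unfolding X' freudC_def
    by (simp add: freud_linear c 1 2 3 Dl freud_Herm Herm_scaleR jprod_linear scaleR_2 algebra_simps)
qed

text \<open>The element of the Lie algebra attached to the unit vector \<open>W\<close>: it is \<open>\<i>\<close> times the triple product
  \<open>Z \<mapsto> {W W* Z}\<close> minus a third of the identity, hence transforms equivariantly.  At \<open>E\<close> it is
  \<open>\<i>\<close> times the multiplication by \<open>E - 1/3\<close>.\<close>

definition xi :: "omat \<times> omat \<Rightarrow> omat \<times> omat \<Rightarrow> omat \<times> omat"
  where "xi W = lie_op (\<lambda>A. 2 *\<^sub>R jcomm (fst W) (snd W) A)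
    (jprod (fst W) (fst W) + jprod (snd W) (snd W) - (1 / 3) *\<^sub>R one_mat)"

text \<open>One real component of the infinitesimal equivariance of \<open>xi\<close>. The
  derivation \<open>D\<close> passes through all products; the terms with \<open>S\<close> cancel by
  \<open>jcomm_derivation\<close> and the linearized Jordan identity.\<close>

lemma xi_deriv_fst:
  assumes D: "D \<in> Der_J n" and S: "S \<in> Herm n" and H: "X \<in> Herm n" "Y \<in> Herm n" "A \<in> Herm n" "B \<in> Herm n"
    and X': "X' = D X - jprod S Y" and Y': "Y' = D Y + jprod S X"
    and A': "A' = D A - jprod S B" and B': "B' = D B + jprod S A"
    and Q: "Q = jprod X X + jprod Y Y - (1 / 3) *\<^sub>R one_mat"
    and Q': "Q' = 2 *\<^sub>R jprod X X' + 2 *\<^sub>R jprod Y Y'"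
  shows "D (2 *\<^sub>R jcomm X Y A - jprod Q B) - jprod S (2 *\<^sub>R jcomm X Y B + jprod Q A) =
     2 *\<^sub>R (jcomm X' Y A + jcomm X Y' A + jcomm X Y A') - (jprod Q' B + jprod Q B')"
proof -
  note Dl = linear_withinD[OF Der_JD(1)[OF D]] linear_within_diff[OF Der_JD(1)[OF D] subspace_Herm]
  have DH: "D M \<in> Herm n" if "M \<in> Herm n" for M using Dl(1) that .
  have QH: "Q \<in> Herm n" using H by (simp add: Q Herm_add Herm_diff Herm_scaleR jprod_Herm)
  have Dj: "D (jprod M N) = jprod (D M) N + jprod M (D N)" if "M \<in> Herm n" "N \<in> Herm n" for M N
    using Der_JD(2)[OF D that] .
  have DQ: "D Q = 2 *\<^sub>R jprod X (D X) + 2 *\<^sub>R jprod Y (D Y)"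
    using H by (simp add: Q Dl Dj Der_J_one[OF D] Herm_add Herm_diff Herm_scaleR jprod_Herm scaleR_2
        jprod_commute[of "D X" X] jprod_commute[of "D Y" Y])
  have Dc: "D (jcomm X Y A) = jcomm (D X) Y A + jcomm X (D Y) A + jcomm X Y (D A)"
    using H DH by (simp add: jcomm_def Dl Dj Herm_add Herm_diff jprod_Herm jprod_linear algebra_simps)
  have Dp: "D (2 *\<^sub>R jcomm X Y A - jprod Q B) =
      2 *\<^sub>R (jcomm (D X) Y A + jcomm X (D Y) A + jcomm X Y (D A)) - (jprod (D Q) B + jprod Q (D B))"
    using H QH by (simp add: Dl Dj Dc Herm_scaleR jprod_Herm jcomm_Herm)
  have J2: "jcomm X Y (jprod S B) = jprod (jcomm X Y S) B + jprod S (jcomm X Y B)"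
    by (rule jcomm_derivation) (use H S in auto)
  \<comment> \<open>The Jordan identity is applied to the squares of \<open>X\<close> and of
    \<open>Y\<close>; the multiple of the identity in \<open>Q\<close> commutes with
    everything.\<close>
  have J1: "jcomm Q S A = 2 *\<^sub>R jcomm X (jprod S X) A + 2 *\<^sub>R jcomm Y (jprod S Y) A"
  proof -
    have "jcomm one_mat S A = 0" using H S by (simp add: jcomm_def jprod_one[of _ n] jprod_Herm)
    then show ?thesis
      using jordan_identity_linearized[OF H(1) S H(3)] jordan_identity_linearized[OF H(2) S H(3)]
      by (simp add: Q jcomm_linear)
  qed
  have cs: "jcomm X Y S = jprod X (jprod S Y) - jprod Y (jprod S X)"
    by (simp add: jcomm_def jprod_commute[of _ S])
  have sw: "jcomm (jprod S Y) Y A = - jcomm Y (jprod S Y) A" "jprod Q (jprod S A) = jprod S (jprod Q A) + jcomm Q S A"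
    by (simp_all add: jcomm_def)
  show ?thesis
    unfolding Dp DQ X' Y' A' B' Q' jcomm_linear jprod_linear J2 cs sw J1
    by (simp add: algebra_simps)
qed

lemma has_vector_derivative_PairI:
  assumes "(f has_vector_derivative f') (at t)" "(g has_vector_derivative g') (at t)"
  shows "((\<lambda>t. (f t, g t)) has_vector_derivative (f', g')) (at t)"
  using assms unfolding has_vector_derivative_def scaleR_Pair by (rule has_derivative_Pair)

lemma xi_Herm: "W \<in> HermC n \<Longrightarrow> Z \<in> HermC n \<Longrightarrow> xi W Z \<in> HermC n"
  by (elim HermC_cases) (simp add: xi_def Herm_add Herm_diff Herm_scaleR jprod_Herm jcomm_Herm)

text \<open>Equivariance under exponentials reduces to this by uniqueness: the exponential of
  \<open>xi W Z\<close> and \<open>xi\<close> of the exponentials are values of the same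
  flow.\<close>

lemma flow_xi:
  assumes D: "D \<in> Der_J n" and S: "S \<in> Herm n"
    and f: "flow (lie_op D S) (HermC n) f" and g: "flow (lie_op D S) (HermC n) g"
  shows "flow (lie_op D S) (HermC n) (\<lambda>t. xi (f t) (g t))"
  unfolding flow_def
proof safe
  fix t
  have m: "f t \<in> HermC n" "g t \<in> HermC n" using f g by (auto simp: flow_def)
  then show "xi (f t) (g t) \<in> HermC n" by (rule xi_Herm)
  define X Y A B where "X = fst (f t)" and "Y = snd (f t)" and "A = fst (g t)" and "B = snd (g t)"
  have H: "X \<in> Herm n" "Y \<in> Herm n" "A \<in> Herm n" "B \<in> Herm n"
    using m by (auto simp: X_def Y_def A_def B_def HermC_def)
  define X' Y' A' B' where "X' = D X - jprod S Y" and "Y' = D Y + jprod S X"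
    and "A' = D A - jprod S B" and "B' = D B + jprod S A"
  note defs = X'_def Y'_def A'_def B'_def
  have fg: "f t = (X, Y)" "g t = (A, B)" by (simp_all add: X_def Y_def A_def B_def)
  have d: "(f has_vector_derivative (X', Y')) (at t)" "(g has_vector_derivative (A', B')) (at t)"
    using f g unfolding flow_def by (metis fg lie_op_Pair defs)+
  have dX: "((\<lambda>t. fst (f t)) has_vector_derivative X') (at t)" "((\<lambda>t. snd (f t)) has_vector_derivative Y') (at t)"
    "((\<lambda>t. fst (g t)) has_vector_derivative A') (at t)" "((\<lambda>t. snd (g t)) has_vector_derivative B') (at t)"
    using bounded_linear.has_vector_derivative[OF bounded_linear_fst d(1)]
      bounded_linear.has_vector_derivative[OF bounded_linear_snd d(1)]
      bounded_linear.has_vector_derivative[OF bounded_linear_fst d(2)]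
      bounded_linear.has_vector_derivative[OF bounded_linear_snd d(2)] by simp_all
  define Q where "Q = jprod X X + jprod Y Y - (1 / 3) *\<^sub>R one_mat"
  define Q' where "Q' = 2 *\<^sub>R jprod X X' + 2 *\<^sub>R jprod Y Y'"
  define q where "q = (\<lambda>t. jprod (fst (f t)) (fst (f t)) + jprod (snd (f t)) (snd (f t)) - (1 / 3) *\<^sub>R one_mat)"
  have dq: "(q has_vector_derivative Q') (at t)"
    unfolding q_def
    by (rule has_vector_derivative_eq_rhs, (rule has_vector_derivative_diff has_vector_derivative_add
         jprod.has_vector_derivative dX has_vector_derivative_const)+)
      (simp add: Q'_def X_def[symmetric] Y_def[symmetric] jprod_commute[of X'] jprod_commute[of Y'] scaleR_2)
  have dj: "((\<lambda>t. 2 *\<^sub>R jcomm (fst (f t)) (snd (f t)) (w t)) has_vector_derivative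
      2 *\<^sub>R (jcomm X' Y (w t) + jcomm X Y' (w t) + jcomm X Y w')) (at t)"
    if "(w has_vector_derivative w') (at t)" for w w'
    unfolding jcomm_def
    by (rule has_vector_derivative_eq_rhs, (rule bounded_linear.has_vector_derivative[OF bounded_linear_scaleR_right]
         has_vector_derivative_diff jprod.has_vector_derivative dX that)+)
      (simp add: X_def[symmetric] Y_def[symmetric] jprod_linear algebra_simps)
  have "((\<lambda>t. xi (f t) (g t)) has_vector_derivative
      (2 *\<^sub>R (jcomm X' Y A + jcomm X Y' A + jcomm X Y A') - (jprod Q' B + jprod Q B'),
       2 *\<^sub>R (jcomm X' Y B + jcomm X Y' B + jcomm X Y B') + (jprod Q' A + jprod Q A'))) (at t)"
  proof -
    have e: "xi (f t) (g t) = (2 *\<^sub>R jcomm (fst (f t)) (snd (f t)) (fst (g t)) - jprod (q t) (snd (g t)),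
       2 *\<^sub>R jcomm (fst (f t)) (snd (f t)) (snd (g t)) + jprod (q t) (fst (g t)))" for t
      unfolding xi_def q_def by (cases "g t") simp
    have qt: "q t = Q" by (simp add: q_def Q_def X_def Y_def)
    show ?thesis
      unfolding e
      by (rule has_vector_derivative_eq_rhs, (rule has_vector_derivative_PairI has_vector_derivative_diff
          has_vector_derivative_add dj dX jprod.has_vector_derivative dq)+)
        (simp add: qt A_def[symmetric] B_def[symmetric] add.commute)
  qed
  moreover have "lie_op D S (xi (f t) (g t)) =
      (2 *\<^sub>R (jcomm X' Y A + jcomm X Y' A + jcomm X Y A') - (jprod Q' B + jprod Q B'),
       2 *\<^sub>R (jcomm X' Y B + jcomm X Y' B + jcomm X Y B') + (jprod Q' A + jprod Q A'))"
  proof -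
    have xi: "xi (f t) (g t) = (2 *\<^sub>R jcomm X Y A - jprod Q B, 2 *\<^sub>R jcomm X Y B + jprod Q A)"
      by (simp add: fg xi_def Q_def)
    have 1: "D (2 *\<^sub>R jcomm X Y A - jprod Q B) - jprod S (2 *\<^sub>R jcomm X Y B + jprod Q A) =
     2 *\<^sub>R (jcomm X' Y A + jcomm X Y' A + jcomm X Y A') - (jprod Q' B + jprod Q B')"
      by (rule xi_deriv_fst[OF D S H defs Q_def Q'_def])
    \<comment> \<open>The other component is the first one with \<open>(A, B)\<close> replaced by
      \<open>(B, - A)\<close>, that is, after multiplication by \<open>- \<i>\<close>.\<close>
    have A2: "B' = D B - jprod S (- A)" by (simp add: defs jprod_linear)
    have "- A' = D (- A) + jprod S B"
      using linear_withinD(3)[OF Der_JD(1)[OF D] H(3), of "-1"] by (simp add: defs)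
    from xi_deriv_fst[OF D S H(1,2,4) Herm_minus[OF H(3)] defs(1,2) A2 this Q_def Q'_def]
    have 2: "D (2 *\<^sub>R jcomm X Y B + jprod Q A) + jprod S (2 *\<^sub>R jcomm X Y A - jprod Q B) =
      2 *\<^sub>R (jcomm X' Y B + jcomm X Y' B + jcomm X Y B') + (jprod Q' A + jprod Q A')"
      using jcomm_linear(6)[of X Y "-1" A] by (simp add: jprod_linear algebra_simps)
    show ?thesis unfolding xi lie_op_Pair 1 2 ..
  qed
  ultimately show "((\<lambda>t. xi (f t) (g t)) has_vector_derivative lie_op D S (xi (f t) (g t))) (at t)"
    by simp
qed


section \<open>Exponentials and what they preserve\<close>

lemma op_exp_flow:
  assumes "D \<in> Der_J n" "S \<in> Herm n" "flow (lie_op D S) (HermC n) f"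
  shows "op_exp (lie_op D S) (f 0) = f 1"
  by (rule op_exp_eqI[OF subspace_HermC lie_op_linear_within[OF assms(1,2)] assms(3)])

lemma flow_lie_op:
  assumes "D \<in> Der_J n" "S \<in> Herm n" "Z \<in> HermC n"
  obtains f where "flow (lie_op D S) (HermC n) f" "f 0 = Z" "f 1 = op_exp (lie_op D S) Z"
  by (rule flow_op_exp[OF subspace_HermC lie_op_linear_within[OF assms(1,2)] assms(3)])

lemma op_exp_HermC:
  assumes "D \<in> Der_J n" "S \<in> Herm n" "Z \<in> HermC n"
  shows "op_exp (lie_op D S) Z \<in> HermC n"
  using flow_lie_op[OF assms] by (metis flow_def)

lemma cscale_HermC: "Z \<in> HermC n \<Longrightarrow> cscale c Z \<in> HermC n"
  by (elim HermC_cases) (simp add: Herm_add Herm_diff Herm_scaleR)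

lemma linear_cscale: "linear (cscale c)"
  by (auto intro!: linearI simp: cscale_def algebra_simps)

lemma op_exp_linear:
  assumes "D \<in> Der_J n" "S \<in> Herm n"
  shows "linear_within (HermC n) (op_exp (lie_op D S))"
    "Z \<in> HermC n \<Longrightarrow> op_exp (lie_op D S) (cscale c Z) = cscale c (op_exp (lie_op D S) Z)"
proof -
  note l = linear_withinD[OF lie_op_linear_within[OF assms]]
  show cs: "op_exp (lie_op D S) (cscale c Z) = cscale c (op_exp (lie_op D S) Z)" if Z: "Z \<in> HermC n" for c Z
  proof -
    obtain f where f: "flow (lie_op D S) (HermC n) f" "f 0 = Z" "f 1 = op_exp (lie_op D S) Z"
      by (rule flow_lie_op[OF assms Z])
    have "bounded_linear (cscale c)" using linear_cscale by (simp add: linear_conv_bounded_linear)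
    with f(1) have "flow (lie_op D S) (HermC n) (\<lambda>t. cscale c (f t))"
      unfolding flow_def
      by (auto simp: cscale_HermC lie_op_cscale[OF assms(1)] intro: bounded_linear.has_vector_derivative)
    from op_exp_flow[OF assms this] f show ?thesis by simp
  qed
  have add: "op_exp (lie_op D S) (Z + W) = op_exp (lie_op D S) Z + op_exp (lie_op D S) W"
    if Z: "Z \<in> HermC n" and W: "W \<in> HermC n" for Z W
  proof -
    obtain f where f: "flow (lie_op D S) (HermC n) f" "f 0 = Z" "f 1 = op_exp (lie_op D S) Z"
      by (rule flow_lie_op[OF assms Z])
    obtain g where g: "flow (lie_op D S) (HermC n) g" "g 0 = W" "g 1 = op_exp (lie_op D S) W"
      by (rule flow_lie_op[OF assms W])
    have "flow (lie_op D S) (HermC n) (\<lambda>t. f t + g t)"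
      using f(1) g(1) unfolding flow_def
      by (simp add: l subspace_add[OF subspace_HermC] has_vector_derivative_add)
    from op_exp_flow[OF assms this] f g show ?thesis by simp
  qed
  have "op_exp (lie_op D S) (r *\<^sub>R Z) = r *\<^sub>R op_exp (lie_op D S) Z" if "Z \<in> HermC n" for r Z
  proof -
    have "cscale (of_real r) W = r *\<^sub>R W" for W by (cases W) simp
    with cs[OF that, of "of_real r"] show ?thesis by simp
  qed
  then show "linear_within (HermC n) (op_exp (lie_op D S))"
    unfolding linear_within_def using add op_exp_HermC[OF assms] by blast
qed

lemma op_exp_norm:
  assumes "D \<in> Der_J n" "S \<in> Herm n" "Z \<in> HermC n"
  shows "norm (op_exp (lie_op D S) Z) = norm Z"
proof -
  obtain f where f: "flow (lie_op D S) (HermC n) f" "f 0 = Z" "f 1 = op_exp (lie_op D S) Z"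
    by (rule flow_lie_op[OF assms])
  have "((\<lambda>t. inner (f t) (f t)) has_real_derivative 0) (at t)" for t
  proof -
    have d: "(f has_derivative (\<lambda>r. r *\<^sub>R lie_op D S (f t))) (at t)" and m: "f t \<in> HermC n"
      using f(1) by (auto simp: flow_def has_vector_derivative_def)
    show ?thesis
      using lie_op_skew[OF assms(1,2) m] unfolding has_field_derivative_def
      by (intro has_derivative_eq_rhs[OF has_derivative_inner[OF d d]]) (auto simp: inner_commute)
  qed
  then have "inner (f 1) (f 1) = inner (f 0) (f 0)"
    using DERIV_isconst_all[of "\<lambda>t. inner (f t) (f t)" 1 0] by blast
  then show ?thesis using f by (simp add: norm_eq_sqrt_inner)
qed

lemma freudC_HermC: "Z \<in> HermC n \<Longrightarrow> freudC Z \<in> HermC n"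
  by (elim HermC_cases) (simp add: freudC_def Herm_diff Herm_scaleR freud_Herm)

lemma op_exp_freudC:
  assumes D: "D \<in> Der_J n" and S: "S \<in> Herm n" "tr S = 0" and Z: "Z \<in> HermC n" "freudC Z = 0"
  shows "freudC (op_exp (lie_op D S) Z) = 0"
proof -
  obtain f where f: "flow (lie_op D S) (HermC n) f" "f 0 = Z" "f 1 = op_exp (lie_op D S) Z"
    by (rule flow_lie_op[OF D S(1) Z(1)])
  have S': "- S \<in> Herm n" using S by (simp add: Herm_minus)
  have "flow (lie_op D (- S)) (HermC n) (\<lambda>t. freudC (f t))"
    unfolding flow_def
  proof safe
    fix t
    have m: "f t \<in> HermC n" and d: "(f has_vector_derivative lie_op D S (f t)) (at t)"
      using f(1) by (auto simp: flow_def)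
    show "freudC (f t) \<in> HermC n" using m by (rule freudC_HermC)
    obtain X Y X' Y' where XY: "f t = (X, Y)" "lie_op D S (f t) = (X', Y')" by (metis surj_pair)
    have dX: "((\<lambda>t. fst (f t)) has_vector_derivative X') (at t)" "((\<lambda>t. snd (f t)) has_vector_derivative Y') (at t)"
      using bounded_linear.has_vector_derivative[OF bounded_linear_fst d]
        bounded_linear.has_vector_derivative[OF bounded_linear_snd d] XY by simp_all
    show "((\<lambda>t. freudC (f t)) has_vector_derivative lie_op D (- S) (freudC (f t))) (at t)"
      unfolding XY(1) freudC_deriv[OF D S m[unfolded XY(1)] XY(2)[unfolded XY(1), symmetric], symmetric]
      unfolding freudC_def
      by (rule has_vector_derivative_eq_rhs, (rule has_vector_derivative_PairI has_vector_derivative_diff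
          bounded_linear.has_vector_derivative[OF bounded_linear_scaleR_right] freud.has_vector_derivative dX)+)
         (simp add: XY)
  qed
  moreover have "flow (lie_op D (- S)) (HermC n) (\<lambda>t. 0)"
    using linear_withinD(3)[OF lie_op_linear_within[OF D S'], of 0 0] subspace_0[OF subspace_HermC]
    by (simp add: flow_def)
  ultimately have "freudC (f 1) = 0"
    by (rule flow_unique[OF subspace_HermC lie_op_linear_within[OF D S']]) (simp add: f Z)
  then show ?thesis by (simp add: f)
qed

lemma op_exp_xi:
  assumes D: "D \<in> Der_J n" and S: "S \<in> Herm n" and "W \<in> HermC n" "Z \<in> HermC n"
  shows "op_exp (lie_op D S) (xi W Z) = xi (op_exp (lie_op D S) W) (op_exp (lie_op D S) Z)"
proof -
  obtain f where f: "flow (lie_op D S) (HermC n) f" "f 0 = W" "f 1 = op_exp (lie_op D S) W"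
    by (rule flow_lie_op[OF D S assms(3)])
  obtain g where g: "flow (lie_op D S) (HermC n) g" "g 0 = Z" "g 1 = op_exp (lie_op D S) Z"
    by (rule flow_lie_op[OF D S assms(4)])
  from op_exp_flow[OF D S flow_xi[OF D S f(1) g(1)]] f g show ?thesis by simp
qed

lemma uminus_Der_J:
  assumes "D \<in> Der_J n"
  shows "(\<lambda>X. - D X) \<in> Der_J n"
  unfolding Der_J_def linear_on_Herm_iff linear_within_def
  using Der_JD(2)[OF assms] linear_withinD[OF Der_JD(1)[OF assms]]
  by (simp add: Herm_minus jprod_linear)

lemma op_exp_minus:
  assumes D: "D \<in> Der_J n" and S: "S \<in> Herm n" and Z: "Z \<in> HermC n"
  shows "op_exp (lie_op (\<lambda>X. - D X) (- S)) (op_exp (lie_op D S) Z) = Z"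
proof -
  obtain f where f: "flow (lie_op D S) (HermC n) f" "f 0 = Z" "f 1 = op_exp (lie_op D S) Z"
    by (rule flow_lie_op[OF D S Z])
  have l: "lie_op (\<lambda>X. - D X) (- S) W = - lie_op D S W" for W
    by (cases W) (simp add: jprod_linear)
  \<comment> \<open>Running the flow backwards from time 1 solves the equation of the opposite
    generator and arrives at the starting point.\<close>
  have "flow (lie_op (\<lambda>X. - D X) (- S)) (HermC n) (\<lambda>t. f (1 - t))"
    unfolding flow_def
  proof safe
    fix t
    show "f (1 - t) \<in> HermC n" using f(1) by (auto simp: flow_def)
    have "((\<lambda>t. 1 - t) has_vector_derivative - 1) (at t)"
      by (auto intro!: derivative_eq_intros)
    from vector_diff_chain_at[OF this, of f] f(1)
    show "((\<lambda>t. f (1 - t)) has_vector_derivative lie_op (\<lambda>X. - D X) (- S) (f (1 - t))) (at t)"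
      by (simp add: o_def flow_def l)
  qed
  from op_exp_flow[OF uminus_Der_J[OF D] Herm_minus[OF S] this] f show ?thesis by simp
qed

text \<open>All properties go through one induction, so that the generators are analysed once.
  Inverses also have to be found here, because \<open>Ghat n\<close> is only introduced as closed
  under multiplication by exponentials.\<close>

lemma Ghat_props:
  assumes "g \<in> Ghat n"
  shows Ghat_linear: "linear_within (HermC n) g"
    and Ghat_cscale: "Z \<in> HermC n \<Longrightarrow> g (cscale c Z) = cscale c (g Z)"
    and Ghat_norm: "Z \<in> HermC n \<Longrightarrow> norm (g Z) = norm Z"
    and Ghat_freudC: "Z \<in> HermC n \<Longrightarrow> freudC Z = 0 \<Longrightarrow> freudC (g Z) = 0"
    and Ghat_xi: "W \<in> HermC n \<Longrightarrow> Z \<in> HermC n \<Longrightarrow> g (xi W Z) = xi (g W) (g Z)"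
    and Ghat_inverse: "\<exists>h\<in>Ghat n. \<forall>Z\<in>HermC n. h (g Z) = Z \<and> g (h Z) = Z"
proof -
  have comp: "g \<circ> h \<in> Ghat n" if "g \<in> Ghat n" "h \<in> Ghat n" for g h
    using that by (induction rule: Ghat.induct) (auto simp: o_assoc[symmetric] intro: Ghat.intros)
  have *: "linear_within (HermC n) g \<and> (\<forall>Z\<in>HermC n. (\<forall>c. g (cscale c Z) = cscale c (g Z)) \<and> norm (g Z) = norm Z \<and>
      (freudC Z = 0 \<longrightarrow> freudC (g Z) = 0) \<and> (\<forall>W\<in>HermC n. g (xi W Z) = xi (g W) (g Z))) \<and>
      (\<exists>h\<in>Ghat n. \<forall>Z\<in>HermC n. h (g Z) = Z \<and> g (h Z) = Z)"
    using assms
  proof (induction rule: Ghat.induct)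
    case Ghat_id
    show ?case by (auto simp: linear_within_def intro!: bexI[OF _ Ghat.Ghat_id])
  next
    case (Ghat_exp \<xi> g)
    obtain D S where \<xi>: "\<xi> = lie_op D S" and D: "D \<in> Der_J n" and S: "S \<in> Herm n" "tr S = 0"
      using Ghat_exp.hyps(1) by (rule lie_GhatE)
    define e where "e = op_exp (lie_op D S)"
    define e' where "e' = op_exp (lie_op (\<lambda>X. - D X) (- S))"
    have m: "lie_op (\<lambda>X. - D X) (- S) \<in> lie_Ghat n"
      using uminus_Der_J[OF D] S by (intro lie_GhatI) (simp_all add: Herm_minus tr_minus)
    obtain h where h: "h \<in> Ghat n" "\<forall>Z\<in>HermC n. h (g Z) = Z \<and> g (h Z) = Z"
      using Ghat_exp.IH by blast
    have e'G: "e' \<in> Ghat n"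
      using Ghat.Ghat_exp[OF m Ghat.Ghat_id] by (simp add: e'_def)
    have gl: "linear_within (HermC n) g" using Ghat_exp.IH by blast
    have e'H: "e' Z \<in> HermC n" if "Z \<in> HermC n" for Z
      unfolding e'_def by (rule op_exp_HermC[OF uminus_Der_J[OF D] Herm_minus[OF S(1)] that])
    have e'e: "e' (e Z) = Z" if "Z \<in> HermC n" for Z
      unfolding e'_def e_def by (rule op_exp_minus[OF D S(1) that])
    have ee': "e (e' Z) = Z" if "Z \<in> HermC n" for Z
      using op_exp_minus[OF uminus_Der_J[OF D] Herm_minus[OF S(1)] that] by (simp add: e'_def e_def)
    have el: "linear_within (HermC n) e"
      and ec: "\<And>Z c. Z \<in> HermC n \<Longrightarrow> e (cscale c Z) = cscale c (e Z)"
      unfolding e_def using op_exp_linear[OF D S(1)] by auto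
    have en: "\<And>Z. Z \<in> HermC n \<Longrightarrow> norm (e Z) = norm Z"
      and ef: "\<And>Z. Z \<in> HermC n \<Longrightarrow> freudC Z = 0 \<Longrightarrow> freudC (e Z) = 0"
      and ex: "\<And>W Z. W \<in> HermC n \<Longrightarrow> Z \<in> HermC n \<Longrightarrow> e (xi W Z) = xi (e W) (e Z)"
      unfolding e_def using op_exp_norm[OF D S(1)] op_exp_freudC[OF D S] op_exp_xi[OF D S(1)] by auto
    have gH: "g Z \<in> HermC n" if "Z \<in> HermC n" for Z using linear_withinD(1)[OF gl that] .
    have "linear_within (HermC n) (e \<circ> g)"
      using linear_withinD[OF gl] linear_withinD[OF el] by (auto simp: linear_within_def)
    moreover have "\<exists>h\<in>Ghat n. \<forall>Z\<in>HermC n. h ((e \<circ> g) Z) = Z \<and> (e \<circ> g) (h Z) = Z"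
    proof (rule bexI[OF _ comp[OF h(1) e'G]], intro ballI conjI)
      fix Z assume Z: "Z \<in> HermC n"
      show "(h \<circ> e') ((e \<circ> g) Z) = Z" using h(2) Z e'e[OF gH[OF Z]] by simp
      show "(e \<circ> g) ((h \<circ> e') Z) = Z" using h(2) e'H[OF Z] ee'[OF Z] by simp
    qed
    ultimately show ?case
      unfolding \<xi> e_def[symmetric] using Ghat_exp.IH gH by (auto simp: ec en ef ex o_def)
  qed
  from * show "linear_within (HermC n) g" "\<exists>h\<in>Ghat n. \<forall>Z\<in>HermC n. h (g Z) = Z \<and> g (h Z) = Z"
    "Z \<in> HermC n \<Longrightarrow> g (cscale c Z) = cscale c (g Z)" "Z \<in> HermC n \<Longrightarrow> norm (g Z) = norm Z"
    "Z \<in> HermC n \<Longrightarrow> freudC Z = 0 \<Longrightarrow> freudC (g Z) = 0"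
    "W \<in> HermC n \<Longrightarrow> Z \<in> HermC n \<Longrightarrow> g (xi W Z) = xi (g W) (g Z)"
    by blast+
qed

lemma Ghat_comp: "g \<in> Ghat n \<Longrightarrow> h \<in> Ghat n \<Longrightarrow> g \<circ> h \<in> Ghat n"
  by (induction rule: Ghat.induct) (auto simp: o_assoc[symmetric] intro: Ghat.intros)

section \<open>The complexified projective plane\<close>

lemma freudC_eq_0_iff:
  assumes "X \<in> Herm n" "Y \<in> Herm n"
  shows "freudC (X, Y) = 0 \<longleftrightarrow> jprod X X - jprod Y Y = tr X *\<^sub>R X - tr Y *\<^sub>R Y \<and>
    2 *\<^sub>R jprod X Y = tr X *\<^sub>R Y + tr Y *\<^sub>R X"
proof -
  define M where "M = jprod X X - jprod Y Y - (tr X *\<^sub>R X - tr Y *\<^sub>R Y)"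
  define N where "N = 2 *\<^sub>R jprod X Y - (tr X *\<^sub>R Y + tr Y *\<^sub>R X)"
  have tr1: "tr one_mat = 3" by (simp add: one_mat_mk)
  have "freud X X - freud Y Y = M + (- tr M / 2) *\<^sub>R one_mat"
    by (simp add: freud_def M_def tr_diff tr_add tr_scaleR algebra_simps diff_divide_distrib add_divide_distrib flip: scaleR_add_left)
  moreover have "2 *\<^sub>R freud X Y = N + (- tr N / 2) *\<^sub>R one_mat"
    by (simp add: freud_def N_def tr_diff tr_add tr_scaleR diff_divide_distrib algebra_simps)
  moreover have "M + (- tr M / 2) *\<^sub>R one_mat = 0 \<longleftrightarrow> M = 0" for M
  proof
    assume *: "M + (- tr M / 2) *\<^sub>R one_mat = 0"
    \<comment> \<open>The identity has trace 3, so the trace of the left side is minus half the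
      trace of \<open>M\<close>.\<close>
    from arg_cong[OF this, of tr] have "tr M = 0" by (simp add: tr_diff tr_scaleR tr1)
    with * show "M = 0" by simp
  qed simp
  ultimately show ?thesis
    by (simp add: freudC_def zero_prod_def M_def N_def)
qed

text \<open>Here \<open>x\<close>, \<open>y\<close>, \<open>z\<close> and \<open>p\<close>,
  \<open>q\<close>, \<open>r\<close> are the diagonals of the real and imaginary parts,
  \<open>A\<close>, \<open>B\<close>, \<open>C\<close> the squared norms of the off-diagonal entries
  of the imaginary part, and \<open>t\<close> is the trace. The assumptions on them are the cone
  equations entry by entry together with the unit norm.\<close>

lemma normal_form_scalars:
  fixes x y z p q r A B C t :: real
  assumes ord: "x \<ge> y" "y \<ge> z" and t: "t = x + y + z" "t \<ge> 0" and pqr: "p + q + r = 0"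
    and nonneg: "A \<ge> 0" "B \<ge> 0" "C \<ge> 0"
    and d: "x\<^sup>2 - (p\<^sup>2 + B + C) = t * x" "y\<^sup>2 - (q\<^sup>2 + A + C) = t * y" "z\<^sup>2 - (r\<^sup>2 + A + B) = t * z"
    and o: "2 * (x * p) = t * p" "2 * (y * q) = t * q"
    and abc: "x = 0 \<or> A = 0" "y = 0 \<or> B = 0" "z = 0 \<or> C = 0"
    and n1: "x\<^sup>2 + y\<^sup>2 + z\<^sup>2 + (p\<^sup>2 + q\<^sup>2 + r\<^sup>2 + 2 * (A + B + C)) = 1"
  shows "y = 0 \<and> p = 0 \<and> q = 0 \<and> r = 0 \<and> A = 0 \<and> C = 0 \<and> B = x * (- z) \<and> x - z = 1 \<and> z \<le> 0"
proof -
  have x: "x > 0"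
  proof (rule ccontr)
    assume "\<not> x > 0"
    then have 0: "x = 0" "y = 0" "z = 0" "t = 0" using ord t by linarith+
    have "p\<^sup>2 + B + C = 0" "q\<^sup>2 + A + C = 0" "r\<^sup>2 + A + B = 0" using d unfolding 0 by simp_all
    moreover have "p\<^sup>2 \<ge> 0" "q\<^sup>2 \<ge> 0" "r\<^sup>2 \<ge> 0" by simp_all
    ultimately have "A = 0" "B = 0" "C = 0" "p\<^sup>2 = 0" "q\<^sup>2 = 0" "r\<^sup>2 = 0" using nonneg by linarith+
    then show False using n1 unfolding 0 by simp
  qed
  have a: "A = 0" using abc(1) x by auto
  have xt: "x * (x - t) = p\<^sup>2 + B + C"
    using d(1) by (simp add: power2_eq_square algebra_simps)
  have "x * (x - t) \<ge> 0" unfolding xt using nonneg by simp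
  then have "x \<ge> t" using x by (simp add: zero_le_mult_iff)
  have "2 * x \<noteq> t" using x \<open>x \<ge> t\<close> by linarith
  moreover have "(2 * x - t) * p = 0" using o(1) by (simp add: algebra_simps)
  ultimately have p: "p = 0" by simp
  have yz: "y + z \<le> 0" "z \<le> 0" using \<open>x \<ge> t\<close> t ord by linarith+
  have yt: "y * (y - t) = q\<^sup>2 + C"
    using d(2) a by (simp add: power2_eq_square algebra_simps)
  \<comment> \<open>If \<open>y\<close> were nonzero, the off-diagonal entries would vanish and
    \<open>x = y = t\<close>, \<open>z = - t\<close>. But then \<open>z\<close> is a negative root
    of \<open>z * (z - t) = 0\<close>, which contradicts \<open>t \<ge> 0\<close>.\<close>
  have y: "y = 0"
  proof (rule ccontr)
    assume y0: "y \<noteq> 0"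
    then have b: "B = 0" using abc by simp
    have z: "z < 0" using yz ord y0 by linarith
    then have c: "C = 0" using abc by simp
    have "x * (x - t) = 0" using xt b c p by simp
    then have xt': "x = t" using x by simp
    then have zy: "z = - y" using t(1) by linarith
    then have "y > 0" using z by linarith
    have "y * (y - t) \<ge> 0" unfolding yt using nonneg by simp
    then have "y \<ge> t" using \<open>y > 0\<close> by (simp add: zero_le_mult_iff)
    then have yt': "y = t" using ord xt' by linarith
    have "(2 * y - t) * q = 0" using o(2) by (simp add: algebra_simps)
    then have "q = 0" using yt' \<open>y > 0\<close> by simp
    then have "r = 0" using pqr p by simp
    then have "z * (z - t) = 0" using d(3) a b by (simp add: power2_eq_square algebra_simps)
    then have "z = t" using z by simp
    then show False using z t(2) by linarith
  qed
  \<comment> \<open>For \<open>z = 0\<close> the trace equals \<open>x\<close>, which leaves no room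
    for \<open>B\<close> and \<open>C\<close>; otherwise the equation for the entry 12
    applies.\<close>
  have bc: "C = 0"
  proof (cases "z = 0")
    case True
    then have "x = t" using t(1) y by linarith
    then have "p\<^sup>2 + B + C = 0" using xt by simp
    then show ?thesis using nonneg p by simp
  qed (use abc in simp)
  have q: "q = 0" using yt y bc by simp
  then have r: "r = 0" using pqr p by simp
  have "x - t = - z" using t(1) y by linarith
  then have xz: "B = x * (- z)" using xt p bc by simp
  have "(x - z)\<^sup>2 = 1\<^sup>2"
    using n1 unfolding xz y p q r bc a by (simp add: power2_eq_square algebra_simps)
  then have "x - z = 1"
    by (rule power2_eq_imp_eq) (use x yz in auto)
  then show ?thesis using y p q r a bc xz yz(2) by (intro conjI)
qed
text \<open>Only \<open>X\<close> is diagonalized; its eigenvalues then decide which entries of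
  \<open>Y\<close> can survive in \<open>2 X Y = t Y\<close>.\<close>

lemma normal_form_real:
  assumes X: "X \<in> Herm n" and Y: "Y \<in> Herm n" and tX: "tr X \<ge> 0" and tY: "tr Y = 0"
    and e1: "jprod X X - jprod Y Y = tr X *\<^sub>R X" and e2: "2 *\<^sub>R jprod X Y = tr X *\<^sub>R Y"
    and nm: "(norm X)\<^sup>2 + (norm Y)\<^sup>2 = 1"
  obtains g \<alpha> \<beta> b where "g \<in> rotations n" "g X = mk \<alpha> 0 (- \<beta>) 0 0 0" "g Y = mk 0 0 0 0 b 0"
    "b \<in> Alg n" "\<alpha> \<ge> \<beta>" "\<beta> \<ge> 0" "\<alpha> + \<beta> = 1" "(norm b)\<^sup>2 = \<alpha> * \<beta>"
proof -
  obtain g x y z where g: "g \<in> rotations n" and gX: "g X = mk x y z 0 0 0" and ord: "x \<ge> y" "y \<ge> z"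
    using spectral[OF X] by metis
  obtain p q r a b c where gY: "g Y = mk p q r a b c" and alg: "b \<in> Alg n"
    using rotations_Herm[OF g Y] by (rule Herm_cases)
  define t where "t = tr X"
  have t: "t = x + y + z" "t \<ge> 0" "p + q + r = 0"
    using rotations_tr[OF g X] rotations_tr[OF g Y] gX gY tX tY by (simp_all add: t_def)
  have lin: "g (A - B) = g A - g B" "g (s *\<^sub>R A) = s *\<^sub>R g A" for A B s
    using linear_rotations[OF g] by (simp_all add: linear_diff linear_scale)
  have "jprod (g X) (g X) - jprod (g Y) (g Y) = t *\<^sub>R g X"
    using arg_cong[OF e1, of g] X Y by (simp add: lin rotations_jprod[OF g] t_def)
  then have d: "x\<^sup>2 - (p\<^sup>2 + (norm b)\<^sup>2 + (norm c)\<^sup>2) = t * x" "y\<^sup>2 - (q\<^sup>2 + (norm a)\<^sup>2 + (norm c)\<^sup>2) = t * y"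
    "z\<^sup>2 - (r\<^sup>2 + (norm a)\<^sup>2 + (norm b)\<^sup>2) = t * z"
    unfolding gX gY jprod_mk_self mk_diff mk_scaleR mk_eq_iff by simp_all
  have "2 *\<^sub>R jprod (g X) (g Y) = t *\<^sub>R g Y"
    using arg_cong[OF e2, of g] X Y by (simp add: lin rotations_jprod[OF g] t_def)
  then have o: "2 * (x * p) = t * p" "2 * (y * q) = t * q" "2 * (z * r) = t * r"
    "y + z = t \<or> a = 0" "z + x = t \<or> b = 0" "x + y = t \<or> c = 0"
    unfolding gX gY jprod_mk mk_diff mk_scaleR mk_eq_iff by (simp_all, (smt (verit))+)
  from o(4-6) have "x = 0 \<or> (norm a)\<^sup>2 = 0" "y = 0 \<or> (norm b)\<^sup>2 = 0" "z = 0 \<or> (norm c)\<^sup>2 = 0"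
    unfolding t(1) by auto
  note abc = this
  have "(norm (g X))\<^sup>2 + (norm (g Y))\<^sup>2 = 1"
    using nm rotations_inner[OF g X X] rotations_inner[OF g Y Y] by (simp add: power2_norm_eq_inner)
  then have n1: "x\<^sup>2 + y\<^sup>2 + z\<^sup>2 + (p\<^sup>2 + q\<^sup>2 + r\<^sup>2 + 2 * ((norm a)\<^sup>2 + (norm b)\<^sup>2 + (norm c)\<^sup>2)) = 1"
    unfolding gX gY norm_mk by simp
  have res: "y = 0 \<and> p = 0 \<and> q = 0 \<and> r = 0 \<and> (norm a)\<^sup>2 = 0 \<and> (norm c)\<^sup>2 = 0 \<and>
      (norm b)\<^sup>2 = x * (- z) \<and> x - z = 1 \<and> z \<le> 0"
    by (rule normal_form_scalars[OF ord t _ _ _ d o(1,2) abc n1]) simp_all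
  show thesis
  proof (rule that[OF g])
    show "g X = mk x 0 (- (- z)) 0 0 0" using gX res by simp
    show "g Y = mk 0 0 0 0 b 0" using gY res by simp
    show "b \<in> Alg n" by fact
    show "- z \<le> x" using t(1,2) res by linarith
    show "0 \<le> - z" "x + - z = 1" "(norm b)\<^sup>2 = x * - z" using res by simp_all
  qed
qed

text \<open>The punctured affine cone over \<open>planeC n\<close>; computing with its vectors
  avoids choosing representatives of lines.\<close>

definition orbit_cone :: "nat \<Rightarrow> (omat \<times> omat) set"
  where "orbit_cone n = {cscale c (g (E_mat, 0)) | c g. c \<noteq> 0 \<and> g \<in> Ghat n}"

lemma E0_HermC [simp]: "(E_mat, 0) \<in> HermC n"
  by simp

lemma cscale_cscale: "cscale c (cscale d Z) = cscale (c * d) Z"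
  by (cases Z) (simp add: algebra_simps)

lemma cscale_1 [simp]: "cscale 1 Z = Z"
  by (cases Z) simp

lemma cscale_0_iff: "cscale c Z = 0 \<longleftrightarrow> c = 0 \<or> Z = 0"
proof
  assume *: "cscale c Z = 0"
  show "c = 0 \<or> Z = 0"
  proof (rule disjCI)
    assume "Z \<noteq> 0"
    show "c = 0"
    proof (rule ccontr)
      assume "c \<noteq> 0"
      then have "Z = cscale (1 / c) (cscale c Z)" by (simp add: cscale_cscale)
      then show False using * \<open>Z \<noteq> 0\<close> linear_0[OF linear_cscale] by simp
    qed
  qed
qed (auto simp: cscale_def zero_prod_def)

lemma norm_cscale: "norm (cscale c Z) = cmod c * norm Z"
proof -
  obtain X Y where Z: "Z = (X, Y)" by (metis surj_pair)
  have "(norm (cscale c Z))\<^sup>2 = (cmod c * norm Z)\<^sup>2"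
    unfolding Z power_mult_distrib power2_norm_eq_inner[of "cscale _ _"] power2_norm_eq_inner[of "(X, Y)"] cmod_power2
    by (simp add: inner_add_left inner_add_right inner_diff_left inner_diff_right inner_commute[of Y X]
        power2_eq_square algebra_simps)
  then show ?thesis by (simp add: power2_eq_iff_nonneg)
qed

lemma line_cscale: "c \<noteq> 0 \<Longrightarrow> line (cscale c Z) = line Z"
proof -
  assume c: "c \<noteq> 0"
  have "cscale d Z = cscale (d / c) (cscale c Z)" for d using c by (simp add: cscale_cscale)
  then show ?thesis unfolding line_def image_def by (metis UNIV_I cscale_cscale)
qed

lemma line_eqD:
  assumes "line Z = line W" "Z \<noteq> 0"
  obtains c where "c \<noteq> 0" "Z = cscale c W"
proof -
  have "Z \<in> line Z" unfolding line_def by (metis cscale_1 rangeI)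
  then obtain c where "Z = cscale c W" using assms(1) by (auto simp: line_def)
  then show thesis using that assms(2) cscale_0_iff by metis
qed

lemma orbit_coneE:
  assumes "Z \<in> orbit_cone n"
  obtains c g where "c \<noteq> 0" "g \<in> Ghat n" "Z = cscale c (g (E_mat, 0))"
  using assms unfolding orbit_cone_def by blast

lemma orbit_cone_HermC:
  assumes "Z \<in> orbit_cone n"
  shows "Z \<in> HermC n"
  using assms by (rule orbit_coneE) (simp add: cscale_HermC linear_withinD(1)[OF Ghat_linear E0_HermC])

lemma E_orbit_cone: "(E_mat, 0) \<in> orbit_cone n"
  unfolding orbit_cone_def by (intro CollectI exI[of _ 1] exI[of _ id]) (simp add: Ghat.Ghat_id)

lemma orbit_cone_cscale: "Z \<in> orbit_cone n \<Longrightarrow> c \<noteq> 0 \<Longrightarrow> cscale c Z \<in> orbit_cone n"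
  unfolding orbit_cone_def by (auto simp: cscale_cscale) (metis no_zero_divisors)

lemma orbit_cone_cscale_iff: "c \<noteq> 0 \<Longrightarrow> cscale c Z \<in> orbit_cone n \<longleftrightarrow> Z \<in> orbit_cone n"
  using orbit_cone_cscale[of "cscale c Z" n "1 / c"] orbit_cone_cscale[of Z n c]
  by (auto simp: cscale_cscale)

lemma orbit_cone_Ghat:
  assumes "h \<in> Ghat n" "Z \<in> orbit_cone n"
  shows "h Z \<in> orbit_cone n"
proof -
  obtain c g where c: "c \<noteq> 0" "g \<in> Ghat n" "Z = cscale c (g (E_mat, 0))"
    using assms(2) by (rule orbit_coneE)
  then have "h Z = cscale c ((h \<circ> g) (E_mat, 0))"
    by (simp add: Ghat_cscale[OF assms(1) linear_withinD(1)[OF Ghat_linear[OF c(2)] E0_HermC]])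
  then show ?thesis
    unfolding orbit_cone_def using c Ghat_comp[OF assms(1) c(2)] by blast
qed

lemma orbit_cone_Ghat_iff:
  assumes "h \<in> Ghat n" "Z \<in> HermC n"
  shows "h Z \<in> orbit_cone n \<longleftrightarrow> Z \<in> orbit_cone n"
  using Ghat_inverse[OF assms(1)] orbit_cone_Ghat assms by metis

lemma planeC_orbit_cone: "planeC n = line ` orbit_cone n"
proof
  show "planeC n \<subseteq> line ` orbit_cone n"
    unfolding planeC_def orbit_cone_def by (auto intro!: image_eqI exI[of _ 1])
  show "line ` orbit_cone n \<subseteq> planeC n"
    unfolding planeC_def orbit_cone_def by (auto simp: line_cscale)
qed

lemma complexify_Pair [simp]: "complexify f (X, Y) = (f X, f Y)"
  by (simp add: complexify_def)

text \<open>A rotation conjugates an exponential to the exponential of the conjugated generator,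
  since it carries one flow to the other.\<close>

lemma rotations_normalize_Ghat:
  assumes k: "k \<in> rotations n" and g: "g \<in> Ghat n"
  shows "\<exists>g'\<in>Ghat n. \<forall>Z\<in>HermC n. complexify k (g Z) = g' (complexify k Z)"
  using g
proof (induction rule: Ghat.induct)
  case Ghat_id
  show ?case by (rule bexI[OF _ Ghat.Ghat_id]) simp
next
  case (Ghat_exp \<xi> g)
  obtain D S where \<xi>: "\<xi> = lie_op D S" and D: "D \<in> Der_J n" and S: "S \<in> Herm n" "tr S = 0"
    using Ghat_exp.hyps(1) by (rule lie_GhatE)
  obtain h where h: "h \<in> rotations n" "\<And>X. X \<in> Herm n \<Longrightarrow> h (k X) = X" "\<And>X. X \<in> Herm n \<Longrightarrow> k (h X) = X"
    using rotations_inverse[OF k] by metis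
  define D' where "D' = (\<lambda>X. k (D (h X)))"
  have D': "D' \<in> Der_J n" unfolding D'_def by (rule rotations_Der_J[OF h(1) k D h(3,2)])
  have S': "k S \<in> Herm n" "tr (k S) = 0" using S by (simp_all add: rotations_Herm[OF k] rotations_tr[OF k])
  obtain g' where g': "g' \<in> Ghat n" "\<forall>Z\<in>HermC n. complexify k (g Z) = g' (complexify k Z)"
    using Ghat_exp.IH by blast
  have m: "lie_op D' (k S) \<in> lie_Ghat n"
    by (rule lie_GhatI[OF D' S'])
  have eq: "complexify k (op_exp (lie_op D S) Z) = op_exp (lie_op D' (k S)) (complexify k Z)" if Z: "Z \<in> HermC n" for Z
  proof -
    obtain f where f: "flow (lie_op D S) (HermC n) f" "f 0 = Z" "f 1 = op_exp (lie_op D S) Z"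
      by (rule flow_lie_op[OF D S(1) Z])
    have lin: "linear k" by (rule linear_rotations[OF k])
    have "linear (complexify k)"
      by (rule linearI) (auto simp: complexify_def linear_add[OF lin] linear_scale[OF lin])
    then have bl: "bounded_linear (complexify k)" by (simp add: linear_conv_bounded_linear)
    have c: "complexify k (lie_op D S W) = lie_op D' (k S) (complexify k W)" if "W \<in> HermC n" for W
      using that
      by (elim HermC_cases) (simp add: D'_def h(2) linear_add[OF lin] linear_diff[OF lin] rotations_jprod[OF k] S(1))
    have "flow (lie_op D' (k S)) (HermC n) (\<lambda>t. complexify k (f t))"
      unfolding flow_def
    proof safe
      fix t
      have m: "f t \<in> HermC n" and d: "(f has_vector_derivative lie_op D S (f t)) (at t)"
        using f(1) by (auto simp: flow_def)
      show "complexify k (f t) \<in> HermC n" using m by (elim HermC_cases) (simp add: rotations_Herm[OF k])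
      show "((\<lambda>t. complexify k (f t)) has_vector_derivative lie_op D' (k S) (complexify k (f t))) (at t)"
        using bounded_linear.has_vector_derivative[OF bl d] c[OF m] by simp
    qed
    from op_exp_flow[OF D' S'(1) this] f show ?thesis by simp
  qed
  have "\<forall>Z\<in>HermC n. complexify k ((op_exp \<xi> \<circ> g) Z) = (op_exp (lie_op D' (k S)) \<circ> g') (complexify k Z)"
    using g'(2) eq linear_withinD(1)[OF Ghat_linear[OF Ghat_exp.hyps(2)]] by (simp add: \<xi>)
  then show ?case using Ghat.Ghat_exp[OF m g'(1)] by blast
qed

text \<open>The rotation is the exponential of the real element with derivation \<open>t\<close>
  times \<open>rot_gen u\<close> and zero part in \<open>Herm_tr n 0\<close>.\<close>

lemma complexify_rot_Ghat:
  assumes u: "u \<in> unit_elements n"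
  obtains g where "g \<in> Ghat n" "\<And>Z. Z \<in> HermC n \<Longrightarrow> g Z = complexify (rot t u) Z"
proof -
  define D where "D = (\<lambda>X. t *\<^sub>R rot_gen u X)"
  have rg: "rot_gen u \<in> Der_J n" by (rule rot_gen_Der_J[OF unit_elementsD(1)[OF u]])
  have D: "D \<in> Der_J n"
    unfolding Der_J_def linear_on_Herm_iff linear_within_def D_def
    using Der_JD(2)[OF rg] linear_withinD[OF Der_JD(1)[OF rg]]
    by (simp add: Herm_scaleR jprod_linear scaleR_add_right)
  have m: "lie_op D 0 \<in> lie_Ghat n" using D by (intro lie_GhatI) simp_all
  have f: "((\<lambda>s. rot (s * t) u X) has_vector_derivative D (rot (s * t) u X)) (at s)" if "X \<in> Herm n" for X s
  proof -
    have "((\<lambda>s. s * t) has_vector_derivative t) (at s)" by (auto intro!: derivative_eq_intros)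
    from vector_diff_chain_at[OF this, of "\<lambda>s. rot s u X"] flow_rot[OF u that]
    show ?thesis by (simp add: o_def flow_def D_def)
  qed
  have "op_exp (lie_op D 0) Z = complexify (rot t u) Z" if "Z \<in> HermC n" for Z
    using that
  proof (elim HermC_cases)
    fix X Y assume Z: "Z = (X, Y)" "X \<in> Herm n" "Y \<in> Herm n"
    have "flow (lie_op D 0) (HermC n) (\<lambda>s. (rot (s * t) u X, rot (s * t) u Y))"
      unfolding flow_def using Z
      by (auto simp: rot_Herm[OF unit_elementsD(1)[OF u]] jprod.zero_left intro!: has_vector_derivative_PairI f)
    from op_exp_flow[OF D Herm_0 this] show ?thesis using Z by (simp add: rot_0[of _ n])
  qed
  then show thesis using that[of "op_exp (lie_op D 0)"] Ghat.Ghat_exp[OF m Ghat.Ghat_id] by simp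
qed

lemma complexify_cscale: "linear k \<Longrightarrow> complexify k (cscale c Z) = cscale c (complexify k Z)"
  by (cases Z) (simp add: linear_add linear_diff linear_scale)

text \<open>The cyclic permutation is not visibly an exponential, but it normalizes the group and moves
  the base point by two quarter turns.\<close>

lemma orbit_cone_rotations:
  assumes "k \<in> rotations n" "Z \<in> orbit_cone n"
  shows "complexify k Z \<in> orbit_cone n"
proof -
  have cyc2: "complexify (\<lambda>X. cyc (cyc X)) Z \<in> orbit_cone n" if Z: "Z \<in> orbit_cone n" for Z
  proof -
    obtain c g where c: "c \<noteq> 0" "g \<in> Ghat n" "Z = cscale c (g (E_mat, 0))"
      using Z by (rule orbit_coneE)
    have k: "(\<lambda>X. cyc (cyc X)) \<in> rotations n" by (rule rotations_cyc2[OF rotations_id])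
    obtain g' where g': "g' \<in> Ghat n" "\<forall>Z\<in>HermC n. complexify (\<lambda>X. cyc (cyc X)) (g Z) = g' (complexify (\<lambda>X. cyc (cyc X)) Z)"
      using rotations_normalize_Ghat[OF k c(2)] by blast
    have u: "oreal 1 \<in> unit_elements n" by (simp add: unit_elements_def)
    obtain r where r: "r \<in> Ghat n" "\<And>Z. Z \<in> HermC n \<Longrightarrow> r Z = complexify (rot (pi / 2) (oreal 1)) Z"
      using complexify_rot_Ghat[OF u] by metis
    have "complexify (\<lambda>X. cyc (cyc X)) (E_mat, 0) = r (E_mat, 0)"
      using linear_0[OF linear_rot] linear_0[OF linear_cyc] by (simp add: r(2) E_mat_mk rot_mk)
    then have "complexify (\<lambda>X. cyc (cyc X)) (E_mat, 0) \<in> orbit_cone n"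
      using orbit_cone_Ghat[OF r(1) E_orbit_cone] by simp
    then have "cscale c (g' (complexify (\<lambda>X. cyc (cyc X)) (E_mat, 0))) \<in> orbit_cone n"
      using orbit_cone_cscale orbit_cone_Ghat[OF g'(1)] c(1) by blast
    then show ?thesis
      using g'(2) by (simp add: c(3) complexify_cscale[OF linear_rotations[OF k]] del: complexify_Pair)
  qed
  show ?thesis using assms(1)
  proof (induction rule: rotations.induct)
    case rotations_id
    then show ?case using assms(2) by (cases Z) simp
  next
    case (rotations_rot g u t)
    obtain r where r: "r \<in> Ghat n" "\<And>Z. Z \<in> HermC n \<Longrightarrow> r Z = complexify (rot t u) Z"
      using complexify_rot_Ghat[OF rotations_rot.hyps(2)] by metis
    have "r (complexify g Z) \<in> orbit_cone n" by (rule orbit_cone_Ghat[OF r(1) rotations_rot.IH])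
    then show ?case
      using r(2)[OF orbit_cone_HermC[OF rotations_rot.IH]] by (cases Z) simp
  next
    case (rotations_cyc g)
    \<comment> \<open>As \<open>cyc\<close> has order three, it is the square of its own
      square.\<close>
    have "complexify (\<lambda>X. cyc (cyc X)) (complexify (\<lambda>X. cyc (cyc X)) (complexify g Z)) \<in> orbit_cone n"
      by (intro cyc2 rotations_cyc.IH)
    moreover obtain X Y where Z: "Z = (X, Y)" "X \<in> Herm n" "Y \<in> Herm n"
      using orbit_cone_HermC[OF assms(2)] by (rule HermC_cases)
    ultimately show ?case
      using rotations_Herm[OF rotations_cyc.hyps] by (simp add: cyc_cyc_cyc[of _ n])
  qed
qed

lemma orbit_cone_rotations_iff:
  assumes "k \<in> rotations n" "Z \<in> HermC n"
  shows "complexify k Z \<in> orbit_cone n \<longleftrightarrow> Z \<in> orbit_cone n"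
proof -
  obtain h where h: "h \<in> rotations n" "\<And>X. X \<in> Herm n \<Longrightarrow> h (k X) = X"
    using rotations_inverse[OF assms(1)] by metis
  have "complexify h (complexify k Z) = Z" using assms(2) by (elim HermC_cases) (simp add: h)
  then show ?thesis using orbit_cone_rotations[OF h(1)] orbit_cone_rotations[OF assms(1)] by metis
qed

lemma trC_cscale: "trC (cscale c Z) = c * trC Z"
  by (cases Z) (simp add: trC_def complex_eq_iff tr_add tr_diff tr_scaleR)

lemma freudC_cscale: "freudC (cscale c Z) = cscale (c * c) (freudC Z)"
proof -
  obtain X Y where Z: "Z = (X, Y)" by (metis surj_pair)
  have eq: "v = w" if "\<And>e. inner v e = inner w e" for v w :: omat
    using that by (metis vector_eq_rdot)
  show ?thesis
    unfolding Z freudC_def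
    by (simp add: freud_linear freud_commute[of Y X], intro conjI; rule eq;
        simp add: inner_add_left inner_diff_left algebra_simps)
qed

lemma freudC_E: "freudC (E_mat, 0) = 0"
proof -
  have "jprod E_mat E_mat = E_mat" "tr E_mat = 1" by (simp_all add: E_mat_mk jprod_mk)
  then show ?thesis by (simp add: freudC_eq_0_iff[of _ n] jprod.zero_left jprod.zero_right)
qed

lemma norm_E_mat [simp]: "norm E_mat = 1"
proof -
  have "(norm E_mat)\<^sup>2 = 1\<^sup>2" unfolding E_mat_mk norm_mk by simp
  then show ?thesis by (rule power2_eq_imp_eq) simp_all
qed

lemma phase_normalization:
  assumes "Z \<noteq> 0"
  obtains c where "c \<noteq> 0" "norm (cscale c Z) = 1" "trC (cscale c Z) = of_real (cmod (trC Z) / norm Z)"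
    "trC Z \<noteq> 0 \<Longrightarrow> c = cnj (trC Z) / of_real (cmod (trC Z) * norm Z)"
proof (cases "trC Z = 0")
  case True
  \<comment> \<open>When the trace vanishes every phase is admissible, so a positive scaling is
    enough.\<close>
  show thesis
    by (rule that[of "of_real (1 / norm Z)"]) (use assms True in \<open>simp_all add: norm_cscale trC_cscale norm_divide\<close>)
next
  case False
  have "cnj (trC Z) * trC Z = of_real ((cmod (trC Z))\<^sup>2)"
    by (metis complex_norm_square mult.commute of_real_power)
  then show thesis
    by (intro that[of "cnj (trC Z) / of_real (cmod (trC Z) * norm Z)"])
      (use assms False in \<open>simp_all add: norm_cscale trC_cscale norm_divide norm_mult power2_eq_square\<close>)
qed

lemma normal_form:
  assumes Z: "(X, Y) \<in> HermC n" and nm: "norm (X, Y) = 1" and tZ: "tr X \<ge> 0" "tr Y = 0" and f: "freudC (X, Y) = 0"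
  obtains g \<alpha> \<beta> b where "g \<in> rotations n" "g X = mk \<alpha> 0 (- \<beta>) 0 0 0" "g Y = mk 0 0 0 0 b 0"
    "b \<in> Alg n" "\<alpha> \<ge> \<beta>" "\<beta> \<ge> 0" "\<alpha> + \<beta> = 1" "(norm b)\<^sup>2 = \<alpha> * \<beta>"
proof -
  have H: "X \<in> Herm n" "Y \<in> Herm n" using Z by auto
  have e: "jprod X X - jprod Y Y = tr X *\<^sub>R X" "2 *\<^sub>R jprod X Y = tr X *\<^sub>R Y"
    using f unfolding freudC_eq_0_iff[OF H] by (simp_all add: tZ)
  have "(norm X)\<^sup>2 + (norm Y)\<^sup>2 = 1"
    using nm by (simp add: norm_Pair)
  from normal_form_real[OF H tZ e this] show thesis using that by metis
qed

lemma zero_Der_J: "(\<lambda>_. 0) \<in> Der_J n"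
  by (simp add: Der_J_def linear_on_Herm_def jprod.zero_left jprod.zero_right)

text \<open>The one-parameter group generated by the diagonal element turns a normal form into
  an imaginary multiple of a real idempotent.\<close>

lemma normal_form_orbit_cone:
  assumes b: "b \<in> Alg n" "\<alpha> + \<beta> = 1" "(norm b)\<^sup>2 = \<alpha> * \<beta>"
  shows "(mk \<alpha> 0 (- \<beta>) 0 0 0, mk 0 0 0 0 b 0) \<in> orbit_cone n"
proof -
  \<comment> \<open>The entry 31 is annihilated because the two outer diagonal entries of
    \<open>S\<close> cancel. The outer diagonal entries of \<open>Z\<close> are multiplied by phases
    of opposite angle, and a quarter turn makes them \<open>\<i> \<alpha>\<close> and
    \<open>\<i> \<beta>\<close>.\<close>
  define S where "S = mk (pi / 2) 0 (- pi / 2) 0 0 0"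
  define f where "f = (\<lambda>t. (mk (\<alpha> * cos (t * (pi / 2))) 0 (- \<beta> * cos (t * (pi / 2))) 0 0 0,
    mk (\<alpha> * sin (t * (pi / 2))) 0 (\<beta> * sin (t * (pi / 2))) 0 b 0))"
  have S: "S \<in> Herm n" "tr S = 0" by (simp_all add: S_def)
  have "flow (lie_op (\<lambda>_. 0) S) (HermC n) f"
    unfolding flow_def
  proof safe
    fix t
    show "f t \<in> HermC n" using b by (simp add: f_def)
    have r: "((\<lambda>t. r * cos (t * (pi / 2))) has_vector_derivative - (pi / 2) * (r * sin (t * (pi / 2)))) (at t)"
      "((\<lambda>t. r * sin (t * (pi / 2))) has_vector_derivative (pi / 2) * (r * cos (t * (pi / 2)))) (at t)" for r
      unfolding has_real_derivative_iff_has_vector_derivative[symmetric]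
      by (auto intro!: derivative_eq_intros)
    show "(f has_vector_derivative lie_op (\<lambda>_. 0) S (f t)) (at t)"
      unfolding f_def
      by (rule has_vector_derivative_eq_rhs, (rule has_vector_derivative_PairI has_vector_derivative_mk r has_vector_derivative_const)+)
        (simp add: S_def jprod_mk mk_minus)
  qed
  from op_exp_flow[OF zero_Der_J S(1) this]
  have "op_exp (lie_op (\<lambda>_. 0) S) (f 0) = f 1" .
  then have e: "op_exp (lie_op (\<lambda>_. 0) S) (mk \<alpha> 0 (- \<beta>) 0 0 0, mk 0 0 0 0 b 0) = (0, mk \<alpha> 0 \<beta> 0 b 0)"
    by (simp add: f_def mk_zero)
  define P where "P = mk \<alpha> 0 \<beta> 0 b 0"
  have ab: "\<alpha>\<^sup>2 + \<alpha> * \<beta> = \<alpha>" "\<beta>\<^sup>2 + \<alpha> * \<beta> = \<beta>"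
  proof -
    have "\<alpha>\<^sup>2 + \<alpha> * \<beta> = \<alpha> * (\<alpha> + \<beta>)" "\<beta>\<^sup>2 + \<alpha> * \<beta> = \<beta> * (\<alpha> + \<beta>)"
      by (simp_all add: power2_eq_square algebra_simps)
    then show "\<alpha>\<^sup>2 + \<alpha> * \<beta> = \<alpha>" "\<beta>\<^sup>2 + \<alpha> * \<beta> = \<beta>" by (simp_all add: b(2))
  qed
  \<comment> \<open>Idempotency comes down to \<open>\<alpha> + \<beta> = 1\<close> and
    \<open>|b|^2 = \<alpha> \<beta>\<close>.\<close>
  have P: "P \<in> idem1 n"
    using b ab by (simp add: P_def idem1_def jprod_mk_self add.commute)
  obtain k where k: "k \<in> rotations n" "k P = E_mat" using idem1_transitive[OF P] by metis
  have "complexify k (P, 0) \<in> orbit_cone n"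
    using E_orbit_cone k linear_0[OF linear_rotations[OF k(1)]] by simp
  then have "(P, 0) \<in> orbit_cone n"
    using orbit_cone_rotations_iff[OF k(1), of "(P, 0)"] P by (simp add: idem1_def)
  then have "cscale \<i> (P, 0) \<in> orbit_cone n"
    by (rule orbit_cone_cscale) simp
  then have "op_exp (lie_op (\<lambda>_. 0) S) (mk \<alpha> 0 (- \<beta>) 0 0 0, mk 0 0 0 0 b 0) \<in> orbit_cone n"
    unfolding e by (simp add: P_def)
  moreover have "op_exp (lie_op (\<lambda>_. 0) S) \<in> Ghat n"
    using Ghat.Ghat_exp[OF lie_GhatI[OF zero_Der_J S] Ghat.Ghat_id] by simp
  ultimately show ?thesis
    using b(1) by (simp add: orbit_cone_Ghat_iff)
qed

text \<open>The orbit is cut out by quadrics. From here on, membership in \<open>planeC n\<close> is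
  a matter of algebra and no group element has to be exhibited.\<close>

theorem orbit_cone_iff: "Z \<in> orbit_cone n \<longleftrightarrow> Z \<in> HermC n \<and> Z \<noteq> 0 \<and> freudC Z = 0"
proof
  assume Z: "Z \<in> orbit_cone n"
  then obtain c g where c: "c \<noteq> 0" "g \<in> Ghat n" "Z = cscale c (g (E_mat, 0))" by (rule orbit_coneE)
  have "freudC (g (E_mat, 0)) = 0" by (rule Ghat_freudC[OF c(2) E0_HermC freudC_E])
  then have "freudC Z = 0" by (simp add: c(3) freudC_cscale linear_0[OF linear_cscale])
  moreover have "norm Z = cmod c"
    by (simp add: c(3) norm_cscale Ghat_norm[OF c(2) E0_HermC])
  ultimately show "Z \<in> HermC n \<and> Z \<noteq> 0 \<and> freudC Z = 0"
    using c(1) orbit_cone_HermC[OF Z] by auto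
next
  assume Z: "Z \<in> HermC n \<and> Z \<noteq> 0 \<and> freudC Z = 0"
  then obtain c where c: "c \<noteq> 0" "norm (cscale c Z) = 1" "trC (cscale c Z) = of_real (cmod (trC Z) / norm Z)"
    using phase_normalization by metis
  obtain X Y where XY: "cscale c Z = (X, Y)" by (metis surj_pair)
  have H: "(X, Y) \<in> HermC n" using Z cscale_HermC XY by metis
  have "tr X = cmod (trC Z) / norm Z" "tr Y = 0"
    using c(3) unfolding XY by (simp_all add: trC_def complex_eq_iff)
  moreover have "freudC (X, Y) = 0"
    using Z XY freudC_cscale[of c Z] linear_0[OF linear_cscale] by simp
  ultimately obtain g \<alpha> \<beta> b where g: "g \<in> rotations n" "g X = mk \<alpha> 0 (- \<beta>) 0 0 0" "g Y = mk 0 0 0 0 b 0"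
    "b \<in> Alg n" "\<alpha> + \<beta> = 1" "(norm b)\<^sup>2 = \<alpha> * \<beta>"
    using normal_form[OF H] c(2) XY by (metis divide_nonneg_nonneg norm_ge_zero)
  have "complexify g (X, Y) \<in> orbit_cone n"
    using normal_form_orbit_cone[OF g(4-6)] g by simp
  then show "Z \<in> orbit_cone n"
    using orbit_cone_rotations_iff[OF g(1) H] orbit_cone_cscale_iff[OF c(1), of Z n] XY by metis
qed

lemma planeC_iff: "Z \<in> HermC n \<Longrightarrow> Z \<noteq> 0 \<Longrightarrow> line Z \<in> planeC n \<longleftrightarrow> freudC Z = 0"
proof
  assume Z: "Z \<in> HermC n" "Z \<noteq> 0" "line Z \<in> planeC n"
  then obtain W where W: "W \<in> orbit_cone n" "line Z = line W" unfolding planeC_orbit_cone by auto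
  obtain c where "c \<noteq> 0" "Z = cscale c W" using line_eqD[OF W(2) Z(2)] .
  then have "Z \<in> orbit_cone n" using W(1) orbit_cone_cscale by simp
  then show "freudC Z = 0" by (simp add: orbit_cone_iff)
qed (auto simp: planeC_orbit_cone orbit_cone_iff)

lemma planeC_unit_rep:
  assumes "p \<in> planeC n"
  obtains X Y where "p = line (X, Y)" "X \<in> Herm n" "Y \<in> Herm n" "norm (X, Y) = 1" "freudC (X, Y) = 0"
    "tr X \<ge> 0" "tr Y = 0"
proof -
  obtain Z where Z: "Z \<in> orbit_cone n" "p = line Z" using assms unfolding planeC_orbit_cone by blast
  then have Z': "Z \<in> HermC n" "Z \<noteq> 0" "freudC Z = 0" by (auto simp: orbit_cone_iff)
  obtain c where c: "c \<noteq> 0" "norm (cscale c Z) = 1" "trC (cscale c Z) = of_real (cmod (trC Z) / norm Z)"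
    using phase_normalization[OF Z'(2)] by metis
  obtain X Y where XY: "cscale c Z = (X, Y)" by (metis surj_pair)
  have "(X, Y) \<in> HermC n" using Z' cscale_HermC XY by metis
  moreover have "tr X = cmod (trC Z) / norm Z" "tr Y = 0"
    using c(3) unfolding XY by (simp_all add: trC_def complex_eq_iff)
  moreover have "freudC (X, Y) = 0"
    using Z' XY freudC_cscale[of c Z] linear_0[OF linear_cscale] by simp
  moreover have "p = line (X, Y)" using Z(2) line_cscale[OF c(1), of Z] XY by simp
  ultimately show thesis using that c(2) XY by simp
qed

section \<open>The moment map\<close>

definition quad :: "omat \<times> omat \<Rightarrow> omat"
  where "quad Z = jprod (fst Z) (fst Z) + jprod (snd Z) (snd Z)"

lemma quad_Herm: "Z \<in> HermC n \<Longrightarrow> quad Z \<in> Herm n"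
  by (elim HermC_cases) (simp add: quad_def Herm_add jprod_Herm)

lemma tr_quad: "Z \<in> HermC n \<Longrightarrow> tr (quad Z) = (norm Z)\<^sup>2"
  by (elim HermC_cases) (simp add: quad_def tr_add power2_norm_eq_inner tr_jprod[of _ n])

lemma quad_cscale: "quad (cscale c Z) = (cmod c)\<^sup>2 *\<^sub>R quad Z"
proof -
  obtain X Y where Z: "Z = (X, Y)" by (metis surj_pair)
  show ?thesis
    unfolding Z quad_def cmod_power2
    by (simp add: jprod_linear jprod_commute[of Y X] power2_eq_square algebra_simps)
qed

text \<open>A phase changes neither the sum of the squares of real and imaginary part nor their
  commutator, which is alternating.\<close>

lemma xi_cscale:
  assumes "cmod c = 1"
  shows "xi (cscale c W) = xi W"
proof -
  obtain X Y where W: "W = (X, Y)" by (metis surj_pair)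
  have c: "Re c * Re c + Im c * Im c = 1" using assms cmod_power2[of c] by (simp add: power2_eq_square)
  have q: "quad (cscale c W) = quad W" using assms by (simp add: quad_cscale)
  have j: "jcomm (fst (cscale c W)) (snd (cscale c W)) A = jcomm X Y A" for A
  proof -
    have "jcomm X X A = 0" "jcomm Y Y A = 0" "jcomm Y X A = - jcomm X Y A" by (simp_all add: jcomm_def)
    then have "jcomm (fst (cscale c W)) (snd (cscale c W)) A = (Re c * Re c + Im c * Im c) *\<^sub>R jcomm X Y A"
      by (simp add: W jcomm_linear algebra_simps)
    then show ?thesis by (simp add: c)
  qed
  show ?thesis
    unfolding xi_def j quad_def[symmetric] q by (simp add: W)
qed

lemma xi_E: "lie_op (\<lambda>_. 0) (E_mat - (1 / 3) *\<^sub>R one_mat) Z = xi (E_mat, 0) Z"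
proof -
  have "jprod E_mat E_mat = E_mat" by (simp add: E_mat_mk jprod_mk)
  then show ?thesis by (cases Z) (simp add: xi_def jcomm_def jprod.zero_left jprod.zero_right)
qed

lemma Ad_xi:
  assumes g: "g \<in> Ghat n"
  shows "Ad n g (lie_op (\<lambda>_. 0) (E_mat - (1 / 3) *\<^sub>R one_mat)) = (\<lambda>Z\<in>HermC n. xi (g (E_mat, 0)) Z)"
proof -
  have gH: "g Z \<in> HermC n" if "Z \<in> HermC n" for Z by (rule linear_withinD(1)[OF Ghat_linear[OF g] that])
  have "g ` HermC n = HermC n"
    using Ghat_inverse[OF g] gH linear_withinD(1)[OF Ghat_linear] by (metis image_eqI image_subsetI subsetI subset_antisym)
  then have "inv_into (HermC n) g Z \<in> HermC n \<and> g (inv_into (HermC n) g Z) = Z" if "Z \<in> HermC n" for Z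
    using that by (metis f_inv_into_f inv_into_into)
  then show ?thesis
    unfolding Ad_def xi_E by (intro restrict_ext) (simp add: Ghat_xi[OF g E0_HermC])
qed

text \<open>Group elements that carry \<open>E_mat\<close> to the same line produce vectors of equal
  norm, which differ by a phase; \<open>xi\<close> does not see it, so the definite description is
  justified.\<close>

lemma adjoint_embedding_line:
  assumes Z: "Z \<in> HermC n" "freudC Z = 0" "norm Z = 1"
  shows "adjoint_embedding n (line Z) = (\<lambda>W\<in>HermC n. xi Z W)"
proof -
  have "Z \<in> orbit_cone n" using Z by (auto simp: orbit_cone_iff)
  then obtain c g where c: "c \<noteq> 0" "g \<in> Ghat n" "Z = cscale c (g (E_mat, 0))" by (rule orbit_coneE)
  have uniq: "xi (g (E_mat, 0)) = xi Z" if g: "g \<in> Ghat n" and l: "line Z = line (g (E_mat, 0))" for g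
  proof -
    have "Z \<noteq> 0" using Z(3) by auto
    then obtain c where c: "Z = cscale c (g (E_mat, 0))" using line_eqD[OF l] by metis
    have "cmod c = 1" using Z(3) unfolding c norm_cscale Ghat_norm[OF g E0_HermC] by simp
    then show ?thesis unfolding c by (simp add: xi_cscale)
  qed
  show ?thesis
    unfolding adjoint_embedding_def
  proof (rule the_equality)
    have "line Z = line (g (E_mat, 0))" using c line_cscale by simp
    then show "\<exists>g\<in>Ghat n. line Z = line (g (E_mat, 0)) \<and> (\<lambda>W\<in>HermC n. xi Z W) =
        Ad n g (lie_op (\<lambda>_. 0) (E_mat - (1 / 3) *\<^sub>R one_mat))"
      using c(2) Ad_xi[OF c(2)] uniq[OF c(2)] by metis
  next
    fix \<xi> assume "\<exists>g\<in>Ghat n. line Z = line (g (E_mat, 0)) \<and> \<xi> = Ad n g (lie_op (\<lambda>_. 0) (E_mat - (1 / 3) *\<^sub>R one_mat))"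
    then show "\<xi> = (\<lambda>W\<in>HermC n. xi Z W)" using Ad_xi uniq by auto
  qed
qed

theorem sigma_map_line:
  assumes Z: "Z \<in> HermC n" "freudC Z = 0" "norm Z = 1"
  shows "sigma_map n (line Z) = quad Z - (1 / 3) *\<^sub>R one_mat"
proof -
  obtain X Y where XY: "Z = (X, Y)" "X \<in> Herm n" "Y \<in> Herm n" using Z(1) by (rule HermC_cases)
  have one: "(one_mat, 0) \<in> HermC n" by simp
  show ?thesis
    unfolding sigma_map_def adjoint_embedding_line[OF Z] Herm0_part_def
  proof (rule the_equality)
    have "quad Z - (1 / 3) *\<^sub>R one_mat \<in> Herm_tr n 0"
      using Z tr_quad[OF Z(1)] by (simp add: Herm_tr_def quad_Herm Herm_diff Herm_scaleR tr_diff tr_scaleR one_mat_mk)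
    moreover have "(\<lambda>A. 2 *\<^sub>R jcomm X Y A) \<in> Der_J n"
      using jcomm_Der_J[OF XY(2) Herm_scaleR[OF XY(3), of 2]] unfolding jcomm_linear[abs_def] .
    ultimately show "quad Z - (1 / 3) *\<^sub>R one_mat \<in> Herm_tr n 0 \<and> (\<exists>D\<in>Der_J n. \<forall>W\<in>HermC n.
        (\<lambda>W\<in>HermC n. xi Z W) W = lie_op D (quad Z - (1 / 3) *\<^sub>R one_mat) W)"
      by (intro conjI bexI) (auto simp: xi_def quad_def XY(1))
  next
    fix S assume S: "S \<in> Herm_tr n 0 \<and> (\<exists>D\<in>Der_J n. \<forall>W\<in>HermC n. (\<lambda>W\<in>HermC n. xi Z W) W = lie_op D S W)"
    then obtain D where D: "D \<in> Der_J n" "\<forall>W\<in>HermC n. (\<lambda>W\<in>HermC n. xi Z W) W = lie_op D S W" by blast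
    \<comment> \<open>The imaginary component of this value is \<open>S\<close>, because
      \<open>D 0 = 0\<close>. So the operator determines its part in
      \<open>Herm_tr n 0\<close>.\<close>
    have "lie_op D S (one_mat, 0) = xi Z (one_mat, 0)"
      using D(2) one by (metis restrict_apply')
    moreover have "D 0 = 0"
      using linear_withinD(3)[OF Der_JD(1)[OF D(1)] Herm_0, of 0] by simp
    moreover have "quad Z - (1 / 3) *\<^sub>R one_mat \<in> Herm n" using quad_Herm[OF Z(1)] by (simp add: Herm_diff Herm_scaleR)
    moreover have "jcomm X Y 0 = 0" by (simp add: jcomm_def jprod.zero_right)
    ultimately show "S = quad Z - (1 / 3) *\<^sub>R one_mat"
      using S by (simp add: xi_def Herm_tr_def XY(1) quad_def jprod_one[of _ n] jprod.zero_right)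
  qed
qed

section \<open>The real group and the real projective plane\<close>

definition Mat :: "nat \<Rightarrow> omat set"
  where "Mat n = {A. \<forall>i j. A $ i $ j \<in> Alg n}"

lemma subspace_Mat: "subspace (Mat n)"
  using subspace_Alg[of n] by (auto simp: Mat_def subspace_def)

lemma mmult_Mat: "A \<in> Mat n \<Longrightarrow> B \<in> Mat n \<Longrightarrow> mmult A B \<in> Mat n"
  by (simp add: Mat_def mmult_def subspace_sum[OF subspace_Alg] omult_Alg)

lemma adj_Mat: "A \<in> Mat n \<Longrightarrow> adj A \<in> Mat n"
  by (simp add: Mat_def adj_def)

lemma one_Mat: "one_mat \<in> Mat n"
  by (simp add: Mat_def one_mat_def oct_of_complex_1)

lemma Herm_Mat: "X \<in> Herm n \<longleftrightarrow> X \<in> Mat n \<and> adj X = X"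
  by (simp add: Herm_def Mat_def)

lemma mmult_assoc:
  assumes "n \<le> 2" "A \<in> Mat n" "B \<in> Mat n" "C \<in> Mat n"
  shows "mmult (mmult A B) C = mmult A (mmult B C)"
proof -
  have "omult (omult (A $ i $ k) (B $ k $ l)) (C $ l $ j) = omult (A $ i $ k) (omult (B $ k $ l) (C $ l $ j))" for i j k l
    using assms by (intro omult_assoc_Alg) (auto simp: Mat_def)
  then show ?thesis
    by (simp add: mmult_def omat_eq_iff sum_3 omult.add_left omult.add_right algebra_simps)
qed

lemma mmult_one [simp]: "mmult one_mat A = A" "mmult A one_mat = A"
  by (simp_all add: mmult_def omat_eq_iff forall_3 sum_3 one_mat_def oct_of_complex_1)

lemma adj_adj [simp]: "adj (adj A) = A"
  by (simp add: adj_def omat_eq_iff)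

lemma adj_mmult: "adj (mmult A B) = mmult (adj B) (adj A)"
  by (simp add: adj_def mmult_def omat_eq_iff sum_3 ocnj_add ocnj_omult)

text \<open>A one-sided inverse is two-sided by finite dimensionality.\<close>

lemma unitary_left:
  assumes n: "n \<le> 2" and M: "M \<in> Mat n" "mmult M (adj M) = one_mat"
  shows "mmult (adj M) M = one_mat"
proof -
  let ?g = "mmult (adj M)"
  note A = adj_Mat[OF M(1)]
  have lin: "linear ?g" using bilinear_mmult by (simp add: bilinear_def)
  have inv: "mmult M (?g B) = B" if "B \<in> Mat n" for B
    using mmult_assoc[OF n M(1) A that] M(2) by simp
  have "inj_on ?g (span (Mat n))"
    unfolding span_eq_iff[THEN iffD2, OF subspace_Mat] by (rule inj_on_inverseI) (rule inv)
  then have "dim (?g ` Mat n) = dim (Mat n)" by (rule dim_image_eq[OF lin])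
  then have "?g ` Mat n = Mat n"
    by (intro subspace_dim_equal linear_subspace_image lin subspace_Mat) (auto intro: mmult_Mat A)
  then obtain C where C: "C \<in> Mat n" "one_mat = ?g C" using one_Mat by (metis imageE)
  then have "C = M" using inv[OF C(1)] by simp
  with C(2) show ?thesis by simp
qed

lemma conj_action_Aut_J:
  assumes n: "n \<le> 2" and M: "M \<in> Mat n" "mmult M (adj M) = one_mat"
  shows "conj_action M \<in> Aut_J n"
proof -
  note A = adj_Mat[OF M(1)]
  note U = unitary_left[OF n M]
  note as = mmult_assoc[OF n]
  have H: "conj_action N X \<in> Herm n" if "N \<in> Mat n" "X \<in> Herm n" for N X
    using that as[OF that(1) _ adj_Mat[OF that(1)], of X] unfolding Herm_Mat conj_action_def
    by (simp add: mmult_Mat adj_Mat adj_mmult)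
  have inv: "conj_action (adj N) (conj_action N X) = X"
    if "N \<in> Mat n" "mmult (adj N) N = one_mat" "X \<in> Herm n" for N X
  proof -
    have X: "X \<in> Mat n" using that by (simp add: Herm_Mat)
    note A = adj_Mat[OF that(1)]
    have "conj_action (adj N) (conj_action N X) = mmult (mmult (adj N) (mmult N (mmult X (adj N)))) N"
      unfolding conj_action_def using as[OF that(1) X A] by simp
    also have "\<dots> = mmult (mmult X (adj N)) N"
      using as[OF A that(1) mmult_Mat[OF X A]] that(2) by simp
    also have "\<dots> = X" using as[OF X A that(1)] that(2) by simp
    finally show ?thesis .
  qed
  have mm: "mmult (conj_action M X) (conj_action M Y) = conj_action M (mmult X Y)" if "X \<in> Herm n" "Y \<in> Herm n" for X Y
  proof -
    have X: "X \<in> Mat n" "Y \<in> Mat n" using that by (simp_all add: Herm_Mat)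
    have "mmult (conj_action M X) (conj_action M Y) = mmult (mmult M X) (mmult (adj M) (mmult M (mmult Y (adj M))))"
      unfolding conj_action_def as[OF M(1) X(2) A] by (rule as) (intro mmult_Mat M A X)+
    also have "mmult (adj M) (mmult M (mmult Y (adj M))) = mmult Y (adj M)"
      using as[OF A M(1) mmult_Mat[OF X(2) A]] U by simp
    also have "mmult (mmult M X) (mmult Y (adj M)) = mmult (mmult (mmult M X) Y) (adj M)"
      by (rule as[symmetric]) (intro mmult_Mat M A X)+
    also have "mmult (mmult M X) Y = mmult M (mmult X Y)" by (rule as[OF M(1) X])
    finally show ?thesis by (simp add: conj_action_def)
  qed
  have lin: "linear (conj_action M)"
    by (rule linearI) (simp_all add: conj_action_def bilinear_ladd[OF bilinear_mmult] bilinear_radd[OF bilinear_mmult]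
        bilinear_lmul[OF bilinear_mmult] bilinear_rmul[OF bilinear_mmult])
  have "bij_betw (conj_action M) (Herm n) (Herm n)"
    by (rule bij_betw_byWitness[where f' = "conj_action (adj M)"])
      (use inv[OF M(1) U] inv[OF A] M(2) H[OF M(1)] H[OF A] in auto)
  then show ?thesis
    using linear_within_linear[OF lin, of "Herm n"] H[OF M(1)] mm
    by (auto simp: Aut_J_def linear_on_Herm_iff jprod_def linear_add[OF lin] linear_scale[OF lin])
qed

definition unitaries :: "nat \<Rightarrow> omat set"
  where "unitaries n =
    (if n = 0 then {\<chi> i j. oct_of_complex (of_real (A $ i $ j)) | A. A \<in> SO3}
     else if n = 1 then {\<chi> i j. oct_of_complex (A $ i $ j) | A. A \<in> SU3} else Sp3)"

lemma Grp_unitaries: "n \<le> 2 \<Longrightarrow> Grp n = conj_action ` unitaries n"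
  unfolding Grp_def unitaries_def by auto

lemma oct_of_complex_mult: "omult (oct_of_complex x) (oct_of_complex y) = oct_of_complex (x * y)"
  by (simp add: oct_of_complex_def)

lemma oct_of_complex_simps:
  "oct_of_complex x + oct_of_complex y = oct_of_complex (x + y)"
  "ocnj (oct_of_complex x) = oct_of_complex (cnj x)" "oct_of_complex 0 = 0"
  "oct_of_complex x = oct_of_complex y \<longleftrightarrow> x = y"
  by (auto simp: oct_of_complex_def zero_prod_def)

lemma unitaries_Mat:
  assumes "n \<le> 2" "M \<in> unitaries n"
  shows "M \<in> Mat n" "mmult M (adj M) = one_mat"
proof -
  consider "n = 0" | "n = 1" | "n = 2" using assms(1) by linarith
  then have "M \<in> Mat n \<and> mmult M (adj M) = one_mat"
  proof cases
    case 1
    then obtain A where A: "A \<in> SO3" "M = (\<chi> i j. oct_of_complex (of_real (A $ i $ j)))"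
      using assms(2) by (auto simp: unitaries_def)
    have "A ** transpose A = mat 1" using A(1) by (simp add: SO3_def rotation_matrix_def orthogonal_matrix_def)
    then have "(\<Sum>k\<in>UNIV. A $ i $ k * A $ j $ k) = (if i = j then 1 else 0)" for i j
      by (auto simp: matrix_matrix_mult_def transpose_def mat_def vec_eq_iff)
    then have "complex_of_real (\<Sum>k\<in>UNIV. A $ i $ k * A $ j $ k) = (if i = j then 1 else 0)" for i j
      by simp
    then show ?thesis
      using 1 A(2) by (auto simp: Mat_def Alg_def mmult_def adj_def omat_eq_iff sum_3 oct_of_complex_simps
          oct_of_complex_mult one_mat_def simp del: of_real_mult of_real_add simp flip: of_real_mult of_real_add)
  next
    case 2
    then obtain A where A: "A \<in> SU3" "M = (\<chi> i j. oct_of_complex (A $ i $ j))"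
      using assms(2) by (auto simp: unitaries_def)
    have "(\<Sum>k\<in>UNIV. A $ i $ k * cnj (A $ j $ k)) = (if i = j then 1 else 0)" for i j
      using A(1) by (auto simp: SU3_def matrix_matrix_mult_def mat_def vec_eq_iff)
    then show ?thesis
      using 2 A(2) by (auto simp: Mat_def Alg_def mmult_def adj_def omat_eq_iff sum_3 oct_of_complex_simps
          oct_of_complex_mult one_mat_def)
  next
    case 3
    then show ?thesis using assms(2) by (simp add: unitaries_def Sp3_def Mat_def)
  qed
  then show "M \<in> Mat n" "mmult M (adj M) = one_mat" by blast+
qed

lemma Grp_Aut_J: "n \<le> 3 \<Longrightarrow> g \<in> Grp n \<Longrightarrow> g \<in> Aut_J n"
proof (cases "n = 3")
  case False
  assume "n \<le> 3" "g \<in> Grp n"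
  with False have "n \<le> 2" "g \<in> conj_action ` unitaries n" by (simp_all add: Grp_unitaries)
  then show ?thesis using conj_action_Aut_J unitaries_Mat by blast
qed (simp add: Grp_def)

lemma mmult_embed_real: "mmult (\<chi> i j. oct_of_complex (of_real (A $ i $ j))) (\<chi> i j. oct_of_complex (of_real (B $ i $ j)))
    = (\<chi> i j. oct_of_complex (of_real ((A ** B) $ i $ j)))"
  by (simp add: mmult_def omat_eq_iff sum_3 oct_of_complex_mult oct_of_complex_simps matrix_matrix_mult_def)

lemma mmult_embed_complex: "mmult (\<chi> i j. oct_of_complex (A $ i $ j)) (\<chi> i j. oct_of_complex (B $ i $ j))
    = (\<chi> i j. oct_of_complex ((A ** B) $ i $ j))"
  by (simp add: mmult_def omat_eq_iff sum_3 oct_of_complex_mult oct_of_complex_simps matrix_matrix_mult_def)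

lemma SU3_mult: "A \<in> SU3 \<Longrightarrow> B \<in> SU3 \<Longrightarrow> A ** B \<in> SU3"
proof -
  assume A: "A \<in> SU3" and B: "B \<in> SU3"
  have "(\<chi> i j. cnj ((A ** B) $ j $ i)) = (\<chi> i j. cnj (B $ j $ i)) ** (\<chi> i j. cnj (A $ j $ i))"
    by (simp add: vec_eq_iff matrix_matrix_mult_def mult.commute)
  then have "(A ** B) ** (\<chi> i j. cnj ((A ** B) $ j $ i)) =
     A ** (B ** (\<chi> i j. cnj (B $ j $ i))) ** (\<chi> i j. cnj (A $ j $ i))"
    by (simp add: matrix_mul_assoc)
  then show ?thesis using A B by (simp add: SU3_def det_mul)
qed

lemma unitaries_mmult:
  assumes n: "n \<le> 2" and M: "M \<in> unitaries n" "N \<in> unitaries n"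
  shows "mmult M N \<in> unitaries n"
proof -
  consider "n = 0" | "n = 1" | "n = 2" using n by linarith
  then show ?thesis
  proof cases
    case 1
    have "A ** B \<in> SO3" if "A \<in> SO3" "B \<in> SO3" for A B
      using that by (simp add: SO3_def rotation_matrix_def orthogonal_matrix_mul det_mul)
    then show ?thesis using 1 M by (auto simp: unitaries_def mmult_embed_real)
  next
    case 2
    then show ?thesis using M by (auto simp: unitaries_def mmult_embed_complex intro!: SU3_mult)
  next
    case 3
    note M' = unitaries_Mat[OF n M(1)] and N' = unitaries_Mat[OF n M(2)]
    note as = mmult_assoc[OF n]
    have "mmult (mmult M N) (adj (mmult M N)) = mmult M (mmult N (mmult (adj N) (adj M)))"
      unfolding adj_mmult by (rule as) (intro M' N' mmult_Mat adj_Mat)+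
    also have "mmult N (mmult (adj N) (adj M)) = adj M"
      using as[OF N'(1) adj_Mat[OF N'(1)] adj_Mat[OF M'(1)]] N'(2) by simp
    finally show ?thesis
      using mmult_Mat[OF M'(1) N'(1)] M'(2) 3 by (simp add: unitaries_def Sp3_def Mat_def)
  qed
qed

section \<open>Rotations as conjugations by unitary matrices\<close>

definition rot_mat :: "real \<Rightarrow> oct \<Rightarrow> omat"
  where "rot_mat t u = vector [vector [oreal (cos t), - (sin t *\<^sub>R u), 0],
    vector [sin t *\<^sub>R ocnj u, oreal (cos t), 0], vector [0, 0, oreal 1]]"

definition cyc_mat :: omat
  where "cyc_mat = vector [vector [0, oreal 1, 0], vector [0, 0, oreal 1], vector [oreal 1, 0, 0]]"

lemma conj_action_cyc_mat: "X \<in> Herm n \<Longrightarrow> conj_action cyc_mat X = cyc X"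
  by (elim Herm_cases)
    (simp add: conj_action_def cyc_mat_def adj_def mmult_def cyc_def omat_eq_iff forall_3 sum_3 vector_3)


text \<open>Besides an entry of \<open>X\<close>, each product contains only \<open>u\<close> and
  its conjugate, at most twice in all; hence the cancellation laws and a reflection formula replace
  associativity.\<close>

lemma conj_action_rot_mat:
  assumes u: "norm u = 1" and X: "X \<in> Herm n"
  shows "conj_action (rot_mat t u) X = rot t u X"
  using X
proof (elim Herm_cases)
  fix x y z a b c assume X: "X = mk x y z a b c"
  define C S where "C = cos t" and "S = sin t"
  have CS: "C * C + S * S = 1" using sin_cos_squared_add[of t] by (simp add: C_def S_def power2_eq_square)
  then have CC: "C * C = 1 - S * S" "C * (C * r) = (1 - S * S) * r" for r
    by (simp_all add: eq_diff_eq mult.assoc[symmetric])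
  have 2: "cos (2 * t) = C * C - S * S" "sin (2 * t) = 2 * (S * C)"
    by (simp_all add: C_def S_def cos_double sin_double power2_eq_square)
  have uu: "omult (omult y u) (ocnj u) = y" "omult (ocnj u) (omult u y) = y"
    "omult (omult y (ocnj u)) u = y" "omult u (omult (ocnj u) y) = y"
    "omult u (ocnj u) = oreal 1" "omult (ocnj u) u = oreal 1" for y
    using omult_ocnj_right[of y u] omult_ocnj_left[of u y] omult_ocnj_right[of y "ocnj u"] omult_ocnj_left[of "ocnj u" y]
      omult_ocnj_right[of "oreal 1" u] omult_ocnj_left[of u "oreal 1"] u by simp_all
  \<comment> \<open>The sum of \<open>u v\<close> and its conjugate is real; multiplying by
    \<open>u\<close> on the right gives the reflection formula.\<close>
  have uvu: "omult (omult u v) u = (2 * inner u (ocnj v)) *\<^sub>R u - ocnj v" if "norm u = 1"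
      "\<And>y. omult (omult y (ocnj u)) u = y" for u v
  proof -
    have "omult (omult u v) u + omult (omult (ocnj v) (ocnj u)) u = (2 * inner u (ocnj v)) *\<^sub>R u"
      using add_omult_ocnj[of u "ocnj v"] by (metis ocnj_ocnj omult.add_left omult_oreal(1))
    then show ?thesis using that(2)[of "ocnj v"] by (simp add: eq_diff_eq)
  qed
  have ucu: "omult (omult u (ocnj c)) u = (2 * inner u c) *\<^sub>R u - c"
    "omult (omult (ocnj u) c) (ocnj u) = (2 * inner u c) *\<^sub>R ocnj u - ocnj c"
    using uvu[of u "ocnj c"] uvu[of "ocnj u" c] u uu inner_ocnj[of u c] by (simp_all add: inner_ocnj[of u c])
  have uc: "omult u (ocnj c) = (2 * inner u c) *\<^sub>R oreal 1 - omult c (ocnj u)"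
    "omult (ocnj u) c = (2 * inner u c) *\<^sub>R oreal 1 - omult (ocnj c) u"
    using add_omult_ocnj[of u c] add_omult_ocnj'[of u c] by (simp_all add: eq_diff_eq)
  have re: "oreal r = r *\<^sub>R oreal 1" for r by simp
  have d1: "oreal (x * C * C) - (C * S) *\<^sub>R omult u (ocnj c) + (- ((S * C) *\<^sub>R omult c (ocnj u)) - oreal (- (y * S * S))) =
     oreal ((x + y) / 2 + ((x - y) * (C * C - S * S) / 2 - inner u c * (2 * (S * C))))"
    unfolding uc re[of "_ * _"] re[of "_ + _"] re[of "- _"]
    by (simp add: oct_eq_iff_inner inner_add_left inner_diff_left CC del: oreal_simps; simp add: field_simps CC)
  have d2: "oreal (x * S * S) + (S * C) *\<^sub>R omult (ocnj c) u + ((C * S) *\<^sub>R omult (ocnj u) c + oreal (y * C * C)) =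
     oreal ((x + y) / 2 - ((x - y) * (C * C - S * S) / 2 - inner u c * (2 * (S * C))))"
    unfolding uc re[of "_ * _"] re[of "_ - _"]
    by (simp add: oct_eq_iff_inner inner_add_left inner_diff_left CC del: oreal_simps; simp add: field_simps CC)
  have d3: "(x * S * C) *\<^sub>R w - (S * S) *\<^sub>R ((2 * inner u c) *\<^sub>R w - e) + ((C * C) *\<^sub>R e - (y * C * S) *\<^sub>R w) =
     e + (inner u c * (C * C - S * S) + (x - y) * (S * C) - inner u c) *\<^sub>R w" for w e :: oct
    by (simp add: oct_eq_iff_inner inner_add_left inner_diff_left CC; simp add: field_simps CC)
  have d4: "(x * C * S) *\<^sub>R w + (C * C) *\<^sub>R e + (- ((S * S) *\<^sub>R ((2 * inner u c) *\<^sub>R w - e)) - (y * S * C) *\<^sub>R w) =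
     e + (inner u c * (C * C - S * S) + (x - y) * (S * C) - inner u c) *\<^sub>R w" for w e :: oct
    by (simp add: oct_eq_iff_inner inner_add_left inner_diff_left CC; simp add: field_simps CC)
  show ?thesis
    unfolding X rot_mk 2 C_def[symmetric] S_def[symmetric]
    by (simp add: conj_action_def rot_mat_def adj_def mmult_def omat_eq_iff forall_3 sum_3 vector_3
       C_def[symmetric] S_def[symmetric] ocnj_minus ocnj_scaleR omult.minus_left omult.minus_right omult.scaleR_left omult.scaleR_right
       omult.add_left omult.add_right omult.diff_left omult.diff_right uu ucu ocnj_omult ocnj_add ocnj_diff;
       simp only: d1 d2 d3 d4; simp add: add.commute)
qed

lemma rot_mat_unitaries:
  assumes n: "n \<le> 2" and u: "u \<in> unit_elements n"
  shows "rot_mat t u \<in> unitaries n"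
proof -
  have cs: "cos t * cos t + sin t * sin t = 1"
    using sin_cos_squared_add[of t] by (simp add: power2_eq_square)
  consider "n = 0" | "n = 1" | "n = 2" using n by linarith
  then show ?thesis
  proof cases
    case 1
    then obtain r :: real where r: "u = oreal r" "r * r = 1"
      using u by (auto simp: unit_elements_def Alg_def oreal_def[symmetric] abs_square_eq_1[symmetric] power2_eq_square)
    define A :: "real^3^3" where "A = vector [vector [cos t, - (sin t * r), 0], vector [sin t * r, cos t, 0], vector [0, 0, 1]]"
    have rr: "r * (r * x) = x" for x using r(2) by (simp add: mult.assoc[symmetric])
    have "A \<in> SO3"
      unfolding SO3_def rotation_matrix_def orthogonal_matrix_def
      using cs by (simp add: rr A_def transpose_def matrix_matrix_mult_def mat_def vec_eq_iff forall_3 sum_3 vector_3 det_3 algebra_simps)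
    moreover have "rot_mat t u = (\<chi> i j. oct_of_complex (of_real (A $ i $ j)))"
      unfolding oreal_def[symmetric]
      by (simp add: r rot_mat_def A_def omat_eq_iff forall_3 vector_3)
    ultimately show ?thesis using 1 by (auto simp: unitaries_def)
  next
    case 2
    then obtain w where w: "u = oct_of_complex w" "cmod w = 1"
      using u by (auto simp: unit_elements_def Alg_def oct_of_complex_def norm_Pair zero_prod_def)
    have ww: "w * cnj w = 1" using complex_norm_square[of w] w(2) by simp
    define A :: "complex^3^3" where "A = vector [vector [of_real (cos t), - (of_real (sin t) * w), 0],
      vector [of_real (sin t) * cnj w, of_real (cos t), 0], vector [0, 0, 1]]"
    have cs': "complex_of_real (cos t) * complex_of_real (cos t) + complex_of_real (sin t) * complex_of_real (sin t) = 1"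
      using cs by (metis of_real_1 of_real_add of_real_mult)
    have "A ** (\<chi> i j. cnj (A $ j $ i)) = mat 1"
      using cs' ww by (simp add: A_def matrix_matrix_mult_def mat_def vec_eq_iff forall_3 sum_3 vector_3) algebra
    moreover have "det A = 1"
      using cs' ww by (simp add: A_def det_3 vector_3) algebra
    moreover have "rot_mat t u = (\<chi> i j. oct_of_complex (A $ i $ j))"
      by (simp add: w rot_mat_def A_def omat_eq_iff forall_3 vector_3 oreal_def oct_of_complex_def scaleR_conv_of_real zero_prod_def)
    ultimately show ?thesis using 2 by (auto simp: unitaries_def SU3_def)
  next
    case 3
    have "u \<in> Alg 2" "norm u = 1" using u 3 by (auto simp: unit_elements_def)
    moreover have "omult u (ocnj u) = oreal 1" "omult (ocnj u) u = oreal 1"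
      using omult_ocnj_right[of "oreal 1" u] omult_ocnj_left[of u "oreal 1"] \<open>norm u = 1\<close> by simp_all
    ultimately show ?thesis
      using 3 cs by (simp add: unitaries_def Sp3_def rot_mat_def forall_3 vector_3 Alg_minus Alg_scaleR
         mmult_def adj_def omat_eq_iff sum_3 one_mat_def oct_of_complex_1 ocnj_minus ocnj_scaleR omult.minus_left
         omult.minus_right omult.scaleR_left omult.scaleR_right algebra_simps)
  qed
qed

lemma cyc_mat_unitaries:
  assumes n: "n \<le> 2"
  shows "cyc_mat \<in> unitaries n"
proof -
  consider "n = 0" | "n = 1" | "n = 2" using n by linarith
  then show ?thesis
  proof cases
    case 1
    define A :: "real^3^3" where "A = vector [vector [0, 1, 0], vector [0, 0, 1], vector [1, 0, 0]]"
    have "A \<in> SO3"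
      unfolding SO3_def rotation_matrix_def orthogonal_matrix_def
      by (simp add: A_def transpose_def matrix_matrix_mult_def mat_def vec_eq_iff forall_3 sum_3 vector_3 det_3)
    moreover have "cyc_mat = (\<chi> i j. oct_of_complex (of_real (A $ i $ j)))"
      unfolding oreal_def[symmetric] by (simp add: cyc_mat_def A_def omat_eq_iff forall_3 vector_3)
    ultimately show ?thesis using 1 by (auto simp: unitaries_def)
  next
    case 2
    define A :: "complex^3^3" where "A = vector [vector [0, 1, 0], vector [0, 0, 1], vector [1, 0, 0]]"
    have "A \<in> SU3"
      unfolding SU3_def
      by (simp add: A_def matrix_matrix_mult_def mat_def vec_eq_iff forall_3 sum_3 vector_3 det_3)
    moreover have "cyc_mat = (\<chi> i j. oct_of_complex (A $ i $ j))"
      by (simp add: cyc_mat_def A_def omat_eq_iff forall_3 vector_3 oct_of_complex_1 oct_of_complex_simps)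
    ultimately show ?thesis using 2 by (auto simp: unitaries_def)
  next
    case 3
    then show ?thesis
      by (simp add: unitaries_def Sp3_def cyc_mat_def forall_3 vector_3 mmult_def adj_def omat_eq_iff sum_3
          one_mat_def oct_of_complex_1)
  qed
qed

lemma one_mat_unitaries:
  assumes n: "n \<le> 2"
  shows "one_mat \<in> unitaries n"
proof -
  \<comment> \<open>Writing the identity as the cube of \<open>cyc_mat\<close> treats the three
    unitary groups at once.\<close>
  have "mmult cyc_mat (mmult cyc_mat cyc_mat) = one_mat"
    by (simp add: cyc_mat_def mmult_def omat_eq_iff forall_3 sum_3 vector_3 one_mat_def oct_of_complex_1)
  then show ?thesis using unitaries_mmult[OF n] cyc_mat_unitaries[OF n] by metis
qed

lemma conj_action_mmult:
  assumes n: "n \<le> 2" and M: "M \<in> Mat n" "N \<in> Mat n" and X: "X \<in> Herm n"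
  shows "conj_action (mmult M N) X = conj_action M (conj_action N X)"
proof -
  have X': "X \<in> Mat n" using X by (simp add: Herm_Mat)
  note as = mmult_assoc[OF n]
  have "conj_action (mmult M N) X = mmult (mmult M (mmult N X)) (mmult (adj N) (adj M))"
    unfolding conj_action_def adj_mmult using as[OF M X'] by simp
  also have "\<dots> = mmult (mmult (mmult M (mmult N X)) (adj N)) (adj M)"
    by (rule as[symmetric]) (intro mmult_Mat M adj_Mat X')+
  also have "mmult (mmult M (mmult N X)) (adj N) = mmult M (mmult (mmult N X) (adj N))"
    by (rule as) (intro mmult_Mat M adj_Mat X')+
  finally show ?thesis by (simp add: conj_action_def)
qed

text \<open>The bridge to the given groups: the generators are automorphisms for octonions and are
  conjugations by explicit matrices, of determinant 1 where that is required, in the other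
  cases.\<close>

lemma rotations_Grp:
  assumes "n \<le> 3" "k \<in> rotations n"
  shows "\<exists>g\<in>Grp n. \<forall>X\<in>Herm n. g X = k X"
proof (cases "n = 3")
  case True
  then show ?thesis using rotations_Aut_J[OF assms(2)] by (auto simp: Grp_def)
next
  case False
  with assms have n: "n \<le> 2" by simp
  have "\<exists>M\<in>unitaries n. \<forall>X\<in>Herm n. conj_action M X = k X"
    using assms(2)
  proof (induction rule: rotations.induct)
    case rotations_id
    have "adj one_mat = one_mat" by (simp add: adj_def one_mat_def omat_eq_iff oct_of_complex_1)
    then show ?case by (intro bexI[OF _ one_mat_unitaries[OF n]]) (simp add: conj_action_def)
  next
    case (rotations_rot g u t)
    then obtain M where M: "M \<in> unitaries n" "\<forall>X\<in>Herm n. conj_action M X = g X" by blast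
    note r = rot_mat_unitaries[OF n rotations_rot.hyps(2), of t]
    have "conj_action (mmult (rot_mat t u) M) X = rot t u (g X)" if "X \<in> Herm n" for X
      using conj_action_mmult[OF n unitaries_Mat(1)[OF n r] unitaries_Mat(1)[OF n M(1)] that] M(2) that
        conj_action_rot_mat[OF unit_elementsD(2)[OF rotations_rot.hyps(2)] rotations_Herm[OF rotations_rot.hyps(1) that]]
      by simp
    then show ?case using unitaries_mmult[OF n r M(1)] by blast
  next
    case (rotations_cyc g)
    then obtain M where M: "M \<in> unitaries n" "\<forall>X\<in>Herm n. conj_action M X = g X" by blast
    note r = cyc_mat_unitaries[OF n]
    have "conj_action (mmult cyc_mat M) X = cyc (g X)" if "X \<in> Herm n" for X
      using conj_action_mmult[OF n unitaries_Mat(1)[OF n r] unitaries_Mat(1)[OF n M(1)] that] M(2) that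
        conj_action_cyc_mat[OF rotations_Herm[OF rotations_cyc.hyps(1) that]]
      by simp
    then show ?case using unitaries_mmult[OF n r M(1)] by blast
  qed
  then show ?thesis by (auto simp: Grp_unitaries[OF n])
qed

lemma idem1_Aut_J:
  assumes "g \<in> Aut_J n" "p \<in> idem1 n"
  shows "g p \<in> idem1 n"
  using assms Aut_JD[OF assms(1)] linear_withinD(1)[OF Aut_JD(1)[OF assms(1)]] tr_Aut_J[OF assms(1)]
  unfolding idem1_def by (simp flip: Aut_JD(3)[OF assms(1)])

text \<open>Automorphisms preserve idempotents and the trace, which gives one inclusion;
  transitivity of the rotations, realized in \<open>Grp n\<close>, gives the other.\<close>

lemma proj_plane_idem1:
  assumes n: "n \<le> 3"
  shows "proj_plane n = idem1 n"
proof
  show "proj_plane n \<subseteq> idem1 n"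
    using idem1_Aut_J[OF Grp_Aut_J[OF n] E_mat_idem1] by (auto simp: proj_plane_def)
  show "idem1 n \<subseteq> proj_plane n"
  proof
    fix p assume p: "p \<in> idem1 n"
    then obtain k where k: "k \<in> rotations n" "k p = E_mat" using idem1_transitive by metis
    obtain h where h: "h \<in> rotations n" "\<And>X. X \<in> Herm n \<Longrightarrow> h (k X) = X" using rotations_inverse[OF k(1)] by metis
    obtain g where g: "g \<in> Grp n" "\<forall>X\<in>Herm n. g X = h X" using rotations_Grp[OF n h(1)] by blast
    have "p = g E_mat" using g(2) h(2)[of p] k(2) p by (simp add: idem1_def)
    then show "p \<in> proj_plane n" using g(1) by (auto simp: proj_plane_def)
  qed
qed

section \<open>Spheres\<close>

text \<open>Coordinates in an orthonormal basis of \<open>V\<close>, divided by the radius, map a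
  compact space bijectively to a Hausdorff space. The index runs over \<open>{..d}\<close>, hence
  the dimension \<open>Suc d\<close>.\<close>

lemma sphere_homeomorphic_nsphere:
  fixes V :: "'a::euclidean_space set"
  assumes V: "subspace V" "dim V = Suc d" and r: "r > 0"
  shows "top_of_set {x \<in> V. norm x = r} homeomorphic_space nsphere d"
proof -
  obtain B where B: "B \<subseteq> V" "pairwise orthogonal B" "\<And>x. x \<in> B \<Longrightarrow> norm x = 1"
    "independent B" "card B = dim V" "span B = V"
    using orthonormal_basis_subspace[OF V(1)] by metis
  have fin: "finite B" using B(4) by (rule independent_imp_finite)
  obtain e where e0: "bij_betw e {0..<card B} B" using ex_bij_betw_nat_finite[OF fin] by blast
  have "{0..<card B} = {..d}" using B(5) V(2) by auto
  with e0 have e: "bij_betw e {..d} B" by simp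
  have eB: "e i \<in> B" if "i \<le> d" for i using e that by (auto simp: bij_betw_def)
  have ee: "inner (e i) (e j) = (if i = j then 1 else 0)" if "i \<le> d" "j \<le> d" for i j
  proof (cases "i = j")
    case True
    then show ?thesis using B(3)[OF eB[OF that(1)]] by (simp add: dot_square_norm)
  next
    case False
    then have "e i \<noteq> e j" using e that by (auto simp: bij_betw_def inj_on_def)
    then show ?thesis using B(2) eB that False by (auto simp: pairwise_def orthogonal_def)
  qed
  have ex: "(\<Sum>i\<le>d. inner x (e i) *\<^sub>R e i) = x" if "x \<in> V" for x
  proof -
    have "(\<Sum>v\<in>B. inner x v *\<^sub>R v) = x"
      by (rule orthonormal_basis_expand) (use B fin that in \<open>auto simp: dot_square_norm\<close>)
    then show ?thesis using sum.reindex_bij_betw[OF e, of "\<lambda>v. inner x v *\<^sub>R v"] by simp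
  qed
  have sq: "inner (\<Sum>i\<le>d. s i *\<^sub>R e i) (\<Sum>i\<le>d. s i *\<^sub>R e i) = (\<Sum>i\<le>d. (s i)\<^sup>2)" for s
    by (simp add: inner_sum_left inner_sum_right ee if_distrib[of "\<lambda>x. _ * x"] power2_eq_square cong: if_cong)
  have co: "inner (\<Sum>i\<le>d. s i *\<^sub>R e i) (e j) = s j" if "j \<le> d" for s j
    using that by (simp add: inner_sum_left ee if_distrib[of "\<lambda>x. _ * x"] cong: if_cong)
  define S where "S = {x \<in> V. norm x = r}"
  define f where "f = (\<lambda>x i. if i \<le> d then inner x (e i) / r else 0)"
  have top: "topspace (nsphere d) = {x. (\<Sum>i\<le>d. (x i)\<^sup>2) = 1 \<and> (\<forall>i>d. x i = 0)}"
    by (auto simp: nsphere)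
  have "homeomorphic_map (top_of_set S) (nsphere d) f"
  proof (rule continuous_imp_homeomorphic_map)
    have "bounded S" by (auto simp: S_def bounded_iff)
    moreover have "S = V \<inter> {x. norm x = r}" by (auto simp: S_def)
    then have "closed S"
      using closed_subspace[OF V(1)] by (simp add: closed_Int closed_Collect_eq continuous_on_norm)
    ultimately have "compact S" by (simp add: compact_eq_bounded_closed)
    then show "compact_space (top_of_set S)"
      by (simp add: compact_space_subtopology)
    show "Hausdorff_space (nsphere d)"
      unfolding nsphere_def by (intro Hausdorff_space_subtopology Hausdorff_Euclidean_space)
    have img: "f x \<in> topspace (nsphere d)" if "x \<in> S" for x
    proof -
      have "inner x x = (\<Sum>i\<le>d. (inner x (e i))\<^sup>2)"
        using sq[of "\<lambda>i. inner x (e i)"] ex[of x] that by (simp add: S_def)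
      moreover have "inner x x = r\<^sup>2" using that by (simp add: S_def dot_square_norm)
      ultimately have "(\<Sum>i\<le>d. (inner x (e i))\<^sup>2) = r\<^sup>2" by simp
      then have "(\<Sum>i\<le>d. (inner x (e i) / r)\<^sup>2) = r\<^sup>2 / r\<^sup>2"
        by (simp only: power_divide sum_divide_distrib[symmetric])
      then have "(\<Sum>i\<le>d. (inner x (e i) / r)\<^sup>2) = 1" using r by simp
      then show ?thesis by (simp add: top f_def)
    qed
    have "continuous_map (top_of_set S) euclideanreal (\<lambda>x. f x k)" for k
      using r by (cases "k \<le> d") (auto simp: f_def intro!: continuous_intros)
    then show "continuous_map (top_of_set S) (nsphere d) f"
      using img unfolding nsphere continuous_map_in_subtopology continuous_map_componentwise_UNIV
      by (auto simp: nsphere)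
    show "f ` topspace (top_of_set S) = topspace (nsphere d)"
    proof
      show "f ` topspace (top_of_set S) \<subseteq> topspace (nsphere d)" using img by auto
      show "topspace (nsphere d) \<subseteq> f ` topspace (top_of_set S)"
      proof
        fix y assume y: "y \<in> topspace (nsphere d)"
        define x where "x = (\<Sum>i\<le>d. (r * y i) *\<^sub>R e i)"
        have "x \<in> V" unfolding x_def
          by (intro subspace_sum[OF V(1)] subspace_scale[OF V(1)]) (use eB B(1) in auto)
        moreover have "inner x x = r\<^sup>2"
          unfolding x_def sq using y by (simp add: top power_mult_distrib flip: sum_distrib_left)
        then have "norm x = r" using r by (simp add: norm_eq_sqrt_inner)
        moreover have "f x = y"
          using y r co[of _ "\<lambda>i. r * y i"] by (auto simp: f_def x_def top fun_eq_iff)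
        ultimately show "y \<in> f ` topspace (top_of_set S)" by (auto simp: S_def)
      qed
    qed
    show "inj_on f (topspace (top_of_set S))"
    proof (rule inj_onI)
      fix x y assume "x \<in> topspace (top_of_set S)" "y \<in> topspace (top_of_set S)" and eq: "f x = f y"
      then have xy: "x \<in> V" "y \<in> V" by (auto simp: S_def)
      have "inner x (e i) = inner y (e i)" if "i \<le> d" for i
        using fun_cong[OF eq, of i] that r by (simp add: f_def)
      then have "(\<Sum>i\<le>d. inner x (e i) *\<^sub>R e i) = (\<Sum>i\<le>d. inner y (e i) *\<^sub>R e i)" by simp
      then show "x = y" using ex xy by simp
    qed
  qed
  then show ?thesis unfolding S_def by (rule homeomorphic_map_imp_homeomorphic_space)
qed

lemma dim_linear_image_UNIV:
  fixes f :: "'a::euclidean_space \<Rightarrow> 'b::euclidean_space"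
  assumes "linear f" "inj f"
  shows "dim (range f) = DIM('a)"
  using dim_image_eq[OF assms(1), of UNIV] assms(2) by (simp add: dim_UNIV)

lemma dim_Alg:
  assumes "n \<le> 3"
  shows "dim (Alg n) = 2 ^ n"
proof -
  have l: "linear (\<lambda>r::real. oct_of_complex (of_real r))" "linear oct_of_complex" "linear (\<lambda>q::quat. (q, 0::quat))"
    by (auto intro!: linearI simp: oct_of_complex_def scaleR_conv_of_real zero_prod_def)
  have i: "inj (\<lambda>r::real. oct_of_complex (of_real r))" "inj oct_of_complex" "inj (\<lambda>q::quat. (q, 0::quat))"
    by (auto simp: inj_on_def oct_of_complex_def)
  consider "n = 0" | "n = 1" | "n = 2" | "n = 3" using assms by linarith
  then show ?thesis
  proof cases
    case 1
    then show ?thesis using dim_linear_image_UNIV[OF l(1) i(1)] by (simp add: Alg_def)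
  next
    case 2
    then show ?thesis using dim_linear_image_UNIV[OF l(2) i(2)] by (simp add: Alg_def)
  next
    case 3
    then show ?thesis using dim_linear_image_UNIV[OF l(3) i(3)] by (simp add: Alg_def)
  qed (simp add: Alg_def dim_UNIV)
qed

lemma unit_elements_nsphere:
  assumes "n \<le> 3"
  shows "top_of_set (unit_elements n) homeomorphic_space nsphere (2 ^ n - 1)"
  unfolding unit_elements_def
  by (rule sphere_homeomorphic_nsphere[OF subspace_Alg]) (simp_all add: dim_Alg assms)

lemma subspace_Herm_tr_0: "subspace (Herm_tr n 0)"
  using subspace_Herm[of n] by (auto simp: subspace_def Herm_tr_def tr_add tr_scaleR)

lemma dim_Herm_tr_0:
  assumes "n \<le> 3"
  shows "dim (Herm_tr n 0) = 3 * 2 ^ n + 2"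
proof -
  define f where "f = (\<lambda>(y, z, a, b, c). mk (- y - z) y z a b c)"
  define D where "D = (UNIV :: real set) \<times> (UNIV :: real set) \<times> Alg n \<times> Alg n \<times> Alg n"
  have lin: "linear f" by (auto intro!: linearI simp: f_def mk_arith algebra_simps)
  have "f ` D = Herm_tr n 0"
  proof
    show "f ` D \<subseteq> Herm_tr n 0" by (auto simp: f_def D_def Herm_tr_def simp del: split_paired_All)
    show "Herm_tr n 0 \<subseteq> f ` D"
    proof
      fix X assume X: "X \<in> Herm_tr n 0"
      then have "X \<in> Herm n" "tr X = 0" by (simp_all add: Herm_tr_def)
      then show "X \<in> f ` D"
      proof (elim Herm_cases)
        fix x y z a b c assume *: "X = mk x y z a b c" "a \<in> Alg n" "b \<in> Alg n" "c \<in> Alg n" "tr X = 0"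
        then have "X = f (y, z, a, b, c)" by (simp add: f_def)
        then show ?thesis using * by (simp add: D_def)
      qed
    qed
  qed
  moreover have "dim (f ` D) = dim D"
  proof (rule dim_image_eq[OF lin])
    have "subspace D" unfolding D_def by (intro subspace_Times subspace_UNIV subspace_Alg)
    show "inj_on f (span D)" by (auto simp: inj_on_def f_def)
  qed
  moreover have "dim D = 3 * 2 ^ n + 2"
    unfolding D_def by (simp add: dim_Times subspace_Times subspace_Alg subspace_UNIV dim_UNIV dim_Alg[OF assms])
  ultimately show ?thesis by simp
qed

lemma rho_pos: "rho > 0" and rho_sq: "rho\<^sup>2 = 2 / 3"
  by (simp_all add: rho_def)

lemma Herm_sphere_nsphere:
  assumes "n \<le> 3"
  shows "top_of_set (Herm_sphere n) homeomorphic_space nsphere (3 * 2 ^ n + 1)"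
  unfolding Herm_sphere_def
  by (rule sphere_homeomorphic_nsphere[OF subspace_Herm_tr_0 _ rho_pos]) (simp add: dim_Herm_tr_0 assms)

section \<open>The topology of the complexified plane\<close>

lemma quotient_map_CProj: "quotient_map (top_of_set (HermC n - {0})) (CProj_top n) line"
  unfolding quotient_map_def topspace_CProj_top openin_CProj_top by (auto simp: CProj_def)

lemma continuous_on_freudC: "continuous_on S freudC"
  unfolding freudC_def[abs_def]
  by (intro continuous_on_Pair continuous_on_diff continuous_on_scaleR continuous_on_const freud.continuous_on
      continuous_on_fst continuous_on_snd continuous_on_id)

lemma orbit_cone_eq: "orbit_cone n = {Z \<in> HermC n - {0}. freudC Z = 0}"
  using orbit_cone_iff by auto

lemma closedin_orbit_cone: "closedin (top_of_set (HermC n - {0})) (orbit_cone n)"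
  unfolding orbit_cone_eq
  by (rule continuous_closedin_preimage_constant[OF continuous_on_freudC])

lemma line_preimage_planeC: "{Z \<in> topspace (top_of_set (HermC n - {0})). line Z \<in> planeC n} = orbit_cone n"
  by (auto simp: planeC_iff orbit_cone_iff)

lemma planeC_subset_CProj: "planeC n \<subseteq> CProj n"
  unfolding planeC_orbit_cone CProj_def by (auto simp: orbit_cone_iff)

lemma topspace_planeC_top [simp]: "topspace (planeC_top n) = planeC n"
  using planeC_subset_CProj by (auto simp: planeC_top_def topspace_CProj_top)

text \<open>The plane is closed, so its preimage is a closed saturated set, and to such a set a
  quotient map restricts.\<close>

lemma quotient_map_planeC: "quotient_map (top_of_set (orbit_cone n)) (planeC_top n) line"
proof -
  have "closedin (top_of_set (HermC n - {0})) {Z \<in> topspace (top_of_set (HermC n - {0})). line Z \<in> planeC n}"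
    unfolding line_preimage_planeC by (rule closedin_orbit_cone)
  then have "closedin (CProj_top n) (planeC n)"
    using quotient_map_CProj[of n] planeC_subset_CProj[of n] unfolding quotient_map_closedin topspace_CProj_top by blast
  then have "quotient_map (subtopology (top_of_set (HermC n - {0})) (orbit_cone n)) (planeC_top n) line"
    unfolding planeC_top_def by (intro quotient_map_restriction[OF quotient_map_CProj line_preimage_planeC]) blast
  moreover have "subtopology (top_of_set (HermC n - {0})) (orbit_cone n) = top_of_set (orbit_cone n)"
    by (simp add: subtopology_subtopology orbit_cone_eq Int_absorb1 subset_iff)
  ultimately show ?thesis by simp
qed

lemma compact_space_planeC: "compact_space (planeC_top n)"
proof -
  define K where "K = HermC n \<inter> {Z. norm Z = 1} \<inter> {Z. freudC Z = 0}"
  have "closed K"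
    unfolding K_def using closed_subspace[OF subspace_HermC[of n]]
    by (intro closed_Int closed_Collect_eq continuous_on_norm continuous_on_id continuous_on_const continuous_on_freudC)
  moreover have "bounded K" by (auto simp: K_def bounded_iff)
  ultimately have K: "compact K" by (simp add: compact_eq_bounded_closed)
  have sub: "K \<subseteq> orbit_cone n" by (auto simp: K_def orbit_cone_iff)
  have "continuous_map (top_of_set (orbit_cone n)) (planeC_top n) line"
    by (rule quotient_imp_continuous_map[OF quotient_map_planeC])
  moreover have "compactin (top_of_set (orbit_cone n)) K"
    using K sub by (simp add: compactin_subtopology)
  ultimately have "compactin (planeC_top n) (line ` K)" by (rule image_compactin[rotated])
  moreover have "line ` K = planeC n"
  proof
    show "line ` K \<subseteq> planeC n" using sub by (auto simp: planeC_orbit_cone)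
    show "planeC n \<subseteq> line ` K"
    proof
      fix p assume "p \<in> planeC n"
      then obtain X Y where "p = line (X, Y)" "X \<in> Herm n" "Y \<in> Herm n" "norm (X, Y) = 1" "freudC (X, Y) = 0"
        by (rule planeC_unit_rep)
      then show "p \<in> line ` K" by (auto simp: K_def)
    qed
  qed
  ultimately show ?thesis by (simp add: compact_space_def)
qed

lemma continuous_map_planeC:
  fixes f :: "_ \<Rightarrow> 'b::topological_space"
  assumes "continuous_on (orbit_cone n) F" "\<And>Z. Z \<in> orbit_cone n \<Longrightarrow> f (line Z) = F Z"
  shows "continuous_map (planeC_top n) euclidean f"
proof (rule continuous_compose_quotient_map[OF quotient_map_planeC])
  have "continuous_on (orbit_cone n) (f \<circ> line)"
    using assms by (simp cong: continuous_on_cong)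
  then show "continuous_map (top_of_set (orbit_cone n)) euclidean (f \<circ> line)" by simp
qed

section \<open>Normal forms in the plane\<close>

definition nf :: "(omat \<Rightarrow> omat) \<Rightarrow> real \<Rightarrow> real \<Rightarrow> oct \<Rightarrow> omat \<times> omat"
  where "nf h \<alpha> \<beta> b = (h (mk \<alpha> 0 (- \<beta>) 0 0 0), h (mk 0 0 0 0 b 0))"

definition nf_data :: "nat \<Rightarrow> (omat \<Rightarrow> omat) \<Rightarrow> real \<Rightarrow> real \<Rightarrow> oct \<Rightarrow> bool"
  where "nf_data n h \<alpha> \<beta> b \<longleftrightarrow> h \<in> rotations n \<and> b \<in> Alg n \<and> \<alpha> + \<beta> = 1 \<and> (norm b)\<^sup>2 = \<alpha> * \<beta>"

definition sigma_fun :: "omat \<times> omat \<Rightarrow> omat"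
  where "sigma_fun Z = (1 / (norm Z)\<^sup>2) *\<^sub>R quad Z - (1 / 3) *\<^sub>R one_mat"

text \<open>The imaginary part of the representative whose trace is real, scaled so as to depend only on
  the line.  It vanishes exactly over the real points and the points at infinity.\<close>

definition kappa_fun :: "omat \<times> omat \<Rightarrow> omat"
  where "kappa_fun Z = (1 / (norm Z)\<^sup>2) *\<^sub>R snd (cscale (cnj (trC Z)) Z)"

text \<open>The choice of representative is harmless because \<open>kappa_fun\<close> is constant on
  punctured lines.\<close>

definition kappa :: "nat \<Rightarrow> (omat \<times> omat) set \<Rightarrow> omat"
  where "kappa n p = kappa_fun (SOME Z. Z \<in> orbit_cone n \<and> line Z = p)"

lemma kappa_fun_cscale:
  assumes "c \<noteq> 0"
  shows "kappa_fun (cscale c Z) = kappa_fun Z"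
proof -
  have s: "cscale (of_real r * d) Z = r *\<^sub>R cscale d Z" for r d
    by (cases Z) (simp add: algebra_simps)
  have "cnj (trC (cscale c Z)) * c = of_real ((cmod c)\<^sup>2) * cnj (trC Z)"
    using complex_norm_square[of c] by (simp add: trC_cscale mult_ac)
  then have "cscale (cnj (trC (cscale c Z))) (cscale c Z) = (cmod c)\<^sup>2 *\<^sub>R cscale (cnj (trC Z)) Z"
    by (simp only: cscale_cscale s)
  then show ?thesis
    using assms by (simp add: kappa_fun_def norm_cscale power_mult_distrib)
qed

lemma kappa_line:
  assumes "Z \<in> orbit_cone n"
  shows "kappa n (line Z) = kappa_fun Z"
proof -
  define W where "W = (SOME W. W \<in> orbit_cone n \<and> line W = line Z)"
  have W: "W \<in> orbit_cone n \<and> line W = line Z"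
    unfolding W_def by (rule someI[of _ Z]) (simp add: assms)
  then have "W \<noteq> 0" by (simp add: orbit_cone_iff)
  then obtain c where "c \<noteq> 0" "W = cscale c Z" using line_eqD W by metis
  then show ?thesis by (simp add: kappa_def W_def[symmetric] kappa_fun_cscale)
qed

lemma sigma_map_orbit_cone:
  assumes Z: "Z \<in> orbit_cone n"
  shows "sigma_map n (line Z) = sigma_fun Z"
proof -
  define c where "c = complex_of_real (1 / norm Z)"
  have Z': "Z \<in> HermC n" "Z \<noteq> 0" "freudC Z = 0" using Z by (simp_all add: orbit_cone_iff)
  then have c: "c \<noteq> 0" "cmod c = 1 / norm Z" by (simp_all add: c_def norm_divide)
  have "sigma_map n (line (cscale c Z)) = quad (cscale c Z) - (1 / 3) *\<^sub>R one_mat"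
    using Z' c by (intro sigma_map_line cscale_HermC) (simp_all add: freudC_cscale norm_cscale linear_0[OF linear_cscale])
  then show ?thesis
    unfolding line_cscale[OF c(1)] quad_cscale c(2) sigma_fun_def by (simp add: power_divide)
qed

lemma rotations_mk_Herm: "h \<in> rotations n \<Longrightarrow> b \<in> Alg n \<Longrightarrow> h (mk x y z 0 b 0) \<in> Herm n"
  by (rule rotations_Herm) simp_all

lemma nf_orbit_cone:
  assumes "nf_data n h \<alpha> \<beta> b"
  shows "nf h \<alpha> \<beta> b \<in> orbit_cone n"
  using orbit_cone_rotations[of h n "(mk \<alpha> 0 (- \<beta>) 0 0 0, mk 0 0 0 0 b 0)"] normal_form_orbit_cone[of b n \<alpha> \<beta>] assms
  by (simp add: nf_data_def nf_def)

lemma norm_nf: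
  assumes "nf_data n h \<alpha> \<beta> b"
  shows "norm (nf h \<alpha> \<beta> b) = 1"
proof -
  have h: "h \<in> rotations n" "b \<in> Alg n" "\<alpha> + \<beta> = 1" "(norm b)\<^sup>2 = \<alpha> * \<beta>" using assms by (simp_all add: nf_data_def)
  have "inner b b = \<alpha> * \<beta>" using h(4) by (simp add: power2_norm_eq_inner)
  then have "inner (nf h \<alpha> \<beta> b) (nf h \<alpha> \<beta> b) = \<alpha>\<^sup>2 + \<beta>\<^sup>2 + 2 * (\<alpha> * \<beta>)"
    using h(1,2) by (simp add: nf_def rotations_inner[of h n] inner_mk power2_eq_square)
  also have "\<dots> = (\<alpha> + \<beta>)\<^sup>2" by (simp add: power2_eq_square algebra_simps)
  finally show ?thesis by (simp add: norm_eq_sqrt_inner h(3))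
qed

lemma trC_nf:
  assumes "nf_data n h \<alpha> \<beta> b"
  shows "trC (nf h \<alpha> \<beta> b) = of_real (\<alpha> - \<beta>)"
  using assms by (simp add: nf_data_def nf_def trC_def rotations_tr[of h n] complex_eq_iff)

text \<open>Both parts have diagonal squares, and by the relations between \<open>\<alpha>\<close>,
  \<open>\<beta>\<close> and \<open>b\<close> the squares add up to the diagonal matrix with entries
  \<open>\<alpha>\<close>, 0, \<open>\<beta>\<close>.\<close>

lemma sigma_map_nf:
  assumes "nf_data n h \<alpha> \<beta> b"
  shows "sigma_map n (line (nf h \<alpha> \<beta> b)) = h (mk (\<alpha> - 1 / 3) (- 1 / 3) (\<beta> - 1 / 3) 0 0 0)"
proof -
  have h: "h \<in> rotations n" "b \<in> Alg n" "\<alpha> + \<beta> = 1" "(norm b)\<^sup>2 = \<alpha> * \<beta>" using assms by (simp_all add: nf_data_def)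
  note l = linear_rotations[OF h(1)]
  have ab: "\<alpha>\<^sup>2 + \<alpha> * \<beta> = \<alpha>" "\<beta>\<^sup>2 + \<alpha> * \<beta> = \<beta>"
  proof -
    have "\<alpha>\<^sup>2 + \<alpha> * \<beta> = \<alpha> * (\<alpha> + \<beta>)" "\<beta>\<^sup>2 + \<alpha> * \<beta> = \<beta> * (\<alpha> + \<beta>)"
      by (simp_all add: power2_eq_square algebra_simps)
    then show "\<alpha>\<^sup>2 + \<alpha> * \<beta> = \<alpha>" "\<beta>\<^sup>2 + \<alpha> * \<beta> = \<beta>" by (simp_all add: h(3))
  qed
  have "quad (nf h \<alpha> \<beta> b) = h (mk \<alpha> 0 \<beta> 0 0 0)"
    using h ab by (simp add: quad_def nf_def jprod_mk_self mk_add flip: rotations_jprod[OF h(1)] linear_add[OF l])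
  moreover have "(1 / 3) *\<^sub>R one_mat = h (mk (1/3) (1/3) (1/3) 0 0 0)"
    using rotations_one[OF h(1)] linear_scale[OF l, of "1/3" one_mat] by (simp add: one_mat_mk mk_scaleR)
  ultimately show ?thesis
    by (simp add: sigma_map_orbit_cone[OF nf_orbit_cone[OF assms]] sigma_fun_def norm_nf[OF assms] mk_diff
        flip: linear_diff[OF l])
qed

lemma kappa_nf:
  assumes "nf_data n h \<alpha> \<beta> b"
  shows "kappa n (line (nf h \<alpha> \<beta> b)) = (\<alpha> - \<beta>) *\<^sub>R h (mk 0 0 0 0 b 0)"
  unfolding kappa_line[OF nf_orbit_cone[OF assms]] kappa_fun_def norm_nf[OF assms] trC_nf[OF assms]
  by (simp add: nf_def)

lemma norm_rotations: "h \<in> rotations n \<Longrightarrow> X \<in> Herm n \<Longrightarrow> norm (h X) = norm X"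
  by (simp add: norm_eq_sqrt_inner rotations_inner)

text \<open>Positivity comes from \<open>\<alpha> \<beta> \<le> 1/4\<close>, which leaves at least
  1/6.\<close>

lemma norm_sigma_map_nf:
  assumes "nf_data n h \<alpha> \<beta> b"
  shows "(norm (sigma_map n (line (nf h \<alpha> \<beta> b))))\<^sup>2 = 2 / 3 - 2 * (\<alpha> * \<beta>)"
    and "norm (sigma_map n (line (nf h \<alpha> \<beta> b))) > 0"
proof -
  have h: "h \<in> rotations n" "\<beta> = 1 - \<alpha>" using assms by (simp_all add: nf_data_def)
  have "norm (sigma_map n (line (nf h \<alpha> \<beta> b))) = norm (mk (\<alpha> - 1 / 3) (- 1 / 3) (\<beta> - 1 / 3) 0 0 0)"
    unfolding sigma_map_nf[OF assms] by (rule norm_rotations[OF h(1)]) simp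
  then have "(norm (sigma_map n (line (nf h \<alpha> \<beta> b))))\<^sup>2 = (\<alpha> - 1 / 3)\<^sup>2 + (- 1 / 3)\<^sup>2 + (\<beta> - 1 / 3)\<^sup>2"
    by (simp only: norm_mk) simp
  also have "\<dots> = 2 / 3 - 2 * (\<alpha> * \<beta>)"
    unfolding h(2) by (simp add: power2_eq_square algebra_simps)
  finally show *: "(norm (sigma_map n (line (nf h \<alpha> \<beta> b))))\<^sup>2 = 2 / 3 - 2 * (\<alpha> * \<beta>)" .
  have "(\<alpha> - \<beta>)\<^sup>2 \<ge> 0" by simp
  then have "2 / 3 - 2 * (\<alpha> * \<beta>) \<ge> 1 / 6" unfolding h(2) by (simp add: power2_eq_square algebra_simps)
  with * have "(norm (sigma_map n (line (nf h \<alpha> \<beta> b))))\<^sup>2 > 0" by linarith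
  then show "norm (sigma_map n (line (nf h \<alpha> \<beta> b))) > 0" by simp
qed

lemma planeC_nf:
  assumes "p \<in> planeC n"
  obtains h \<alpha> \<beta> b where "nf_data n h \<alpha> \<beta> b" "\<alpha> \<ge> \<beta>" "\<beta> \<ge> 0" "p = line (nf h \<alpha> \<beta> b)"
proof -
  obtain X Y where XY: "p = line (X, Y)" "X \<in> Herm n" "Y \<in> Herm n" "norm (X, Y) = 1" "freudC (X, Y) = 0"
    "tr X \<ge> 0" "tr Y = 0" using assms by (rule planeC_unit_rep)
  have "(X, Y) \<in> HermC n" using XY by simp
  then obtain g \<alpha> \<beta> b where g: "g \<in> rotations n" "g X = mk \<alpha> 0 (- \<beta>) 0 0 0" "g Y = mk 0 0 0 0 b 0"
    "b \<in> Alg n" "\<alpha> \<ge> \<beta>" "\<beta> \<ge> 0" "\<alpha> + \<beta> = 1" "(norm b)\<^sup>2 = \<alpha> * \<beta>"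
    using normal_form[OF _ XY(4,6,7,5)] by metis
  obtain h where h: "h \<in> rotations n" "\<And>X. X \<in> Herm n \<Longrightarrow> h (g X) = X" using rotations_inverse[OF g(1)] by metis
  have "(X, Y) = nf h \<alpha> \<beta> b" using h(2)[OF XY(2)] h(2)[OF XY(3)] by (simp add: nf_def g)
  then show thesis using that[of h \<alpha> \<beta> b] g h(1) XY(1) by (simp add: nf_data_def)
qed

lemma line_nf_planeC: "nf_data n h \<alpha> \<beta> b \<Longrightarrow> line (nf h \<alpha> \<beta> b) \<in> planeC n"
  using nf_orbit_cone by (auto simp: planeC_orbit_cone)

lemma phi_map_nf:
  assumes "nf_data n h \<alpha> \<beta> b"
  obtains s where "s > 0" "phi_map n (line (nf h \<alpha> \<beta> b)) = s *\<^sub>R h (mk (\<alpha> - 1 / 3) (- 1 / 3) (\<beta> - 1 / 3) 0 0 0)"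
    "s\<^sup>2 * (2 / 3 - 2 * (\<alpha> * \<beta>)) = 2 / 3"
proof
  show "rho / norm (sigma_map n (line (nf h \<alpha> \<beta> b))) > 0"
    using rho_pos norm_sigma_map_nf(2)[OF assms] by simp
  show "(rho / norm (sigma_map n (line (nf h \<alpha> \<beta> b))))\<^sup>2 * (2 / 3 - 2 * (\<alpha> * \<beta>)) = 2 / 3"
    using norm_sigma_map_nf(2)[OF assms] rho_sq unfolding norm_sigma_map_nf(1)[OF assms, symmetric]
    by (simp add: power_divide)
qed (simp add: phi_map_def sigma_map_nf[OF assms])

lemma phi_map_Herm_sphere:
  assumes "p \<in> planeC n"
  shows "phi_map n p \<in> Herm_sphere n"
proof -
  obtain h \<alpha> \<beta> b where d: "nf_data n h \<alpha> \<beta> b" "p = line (nf h \<alpha> \<beta> b)" using planeC_nf[OF assms] by metis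
  have h: "h \<in> rotations n" "\<alpha> + \<beta> = 1" using d by (simp_all add: nf_data_def)
  have "sigma_map n p \<in> Herm n" "tr (sigma_map n p) = 0"
    unfolding d(2) sigma_map_nf[OF d(1)] using h by (simp_all add: rotations_mk_Herm rotations_tr[of h n])
  moreover have "norm (sigma_map n p) > 0" unfolding d(2) by (rule norm_sigma_map_nf(2)[OF d(1)])
  ultimately show ?thesis
    using rho_pos by (simp add: phi_map_def Herm_sphere_def Herm_tr_def Herm_scaleR tr_scaleR)
qed

lemma continuous_on_trC: "continuous_on S trC"
  unfolding trC_def[abs_def] by (intro continuous_on_Complex continuous_on_tr continuous_on_fst continuous_on_snd continuous_on_id)

lemma continuous_on_sigma_fun: "continuous_on (orbit_cone n) sigma_fun"
  unfolding sigma_fun_def[abs_def] quad_def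
  by (intro continuous_on_diff continuous_on_add continuous_on_scaleR continuous_on_divide continuous_on_power
      continuous_on_norm continuous_on_const continuous_on_jprod continuous_on_fst continuous_on_snd continuous_on_id)
    (auto simp: orbit_cone_iff)

lemma continuous_kappa: "continuous_map (planeC_top n) euclidean (kappa n)"
proof (rule continuous_map_planeC)
  have "continuous_on (orbit_cone n) (\<lambda>Z. snd (cscale (cnj (trC Z)) Z))"
    unfolding cscale_def snd_conv
    by (intro continuous_on_add continuous_on_scaleR continuous_on_Re continuous_on_Im continuous_on_cnj continuous_on_trC
        continuous_on_fst continuous_on_snd continuous_on_id)
  then show "continuous_on (orbit_cone n) kappa_fun"
    unfolding kappa_fun_def[abs_def]
    by (intro continuous_on_scaleR continuous_on_divide continuous_on_power
        continuous_on_norm continuous_on_const continuous_on_id) (auto simp: orbit_cone_iff)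
qed (rule kappa_line)

lemma continuous_phi_map: "continuous_map (planeC_top n) (top_of_set (Herm_sphere n)) (phi_map n)"
proof -
  have nz: "norm (sigma_map n p) \<noteq> 0" if "p \<in> planeC n" for p
    using planeC_nf[OF that] norm_sigma_map_nf(2) by (metis less_irrefl)
  have c: "continuous_on (orbit_cone n) sigma_fun" by (rule continuous_on_sigma_fun)
  have "continuous_map (planeC_top n) euclidean (phi_map n)"
  proof (rule continuous_map_planeC)
    show "continuous_on (orbit_cone n) (\<lambda>Z. (rho / norm (sigma_fun Z)) *\<^sub>R sigma_fun Z)"
    proof (intro continuous_on_scaleR continuous_on_divide continuous_on_norm continuous_on_const c ballI)
      fix Z assume "Z \<in> orbit_cone n"
      then show "norm (sigma_fun Z) \<noteq> 0"
        using nz[of "line Z"] sigma_map_orbit_cone planeC_orbit_cone by simp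
    qed
  qed (simp add: phi_map_def sigma_map_orbit_cone)
  then show ?thesis
    using phi_map_Herm_sphere by (auto simp: continuous_map_in_subtopology)
qed

section \<open>Real points, points at infinity and generic points\<close>

lemma real_point_nf:
  assumes "X \<in> idem1 n"
  obtains h where "nf_data n h 1 0 0" "(X, 0) = nf h 1 0 0"
proof -
  obtain k where k: "k \<in> rotations n" "k X = E_mat" using idem1_transitive[OF assms] by metis
  obtain h where h: "h \<in> rotations n" "\<And>X. X \<in> Herm n \<Longrightarrow> h (k X) = X" using rotations_inverse[OF k(1)] by metis
  have "h E_mat = X" using h(2)[of X] k(2) assms by (simp add: idem1_def)
  then show thesis
    using that[of h] h(1) linear_0[OF linear_rotations[OF h(1)]] by (simp add: nf_data_def nf_def E_mat_mk mk_zero)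
qed

lemma phi_map_real_point:
  assumes "X \<in> idem1 n"
  shows "line (X, 0) \<in> planeC n" "phi_map n (line (X, 0)) = X - (1 / 3) *\<^sub>R one_mat"
proof -
  obtain h where h: "nf_data n h 1 0 0" "(X, 0) = nf h 1 0 0" using real_point_nf[OF assms] .
  show "line (X, 0) \<in> planeC n" unfolding h(2) by (rule line_nf_planeC[OF h(1)])
  obtain s where s: "s > 0" "phi_map n (line (X, 0)) = s *\<^sub>R h (mk (1 - 1 / 3) (- 1 / 3) (0 - 1 / 3) 0 0 0)"
    "s\<^sup>2 * (2 / 3 - 2 * (1 * 0)) = 2 / 3" using phi_map_nf[OF h(1)] h(2) by metis
  have "s = 1" using s(1,3) by (simp add: power2_eq_1_iff)
  have hr: "h \<in> rotations n" using h(1) by (simp add: nf_data_def)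
  have X: "X = h (mk 1 0 0 0 0 0)" using h(2) by (simp add: nf_def)
  have e: "mk (1 - 1 / 3) (- 1 / 3) (0 - 1 / 3) 0 0 0 = mk 1 0 0 0 0 0 - (1 / 3) *\<^sub>R one_mat"
    by (simp add: one_mat_mk mk_arith)
  show "phi_map n (line (X, 0)) = X - (1 / 3) *\<^sub>R one_mat"
    unfolding s(2) \<open>s = 1\<close> e
    by (simp add: X linear_diff[OF linear_rotations[OF hr]] linear_scale[OF linear_rotations[OF hr]] rotations_one[OF hr])
qed

text \<open>The quadratic equations of \<open>plane_tilde\<close> and its antipode rule out three distinct eigenvalues.\<close>

lemma idem1_shift_square:
  assumes "X \<in> idem1 n" "y = X - (1 / 3) *\<^sub>R one_mat"
  shows "jprod y y = (1 / 3) *\<^sub>R y + (2 / 9) *\<^sub>R one_mat"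
proof -
  have "X \<in> Herm n" "jprod X X = X" using assms by (simp_all add: idem1_def)
  then show ?thesis
    unfolding assms(2) by (simp add: jprod_linear jprod_one[of _ n] algebra_simps flip: scaleR_add_left)
qed

definition plane_base :: "nat \<Rightarrow> omat set"
  where "plane_base n = Herm_sphere n - (plane_tilde n \<union> uminus ` plane_tilde n)"

lemma plane_tilde_idem1: "n \<le> 3 \<Longrightarrow> plane_tilde n = {X - (1 / 3) *\<^sub>R one_mat | X. X \<in> idem1 n}"
  by (simp add: plane_tilde_def proj_plane_idem1)

lemma rotations_diag_square:
  assumes h: "h \<in> rotations n" and y: "y = h (mk p q r 0 0 0)"
    and sq: "jprod y y = \<epsilon> *\<^sub>R y + \<delta> *\<^sub>R one_mat"
  shows "p\<^sup>2 = \<epsilon> * p + \<delta>" "q\<^sup>2 = \<epsilon> * q + \<delta>" "r\<^sup>2 = \<epsilon> * r + \<delta>"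
proof -
  obtain g where g: "g \<in> rotations n" "\<And>X. X \<in> Herm n \<Longrightarrow> g (h X) = X" using rotations_inverse[OF h] by metis
  have H: "y \<in> Herm n" unfolding y by (rule rotations_Herm[OF h]) simp
  have gy: "g y = mk p q r 0 0 0" unfolding y by (rule g(2)) simp
  have "jprod (g y) (g y) = \<epsilon> *\<^sub>R g y + \<delta> *\<^sub>R one_mat"
    using arg_cong[OF sq, of g] rotations_jprod[OF g(1) H H] rotations_one[OF g(1)]
    by (simp add: linear_add[OF linear_rotations[OF g(1)]] linear_scale[OF linear_rotations[OF g(1)]])
  then show "p\<^sup>2 = \<epsilon> * p + \<delta>" "q\<^sup>2 = \<epsilon> * q + \<delta>" "r\<^sup>2 = \<epsilon> * r + \<delta>"
    unfolding gy jprod_mk_self by (simp_all add: one_mat_mk mk_arith)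
qed

text \<open>On both exceptional sets every eigenvalue satisfies one quadratic equation, whereas here
  there are three different eigenvalues.\<close>

lemma phi_map_nf_base:
  assumes n: "n \<le> 3" and d: "nf_data n h \<alpha> \<beta> b" and ab: "\<alpha> > \<beta>" "\<beta> > 0"
  shows "phi_map n (line (nf h \<alpha> \<beta> b)) \<in> plane_base n"
proof -
  define y where "y = phi_map n (line (nf h \<alpha> \<beta> b))"
  obtain s where s: "s > 0" "y = s *\<^sub>R h (mk (\<alpha> - 1 / 3) (- 1 / 3) (\<beta> - 1 / 3) 0 0 0)"
    using phi_map_nf[OF d] y_def by metis
  have h: "h \<in> rotations n" using d by (simp add: nf_data_def)
  have y: "y = h (mk (s * (\<alpha> - 1 / 3)) (s * (- 1 / 3)) (s * (\<beta> - 1 / 3)) 0 0 0)"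
    unfolding s(2) by (simp add: linear_scale[OF linear_rotations[OF h], symmetric] mk_scaleR)
  have no: "jprod y y \<noteq> \<epsilon> *\<^sub>R y + \<delta> *\<^sub>R one_mat" for \<epsilon> \<delta>
  proof
    assume "jprod y y = \<epsilon> *\<^sub>R y + \<delta> *\<^sub>R one_mat"
    note r = rotations_diag_square[OF h y this]
    define u v w where "u = s * (\<alpha> - 1 / 3)" and "v = s * (- 1 / 3)" and "w = s * (\<beta> - 1 / 3)"
    have "u - v = s * \<alpha>" "u - w = s * (\<alpha> - \<beta>)" "w - v = s * \<beta>"
      by (simp_all add: u_def v_def w_def algebra_simps)
    then have "u - v > 0" "u - w > 0" "w - v > 0" using s(1) ab by simp_all
    then have ne: "u \<noteq> v" "u \<noteq> w" "v \<noteq> w" by simp_all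
    have "(u - v) * (u + v - \<epsilon>) = 0" "(u - w) * (u + w - \<epsilon>) = 0"
      using r unfolding u_def[symmetric] v_def[symmetric] w_def[symmetric] by (simp_all add: power2_eq_square algebra_simps)
    then show False using ne by simp
  qed
  have "y \<notin> plane_tilde n"
    using no idem1_shift_square unfolding plane_tilde_idem1[OF n] by blast
  moreover have "y \<notin> uminus ` plane_tilde n"
  proof
    assume "y \<in> uminus ` plane_tilde n"
    then obtain X where "X \<in> idem1 n" "- y = X - (1 / 3) *\<^sub>R one_mat" unfolding plane_tilde_idem1[OF n] by auto
    from idem1_shift_square[OF this] have "jprod y y = (- 1 / 3) *\<^sub>R y + (2 / 9) *\<^sub>R one_mat"
      by (simp add: jprod_linear)
    then show False using no by blast
  qed
  moreover have "y \<in> Herm_sphere n" unfolding y_def by (rule phi_map_Herm_sphere[OF line_nf_planeC[OF d]])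
  ultimately show ?thesis unfolding plane_base_def y_def by blast
qed

lemma phi_map_infinity_nf:
  assumes d: "nf_data n h (1 / 2) (1 / 2) b"
  shows "phi_map n (line (nf h (1 / 2) (1 / 2) b)) = - (h (mk 0 1 0 0 0 0) - (1 / 3) *\<^sub>R one_mat)"
proof -
  have h: "h \<in> rotations n" using d by (simp add: nf_data_def)
  obtain s where s: "s > 0" "phi_map n (line (nf h (1 / 2) (1 / 2) b)) = s *\<^sub>R h (mk (1/2 - 1 / 3) (- 1 / 3) (1/2 - 1 / 3) 0 0 0)"
    "s\<^sup>2 * (2 / 3 - 2 * (1/2 * (1/2))) = 2 / 3" using phi_map_nf[OF d] by metis
  have "s\<^sup>2 = 2\<^sup>2" using s(3) by simp
  then have "s = 2" by (rule power2_eq_imp_eq) (use s(1) in simp_all)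
  \<comment> \<open>The eigenvalues 1/6, -1/3, 1/6 are half those of the antipode of a shifted
    idempotent, which is why the normalizing factor is 2.\<close>
  have "2 *\<^sub>R mk (1/2 - 1 / 3) (- 1 / 3) (1/2 - 1 / 3) 0 0 0 = - (mk 0 1 0 0 0 0 - (1 / 3) *\<^sub>R one_mat)"
    by (simp add: one_mat_mk mk_arith)
  from arg_cong[OF this, of h] show ?thesis
    unfolding s(2) \<open>s = 2\<close>
    by (simp add: linear_diff[OF linear_rotations[OF h]] linear_scale[OF linear_rotations[OF h]]
        linear_neg[OF linear_rotations[OF h]] rotations_one[OF h])
qed

lemma infinity_points_nf: "nf_data n h \<alpha> \<beta> b \<Longrightarrow> line (nf h \<alpha> \<beta> b) \<in> infinity_points n \<longleftrightarrow> \<alpha> = \<beta>"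
proof
  assume d: "nf_data n h \<alpha> \<beta> b" and "line (nf h \<alpha> \<beta> b) \<in> infinity_points n"
  then obtain Z where Z: "line (nf h \<alpha> \<beta> b) = line Z" "trC Z = 0" by (auto simp: infinity_points_def)
  have "nf h \<alpha> \<beta> b \<noteq> 0" using norm_nf[OF d] by auto
  then obtain c where "nf h \<alpha> \<beta> b = cscale c Z" using line_eqD[OF Z(1)] by metis
  then have "trC (nf h \<alpha> \<beta> b) = 0" by (simp add: trC_cscale Z(2))
  then have "complex_of_real (\<alpha> - \<beta>) = of_real 0" using trC_nf[OF d] by simp
  then show "\<alpha> = \<beta>" unfolding of_real_eq_iff by simp
next
  assume d: "nf_data n h \<alpha> \<beta> b" and "\<alpha> = \<beta>"
  then have "trC (nf h \<alpha> \<beta> b) = 0" using trC_nf[OF d] by simp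
  then show "line (nf h \<alpha> \<beta> b) \<in> infinity_points n" using line_nf_planeC[OF d] unfolding infinity_points_def by blast
qed

lemma phi_map_infinity_points:
  assumes n: "n \<le> 3"
  shows "phi_map n ` infinity_points n = uminus ` plane_tilde n"
proof
  show "phi_map n ` infinity_points n \<subseteq> uminus ` plane_tilde n"
  proof
    fix y assume "y \<in> phi_map n ` infinity_points n"
    then obtain p where p: "p \<in> infinity_points n" "y = phi_map n p" by blast
    then have "p \<in> planeC n" by (auto simp: infinity_points_def)
    then obtain h \<alpha> \<beta> b where d: "nf_data n h \<alpha> \<beta> b" "p = line (nf h \<alpha> \<beta> b)" using planeC_nf by metis
    have "\<alpha> = \<beta>" using infinity_points_nf[OF d(1)] p(1) d(2) by simp
    then have "\<alpha> = 1 / 2" "\<beta> = 1 / 2" using d(1) by (simp_all add: nf_data_def)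
    note ab = this
    have y: "y = - (h (mk 0 1 0 0 0 0) - (1 / 3) *\<^sub>R one_mat)"
      unfolding p(2) d(2) ab by (rule phi_map_infinity_nf[OF d(1)[unfolded ab]])
    have "mk 0 1 0 0 0 0 \<in> idem1 n" by (simp add: idem1_def jprod_mk)
    then have "h (mk 0 1 0 0 0 0) \<in> idem1 n" using d(1) by (intro idem1_rotations[of h]) (simp_all add: nf_data_def)
    then show "y \<in> uminus ` plane_tilde n" unfolding y plane_tilde_idem1[OF n] by blast
  qed
  show "uminus ` plane_tilde n \<subseteq> phi_map n ` infinity_points n"
  proof
    fix y assume "y \<in> uminus ` plane_tilde n"
    then obtain X where X: "X \<in> idem1 n" "y = - (X - (1 / 3) *\<^sub>R one_mat)" unfolding plane_tilde_idem1[OF n] by blast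
    obtain k where k: "k \<in> rotations n" "k X = E_mat" using idem1_transitive[OF X(1)] by metis
    obtain h where h: "h \<in> rotations n" "\<And>X. X \<in> Herm n \<Longrightarrow> h (k X) = X" using rotations_inverse[OF k(1)] by metis
    have c: "(\<lambda>X. h (cyc X)) \<in> rotations n" by (rule rotations_comp[OF h(1) rotations_cyc[OF rotations_id]])
    have "h E_mat = X" using h(2)[of X] k(2) X(1) by (simp add: idem1_def)
    then have e: "h (cyc (mk 0 1 0 0 0 0)) = X" by (simp add: E_mat_mk)
    \<comment> \<open>Any entry of norm 1/2 would serve, as \<open>\<alpha> \<beta> = 1/4\<close>; a
      real one lies in every algebra. The shift by \<open>cyc\<close> puts the distinguished
      idempotent in the middle position.\<close>
    have d: "nf_data n (\<lambda>X. h (cyc X)) (1 / 2) (1 / 2) (oreal (1 / 2))"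
      using c by (simp add: nf_data_def power2_eq_square)
    have "y = phi_map n (line (nf (\<lambda>X. h (cyc X)) (1 / 2) (1 / 2) (oreal (1 / 2))))"
      unfolding phi_map_infinity_nf[OF d] X(2) e ..
    then show "y \<in> phi_map n ` infinity_points n" using infinity_points_nf[OF d] by blast
  qed
qed

text \<open>The exceptional points are recognized by their images. Hence the total space is a full
  preimage of the base, and properness restricts to it.\<close>

lemma generic_points:
  assumes n: "n \<le> 3"
  shows "planeC n - (real_points n \<union> infinity_points n) = {p \<in> planeC n. phi_map n p \<in> plane_base n}"
    and "p \<in> planeC n \<Longrightarrow> phi_map n p \<in> plane_base n \<Longrightarrow>
      \<exists>h \<alpha> \<beta> b. nf_data n h \<alpha> \<beta> b \<and> \<alpha> > \<beta> \<and> \<beta> > 0 \<and> p = line (nf h \<alpha> \<beta> b)"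
proof -
  have real: "phi_map n p \<notin> plane_base n" if "p \<in> real_points n" for p
    using that phi_map_real_point(2) n
    by (auto simp: real_points_def plane_base_def plane_tilde_def proj_plane_idem1)
  have inf: "phi_map n p \<notin> plane_base n" if "p \<in> infinity_points n" for p
    using that phi_map_infinity_points[OF n] by (auto simp: plane_base_def)
  have gen: "\<exists>h \<alpha> \<beta> b. nf_data n h \<alpha> \<beta> b \<and> \<alpha> > \<beta> \<and> \<beta> > 0 \<and> p = line (nf h \<alpha> \<beta> b)"
    if p: "p \<in> planeC n" "p \<notin> real_points n" "p \<notin> infinity_points n" for p
  proof -
    obtain h \<alpha> \<beta> b where d: "nf_data n h \<alpha> \<beta> b" "\<alpha> \<ge> \<beta>" "\<beta> \<ge> 0" "p = line (nf h \<alpha> \<beta> b)" using planeC_nf[OF p(1)] .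
    have "\<alpha> \<noteq> \<beta>" using infinity_points_nf[OF d(1)] p(3) d(4) by simp
    moreover have "\<beta> \<noteq> 0"
    proof
      assume "\<beta> = 0"
      then have b: "\<alpha> = 1" "b = 0" "h \<in> rotations n" using d(1) by (simp_all add: nf_data_def)
      have "h E_mat \<in> idem1 n" by (rule idem1_rotations[OF b(3) E_mat_idem1])
      moreover have "p = line (h E_mat, 0)"
        using d(4) b \<open>\<beta> = 0\<close> linear_0[OF linear_rotations[OF b(3)]] by (simp add: nf_def E_mat_mk mk_zero)
      ultimately have "p \<in> real_points n" using n by (auto simp: real_points_def proj_plane_idem1)
      with p(2) show False by blast
    qed
    ultimately have "\<alpha> > \<beta>" "\<beta> > 0" using d by simp_all
    then show ?thesis using d by blast
  qed
  show "planeC n - (real_points n \<union> infinity_points n) = {p \<in> planeC n. phi_map n p \<in> plane_base n}"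
  proof (intro set_eqI iffI)
    fix p assume p: "p \<in> planeC n - (real_points n \<union> infinity_points n)"
    then obtain h \<alpha> \<beta> b where d: "nf_data n h \<alpha> \<beta> b" "\<alpha> > \<beta>" "\<beta> > 0" "p = line (nf h \<alpha> \<beta> b)"
      using gen by blast
    have "phi_map n p \<in> plane_base n" unfolding d(4) by (rule phi_map_nf_base[OF n d(1-3)])
    then show "p \<in> {p \<in> planeC n. phi_map n p \<in> plane_base n}" using p by blast
  next
    fix p assume "p \<in> {p \<in> planeC n. phi_map n p \<in> plane_base n}"
    then show "p \<in> planeC n - (real_points n \<union> infinity_points n)" using real inf by blast
  qed
  show "\<exists>h \<alpha> \<beta> b. nf_data n h \<alpha> \<beta> b \<and> \<alpha> > \<beta> \<and> \<beta> > 0 \<and> p = line (nf h \<alpha> \<beta> b)"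
    if "p \<in> planeC n" "phi_map n p \<in> plane_base n"
    using gen real inf that by blast
qed

section \<open>The fibration\<close>

text \<open>If two eigenvalues coincide, trace zero and the radius force the point into
  \<open>plane_tilde n\<close> or its antipode. The smallest eigenvalue is placed in the middle to
  match the normal form.\<close>

lemma base_frame:
  assumes n: "n \<le> 3" and y: "y \<in> plane_base n"
  obtains g h p q r where "g \<in> rotations n" "h \<in> rotations n" "\<And>X. X \<in> Herm n \<Longrightarrow> h (g X) = X"
    "\<And>X. X \<in> Herm n \<Longrightarrow> g (h X) = X" "g y = mk p q r 0 0 0" "p > r" "r > q" "p + q + r = 0"
    "p\<^sup>2 + q\<^sup>2 + r\<^sup>2 = 2 / 3"
proof -
  have yH: "y \<in> Herm n" "tr y = 0" "norm y = rho" and yt: "y \<notin> plane_tilde n" "y \<notin> uminus ` plane_tilde n"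
    using y by (auto simp: plane_base_def Herm_sphere_def Herm_tr_def)
  obtain k x1 x2 x3 where k: "k \<in> rotations n" "k y = mk x1 x2 x3 0 0 0" "x1 \<ge> x2" "x2 \<ge> x3"
    using spectral[OF yH(1)] by metis
  obtain k' where k': "k' \<in> rotations n" "\<And>X. X \<in> Herm n \<Longrightarrow> k' (k X) = X" using rotations_inverse[OF k(1)] by metis
  have yk: "y = k' (mk x1 x2 x3 0 0 0)" using k'(2)[OF yH(1)] k(2) by simp
  note l = linear_rotations[OF k'(1)]
  have sum: "x1 + x2 + x3 = 0" using rotations_tr[OF k(1) yH(1)] yH(2) k(2) by simp
  have "(norm (k y))\<^sup>2 = 2 / 3" using norm_rotations[OF k(1) yH(1)] yH(3) rho_sq by simp
  then have sq: "x1\<^sup>2 + x2\<^sup>2 + x3\<^sup>2 = 2 / 3" unfolding k(2) norm_mk by simp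
  have one: "k' (X - (1 / 3) *\<^sub>R one_mat) = k' X - (1 / 3) *\<^sub>R one_mat" for X
    by (simp add: linear_diff[OF l] linear_scale[OF l] rotations_one[OF k'(1)])
  have ne12: "x1 \<noteq> x2"
  proof
    assume e: "x1 = x2"
    have x3: "x3 = - 2 * x2" using sum e by simp
    have "x2\<^sup>2 = (1 / 3)\<^sup>2" using sq e x3 by (simp add: power2_eq_square)
    moreover have "x2 \<ge> 0" using k(4) x3 by simp
    ultimately have "x2 = 1 / 3" by (intro power2_eq_imp_eq[of x2 "1/3"]) simp_all
    then have "mk x1 x2 x3 0 0 0 = - (mk 0 0 1 0 0 0 - (1 / 3) *\<^sub>R one_mat)"
      using e x3 by (simp add: one_mat_mk mk_arith)
    then have "y = - (k' (mk 0 0 1 0 0 0) - (1 / 3) *\<^sub>R one_mat)"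
      unfolding yk using one by (simp add: linear_neg[OF l] del: minus_diff_eq)
    moreover have "k' (mk 0 0 1 0 0 0) \<in> idem1 n"
      by (rule idem1_rotations[OF k'(1)]) (simp add: idem1_def jprod_mk)
    ultimately show False using yt(2) unfolding plane_tilde_idem1[OF n] by blast
  qed
  have ne23: "x2 \<noteq> x3"
  proof
    assume e: "x2 = x3"
    have x1: "x1 = - 2 * x2" using sum e by simp
    have "x2\<^sup>2 = (1 / 3)\<^sup>2" using sq e x1 by (simp add: power2_eq_square)
    then have "(- x2)\<^sup>2 = (1 / 3)\<^sup>2" by simp
    moreover have "- x2 \<ge> 0" using k(3) x1 by simp
    ultimately have "- x2 = 1 / 3" by (intro power2_eq_imp_eq[of "- x2" "1/3"]) simp_all
    then have "x2 = - 1 / 3" by simp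
    then have "mk x1 x2 x3 0 0 0 = mk 1 0 0 0 0 0 - (1 / 3) *\<^sub>R one_mat"
      using e x1 by (simp add: one_mat_mk mk_arith)
    then have "y = k' (mk 1 0 0 0 0 0) - (1 / 3) *\<^sub>R one_mat" unfolding yk using one by simp
    moreover have "k' (mk 1 0 0 0 0 0) \<in> idem1 n"
      by (rule idem1_rotations[OF k'(1)]) (simp add: idem1_def jprod_mk)
    ultimately show False using yt(1) unfolding plane_tilde_idem1[OF n] by blast
  qed
  \<comment> \<open>A quarter turn, shifted by \<open>cyc\<close>, interchanges the last two
    diagonal entries.\<close>
  have u: "oreal 1 \<in> unit_elements n" by (simp add: unit_elements_def)
  define w where "w = (\<lambda>X. cyc (cyc (rot (pi / 2) (oreal 1) (cyc X))))"
  have w: "w \<in> rotations n" unfolding w_def by (intro rotations.intros u)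
  have "w (mk x1 x2 x3 0 0 0) = mk x1 x3 x2 0 0 0" by (simp add: w_def rot_mk field_simps)
  then have wk: "w (k y) = mk x1 x3 x2 0 0 0" unfolding k(2) .
  have c: "(\<lambda>X. w (k X)) \<in> rotations n" by (rule rotations_comp[OF w k(1)])
  obtain h where h: "h \<in> rotations n" "\<And>X. X \<in> Herm n \<Longrightarrow> h (w (k X)) = X" "\<And>X. X \<in> Herm n \<Longrightarrow> w (k (h X)) = X"
    using rotations_inverse[OF c] by metis
  show thesis
    by (rule that[OF c h wk]) (use k ne12 ne23 sum sq in auto)
qed

text \<open>Three distinct numbers among the roots 0, \<open>\<alpha>\<close>,
  \<open>\<beta>\<close> exhaust them, and the order fixes which is which.\<close>

lemma cubic_roots:
  fixes \<alpha> \<beta> q1 q2 q3 :: real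
  assumes "\<alpha> + \<beta> = 1" "\<alpha> \<ge> \<beta>" "\<beta> \<ge> 0" "q1 > q3" "q3 > q2"
    and "\<And>q. q \<in> {q1, q2, q3} \<Longrightarrow> q * q\<^sup>2 - q\<^sup>2 + \<alpha> * \<beta> * q = 0"
  shows "q1 = \<alpha>" "q2 = 0" "q3 = \<beta>"
proof -
  have r: "q = 0 \<or> q = \<alpha> \<or> q = \<beta>" if "q \<in> {q1, q2, q3}" for q
  proof -
    have "q * ((q - \<alpha>) * (q - \<beta>)) = q * q\<^sup>2 - (\<alpha> + \<beta>) * q\<^sup>2 + \<alpha> * \<beta> * q"
      by (simp add: power2_eq_square algebra_simps)
    also have "\<dots> = 0" using assms(6)[OF that] assms(1) by simp
    finally show ?thesis by auto
  qed
  have "q1 = 0 \<or> q1 = \<alpha> \<or> q1 = \<beta>" "q2 = 0 \<or> q2 = \<alpha> \<or> q2 = \<beta>" "q3 = 0 \<or> q3 = \<alpha> \<or> q3 = \<beta>" by (intro r; simp)+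
  then show "q1 = \<alpha>" "q2 = 0" "q3 = \<beta>" using assms(1-5) by auto
qed

text \<open>Any ordered eigenframe of the image, not merely the frame from which the normal form was
  obtained, puts the point into normal form. Hence all points of one fibre are described in one
  common frame and differ only in \<open>b\<close>.\<close>

lemma fibre_nf:
  assumes g: "g \<in> rotations n" and h: "h \<in> rotations n" and hg: "\<And>X. X \<in> Herm n \<Longrightarrow> h (g X) = X"
    and p: "p \<in> planeC n" and gy: "g (phi_map n p) = mk x y z 0 0 0" and xyz: "x > z" "z > y"
  obtains b where "nf_data n h (1 / 3 - x / (3 * y)) (1 / 3 - z / (3 * y)) b" "p = line (nf h (1 / 3 - x / (3 * y)) (1 / 3 - z / (3 * y)) b)"
    "1 / 3 - z / (3 * y) > 0" "1 / 3 - x / (3 * y) > 1 / 3 - z / (3 * y)"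
proof -
  obtain h' \<alpha> \<beta> b' where d: "nf_data n h' \<alpha> \<beta> b'" "\<alpha> \<ge> \<beta>" "\<beta> \<ge> 0" "p = line (nf h' \<alpha> \<beta> b')" using planeC_nf[OF p] .
  have h': "h' \<in> rotations n" "b' \<in> Alg n" "\<alpha> + \<beta> = 1" "(norm b')\<^sup>2 = \<alpha> * \<beta>" using d(1) by (simp_all add: nf_data_def)
  note l = linear_rotations[OF g] and l' = linear_rotations[OF h'(1)]
  define X Y Q where "X = h' (mk \<alpha> 0 (- \<beta>) 0 0 0)" and "Y = h' (mk 0 0 0 0 b' 0)" and "Q = h' (mk \<alpha> 0 \<beta> 0 0 0)"
  have H: "X \<in> Herm n" "Y \<in> Herm n" "Q \<in> Herm n"
    unfolding X_def Y_def Q_def using h' by (simp_all add: rotations_mk_Herm)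
  obtain t where t: "t > 0" "phi_map n p = t *\<^sub>R h' (mk (\<alpha> - 1 / 3) (- 1 / 3) (\<beta> - 1 / 3) 0 0 0)"
    using phi_map_nf[OF d(1)] d(4) by metis
  define s where "s = 1 / t"
  have s: "s > 0" using t by (simp add: s_def)
  have "mk (\<alpha> - 1 / 3) (- 1 / 3) (\<beta> - 1 / 3) 0 0 0 = mk \<alpha> 0 \<beta> 0 0 0 - (1 / 3) *\<^sub>R one_mat"
    by (simp add: one_mat_mk mk_arith)
  then have "phi_map n p = t *\<^sub>R (Q - (1 / 3) *\<^sub>R one_mat)"
    unfolding t(2) Q_def by (simp add: linear_diff[OF l'] linear_scale[OF l'] rotations_one[OF h'(1)])
  then have "Q = s *\<^sub>R phi_map n p + (1 / 3) *\<^sub>R one_mat" using t(1) by (simp add: s_def)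
  then have "g Q = s *\<^sub>R mk x y z 0 0 0 + (1 / 3) *\<^sub>R one_mat"
    by (simp add: linear_add[OF l] linear_scale[OF l] gy rotations_one[OF g])
  then have gQ: "g Q = mk (s * x + 1 / 3) (s * y + 1 / 3) (s * z + 1 / 3) 0 0 0"
    by (simp add: one_mat_mk mk_arith)
  define q1 q2 q3 where "q1 = s * x + 1 / 3" and "q2 = s * y + 1 / 3" and "q3 = s * z + 1 / 3"
  note gQ' = gQ[folded q1_def q2_def q3_def]
  have ab: "\<alpha>\<^sup>2 = \<alpha> - \<alpha> * \<beta>" "\<beta>\<^sup>2 = \<beta> - \<alpha> * \<beta>"
  proof -
    have "\<alpha>\<^sup>2 = \<alpha> * (\<alpha> + \<beta>) - \<alpha> * \<beta>" "\<beta>\<^sup>2 = \<beta> * (\<alpha> + \<beta>) - \<alpha> * \<beta>" by (simp_all add: power2_eq_square algebra_simps)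
    then show "\<alpha>\<^sup>2 = \<alpha> - \<alpha> * \<beta>" "\<beta>\<^sup>2 = \<beta> - \<alpha> * \<beta>" by (simp_all add: h'(3))
  qed
  \<comment> \<open>The cubic equation of \<open>Q\<close> is independent of the frame, so it
    carries the eigenvalues over without any comparison of the two frames.\<close>
  have cub: "jprod (g Q) (jprod (g Q) (g Q)) - jprod (g Q) (g Q) + (\<alpha> * \<beta>) *\<^sub>R g Q = 0"
  proof -
    let ?A = "mk \<alpha> 0 \<beta> 0 0 0"
    have "jprod ?A (jprod ?A ?A) - jprod ?A ?A + (\<alpha> * \<beta>) *\<^sub>R ?A = 0"
      by (simp add: jprod_mk_self jprod_mk mk_arith ab algebra_simps)
        (simp add: ab power2_eq_square[symmetric] algebra_simps)?
    from arg_cong[OF this, of h'] have "jprod Q (jprod Q Q) - jprod Q Q + (\<alpha> * \<beta>) *\<^sub>R Q = 0"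
      unfolding Q_def by (simp add: linear_add[OF l'] linear_diff[OF l'] linear_scale[OF l'] linear_0[OF l']
          rotations_jprod[OF h'(1)] jprod_Herm del: mk_eq_0_iff)
    from arg_cong[OF this, of g] show ?thesis
      using H(3) by (simp add: linear_add[OF l] linear_diff[OF l] linear_scale[OF l] linear_0[OF l]
          rotations_jprod[OF g] jprod_Herm)
  qed
  have roots: "q * q\<^sup>2 - q\<^sup>2 + \<alpha> * \<beta> * q = 0" if "q \<in> {q1, q2, q3}" for q
    using cub that unfolding gQ' jprod_mk_self jprod_mk mk_arith mk_eq_0_iff by auto
  have "q1 > q3" "q3 > q2" using xyz s by (simp_all add: q1_def q2_def q3_def)
  note q = cubic_roots[OF h'(3) d(2,3) this roots]
  have pos: "\<beta> > 0" "\<alpha> > \<beta>" using q \<open>q1 > q3\<close> \<open>q3 > q2\<close> by simp_all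
  \<comment> \<open>The middle eigenvalue of \<open>Q\<close> is 0; this determines the unknown
    scale and explains the denominators \<open>3 * y\<close>.\<close>
  have "s * y = - 1 / 3" using q(2) unfolding q2_def by simp
  then have "y \<noteq> 0" "s * (3 * y) = - 1" by auto
  then have "s = - 1 / (3 * y)" using nonzero_eq_divide_eq[of "3 * y" s "- 1"] by simp
  then have al: "\<alpha> = 1 / 3 - x / (3 * y)" "\<beta> = 1 / 3 - z / (3 * y)"
    using q(1,3) unfolding q1_def q3_def by (simp_all add: field_simps)
  have gQ2: "g Q = mk \<alpha> 0 \<beta> 0 0 0" using gQ' q by simp
  have aa: "2 * \<alpha>\<^sup>2 - \<alpha> = (\<alpha> - \<beta>) * \<alpha>" "2 * \<beta>\<^sup>2 - \<beta> = (\<alpha> - \<beta>) * (- \<beta>)"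
    by (simp_all only: ab) (simp_all add: algebra_simps power2_eq_square[symmetric] ab)
  \<comment> \<open>\<open>X\<close> is a polynomial in \<open>Q\<close>, hence determined by the
    image and diagonal in the same frame.\<close>
  have rel: "2 *\<^sub>R jprod (mk \<alpha> 0 \<beta> 0 0 0) (mk \<alpha> 0 \<beta> 0 0 0) - mk \<alpha> 0 \<beta> 0 0 0 = (\<alpha> - \<beta>) *\<^sub>R mk \<alpha> 0 (- \<beta>) 0 0 0"
    using aa by (simp add: jprod_mk_self mk_arith)
  from arg_cong[OF this, of h'] have "2 *\<^sub>R jprod Q Q - Q = (\<alpha> - \<beta>) *\<^sub>R X"
    unfolding Q_def X_def by (simp add: linear_diff[OF l'] linear_scale[OF l'] rotations_jprod[OF h'(1)])
  from arg_cong[OF this, of g] have "2 *\<^sub>R jprod (g Q) (g Q) - g Q = (\<alpha> - \<beta>) *\<^sub>R g X"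
    using H by (simp add: linear_diff[OF l] linear_scale[OF l] rotations_jprod[OF g])
  then have gX: "g X = mk \<alpha> 0 (- \<beta>) 0 0 0"
    unfolding gQ2 rel using pos by simp
  \<comment> \<open>\<open>Y\<close> is an eigenvector of the multiplication by \<open>X\<close>,
    and for these eigenvalues only the Peirce space at the position 31 is possible.\<close>
  have "2 *\<^sub>R jprod (mk \<alpha> 0 (- \<beta>) 0 0 0) (mk 0 0 0 0 b' 0) = (\<alpha> - \<beta>) *\<^sub>R mk 0 0 0 0 b' 0"
    by (simp add: jprod_mk mk_arith)
  from arg_cong[OF this, of h'] have "2 *\<^sub>R jprod X Y = (\<alpha> - \<beta>) *\<^sub>R Y"
    unfolding X_def Y_def using h'(2) by (simp add: linear_scale[OF l'] rotations_jprod[OF h'(1)])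
  from arg_cong[OF this, of g] have XY: "2 *\<^sub>R jprod (g X) (g Y) = (\<alpha> - \<beta>) *\<^sub>R g Y"
    using H by (simp add: linear_scale[OF l] rotations_jprod[OF g])
  obtain y1 y2 y3 a b c where gY: "g Y = mk y1 y2 y3 a b c" "b \<in> Alg n"
    using rotations_Herm[OF g H(2)] by (rule Herm_cases)
  have e: "2 * (\<alpha> * y1) = (\<alpha> - \<beta>) * y1" "(\<alpha> - \<beta>) * y2 = 0" "2 * (- \<beta> * y3) = (\<alpha> - \<beta>) * y3"
    "(- \<beta>) *\<^sub>R a = (\<alpha> - \<beta>) *\<^sub>R a" "\<alpha> *\<^sub>R c = (\<alpha> - \<beta>) *\<^sub>R c"
    using XY unfolding gX gY(1) jprod_mk mk_arith mk_eq_iff by simp_all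
  have "(\<alpha> + \<beta>) * y1 = 0" "(\<alpha> + \<beta>) * y3 = 0" "\<alpha> *\<^sub>R a = 0" "\<beta> *\<^sub>R c = 0"
    using e by (simp_all add: algebra_simps)
  then have z: "y1 = 0" "y2 = 0" "y3 = 0" "a = 0" "c = 0" using pos e(2) h'(3) by simp_all
  have "inner (g Y) (g Y) = inner (mk 0 0 0 0 b' 0) (mk 0 0 0 0 b' 0)"
    unfolding rotations_inner[OF g H(2,2)] unfolding Y_def using h'(2) by (intro rotations_inner[OF h'(1)]) simp_all
  then have "inner b b = inner b' b'" unfolding gY(1) z by (simp add: inner_mk)
  then have nb: "(norm b)\<^sup>2 = \<alpha> * \<beta>" using h'(4) by (simp add: power2_norm_eq_inner)
  have "nf h' \<alpha> \<beta> b' = nf h \<alpha> \<beta> b"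
    using hg[OF H(1)] hg[OF H(2)] unfolding gX gY(1) z by (simp add: nf_def X_def Y_def)
  then show thesis
    using that[of b] pos h gY(2) h'(3) nb d(4) unfolding al[symmetric] by (simp add: nf_data_def)
qed

text \<open>The image is a positive multiple of \<open>y\<close>, and both lie on the sphere of
  radius \<open>rho\<close>.\<close>

lemma phi_map_fibre:
  assumes h: "h \<in> rotations n" and y: "h (g y) = y" and gy: "g y = mk x1 x2 x3 0 0 0" and sm: "x1\<^sup>2 + x2\<^sup>2 + x3\<^sup>2 = 2 / 3"
    and d: "nf_data n h (1 / 3 - x1 / (3 * x2)) (1 / 3 - x3 / (3 * x2)) b" and neg: "x2 < 0"
  shows "phi_map n (line (nf h (1 / 3 - x1 / (3 * x2)) (1 / 3 - x3 / (3 * x2)) b)) = y"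
proof -
  define \<alpha> \<beta> where "\<alpha> = 1 / 3 - x1 / (3 * x2)" and "\<beta> = 1 / 3 - x3 / (3 * x2)"
  note d' = d[folded \<alpha>_def \<beta>_def]
  note l = linear_rotations[OF h]
  obtain s where s: "s > 0" "phi_map n (line (nf h \<alpha> \<beta> b)) = s *\<^sub>R h (mk (\<alpha> - 1 / 3) (- 1 / 3) (\<beta> - 1 / 3) 0 0 0)"
    using phi_map_nf[OF d'] by metis
  define u where "u = - 1 / (3 * x2)"
  have u: "u > 0" using neg by (simp add: u_def divide_neg_neg)
  have "mk (\<alpha> - 1 / 3) (- 1 / 3) (\<beta> - 1 / 3) 0 0 0 = u *\<^sub>R mk x1 x2 x3 0 0 0"
    using neg by (simp add: \<alpha>_def \<beta>_def u_def mk_scaleR)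
  then have "phi_map n (line (nf h \<alpha> \<beta> b)) = (s * u) *\<^sub>R y"
    unfolding s(2) using y gy by (simp add: linear_scale[OF l])
  moreover have "norm y = rho"
  proof -
    have "(norm y)\<^sup>2 = (norm (mk x1 x2 x3 0 0 0))\<^sup>2" using y gy norm_rotations[OF h, of "mk x1 x2 x3 0 0 0"] by simp
    also have "\<dots> = rho\<^sup>2" unfolding norm_mk rho_sq using sm by simp
    finally show ?thesis by (rule power2_eq_imp_eq) (use rho_pos in simp_all)
  qed
  moreover have "norm (phi_map n (line (nf h \<alpha> \<beta> b))) = rho"
    using phi_map_Herm_sphere[OF line_nf_planeC[OF d']] by (simp add: Herm_sphere_def)
  ultimately have "(s * u) * rho = rho" using s(1) u by simp
  then have "s * u = 1" using rho_pos by simp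
  then show ?thesis
    using \<open>phi_map n (line (nf h \<alpha> \<beta> b)) = (s * u) *\<^sub>R y\<close> unfolding \<alpha>_def \<beta>_def by simp
qed


lemma complexify_line:
  assumes g: "linear_within (Herm n) g" and Z: "Z \<in> HermC n"
  shows "complexify g ` line Z = line (complexify g Z)"
proof -
  have "complexify g (cscale c Z) = cscale c (complexify g Z)" for c
    using Z by (elim HermC_cases)
      (simp add: linear_withinD[OF g] linear_within_diff[OF g subspace_Herm] Herm_scaleR)
  then show ?thesis by (simp add: line_def image_image)
qed

text \<open>The plane is given by equations in Jordan product and trace, and
  \<open>sigma_map\<close> by the same operations, so every automorphism respects them; it need not
  first be placed inside \<open>Ghat n\<close>.\<close>

lemma phi_map_equivariant:
  assumes g: "g \<in> Aut_J n" and p: "p \<in> planeC n"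
  shows "complexify g ` p \<in> planeC n" "phi_map n (complexify g ` p) = g (phi_map n p)"
proof -
  note a = Aut_JD[OF g]
  note l = linear_withinD[OF a(1)] linear_within_diff[OF a(1) subspace_Herm]
  obtain Z where Z: "Z \<in> orbit_cone n" "p = line Z" using p by (auto simp: planeC_orbit_cone)
  then have H: "Z \<in> HermC n" "Z \<noteq> 0" "freudC Z = 0" by (simp_all add: orbit_cone_iff)
  obtain X Y where XY: "Z = (X, Y)" "X \<in> Herm n" "Y \<in> Herm n" using H(1) by (rule HermC_cases)
  have im: "complexify g ` p = line (g X, g Y)" using complexify_line[OF a(1) H(1)] Z(2) XY(1) by simp
  have "jprod X X - jprod Y Y = tr X *\<^sub>R X - tr Y *\<^sub>R Y" "2 *\<^sub>R jprod X Y = tr X *\<^sub>R Y + tr Y *\<^sub>R X"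
    using H(3) freudC_eq_0_iff[OF XY(2,3)] XY(1) by simp_all
  then have "g (jprod X X - jprod Y Y) = g (tr X *\<^sub>R X - tr Y *\<^sub>R Y)" "g (2 *\<^sub>R jprod X Y) = g (tr X *\<^sub>R Y + tr Y *\<^sub>R X)"
    by simp_all
  then have f: "freudC (g X, g Y) = 0"
    using XY by (subst freudC_eq_0_iff[of _ n]) (simp_all add: l a(3) jprod_Herm Herm_scaleR tr_Aut_J[OF g])
  have nm: "norm (g X, g Y) = norm Z"
    using XY by (simp add: norm_Pair norm_eq_sqrt_inner inner_Aut_J[OF g])
  then have "(g X, g Y) \<noteq> 0" using H(2) by (metis norm_eq_zero)
  then have W: "(g X, g Y) \<in> orbit_cone n" using f XY by (simp add: orbit_cone_iff l(1))
  then show "complexify g ` p \<in> planeC n" unfolding im planeC_orbit_cone by blast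
  have q: "quad Z \<in> Herm n" "g (quad Z) = quad (g X, g Y)"
    using XY by (simp_all add: quad_def l a(3) jprod_Herm Herm_add)
  have "g ((1 / 3) *\<^sub>R one_mat) = (1 / 3) *\<^sub>R one_mat"
    using l(3)[OF one_mat_Herm] Aut_J_one[OF g] by simp
  then have "g (sigma_fun Z) = sigma_fun (g X, g Y)"
    unfolding sigma_fun_def nm
    using q l(4)[of "(1 / (norm Z)\<^sup>2) *\<^sub>R quad Z" "(1 / 3) *\<^sub>R one_mat"] l(3)[OF q(1)] by (simp add: Herm_scaleR)
  then have sg: "sigma_map n (complexify g ` p) = g (sigma_map n p)"
    unfolding im unfolding Z(2) sigma_map_orbit_cone[OF W] sigma_map_orbit_cone[OF Z(1)] by simp
  have sH: "sigma_map n p \<in> Herm n"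
    unfolding Z(2) sigma_map_orbit_cone[OF Z(1)] sigma_fun_def by (simp add: Herm_diff Herm_scaleR q(1))
  show "phi_map n (complexify g ` p) = g (phi_map n p)"
    unfolding phi_map_def sg l(3)[OF sH] using inner_Aut_J[OF g sH sH] by (simp add: norm_eq_sqrt_inner)
qed

text \<open>The first projection of the paired map is proper and the target is Hausdorff, so the
  pair is itself proper, hence closed, and continuity of the inverse comes for free.\<close>

lemma proper_continuous_trivialization:
  assumes \<phi>: "proper_map X Y \<phi>" "continuous_map X Y \<phi>" and haus: "Hausdorff_space Y" "Hausdorff_space F"
    and \<psi>: "continuous_map X F \<psi>"
    and bij: "bij_betw (\<lambda>x. (\<phi> x, \<psi> x)) (topspace X) (topspace Y \<times> topspace F)"
  shows "homeomorphic_map X (prod_topology Y F) (\<lambda>x. (\<phi> x, \<psi> x))"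
proof (rule bijective_closed_imp_homeomorphic_map)
  show c: "continuous_map X (prod_topology Y F) (\<lambda>x. (\<phi> x, \<psi> x))"
    using \<phi>(2) \<psi> by (simp add: continuous_map_paired)
  show "closed_map X (prod_topology Y F) (\<lambda>x. (\<phi> x, \<psi> x))"
  proof (rule proper_imp_closed_map, rule proper_map_from_composition_right)
    show "Hausdorff_space (prod_topology Y F)" using haus by (simp add: Hausdorff_space_prod_topology)
    show "proper_map X Y (fst \<circ> (\<lambda>x. (\<phi> x, \<psi> x)))" using \<phi>(1) by (simp add: o_def)
  qed (rule c continuous_map_fst)+
  show "(\<lambda>x. (\<phi> x, \<psi> x)) ` topspace X = topspace (prod_topology Y F)" "inj_on (\<lambda>x. (\<phi> x, \<psi> x)) (topspace X)"
    using bij by (simp_all add: bij_betw_def)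
qed

text \<open>An injective endomorphism of \<open>V\<close> permutes its rays, and each of the two
  spheres meets every ray once.\<close>

lemma normalized_linear_bij:
  fixes T :: "'a::euclidean_space \<Rightarrow> 'a"
  assumes V: "subspace V" and T: "linear T" "T ` V \<subseteq> V" "\<And>v. v \<in> V \<Longrightarrow> v \<noteq> 0 \<Longrightarrow> T v \<noteq> 0" and r: "r > 0"
  shows "bij_betw (\<lambda>v. T v /\<^sub>R norm (T v)) {v \<in> V. norm v = r} {v \<in> V. norm v = 1}"
proof -
  have inj: "inj_on T V"
    by (rule inj_onI) (metis T(1,3) V eq_iff_diff_eq_0 linear_diff subspace_diff)
  have "dim (T ` V) = dim V"
    by (rule dim_image_eq[OF T(1)]) (use inj V in \<open>simp add: span_eq_iff[THEN iffD2]\<close>)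
  then have surj: "T ` V = V"
    by (intro subspace_dim_equal linear_subspace_image T V) simp
  show ?thesis
  proof (rule bij_betw_imageI)
    show "inj_on (\<lambda>v. T v /\<^sub>R norm (T v)) {v \<in> V. norm v = r}"
    proof (rule inj_onI)
      fix v w assume v: "v \<in> {v \<in> V. norm v = r}" and w: "w \<in> {v \<in> V. norm v = r}"
        and eq: "T v /\<^sub>R norm (T v) = T w /\<^sub>R norm (T w)"
      then have nz: "norm (T v) > 0" "norm (T w) > 0" using T(3) r by auto
      have "T v = norm (T v) *\<^sub>R (T w /\<^sub>R norm (T w))" using nz by (simp flip: eq)
      then have "T v = T ((norm (T v) / norm (T w)) *\<^sub>R w)" using T(1) by (simp add: linear_scale divide_inverse)
      then have vw: "v = (norm (T v) / norm (T w)) *\<^sub>R w"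
        using inj v w by (auto dest!: inj_onD simp: subspace_scale[OF V])
      define k where "k = norm (T v) / norm (T w)"
      have "norm v = k * norm w" unfolding k_def using vw nz by (metis abs_of_pos divide_pos_pos norm_scaleR)
      then have "k = 1" using v w r by simp
      then show "v = w" using vw unfolding k_def[symmetric] by simp
    qed
    show "(\<lambda>v. T v /\<^sub>R norm (T v)) ` {v \<in> V. norm v = r} = {v \<in> V. norm v = 1}"
    proof
      show "(\<lambda>v. T v /\<^sub>R norm (T v)) ` {v \<in> V. norm v = r} \<subseteq> {v \<in> V. norm v = 1}"
      proof (intro image_subsetI)
        fix v assume "v \<in> {v \<in> V. norm v = r}"
        then have "T v \<noteq> 0" "T v \<in> V" using T r by auto
        then show "T v /\<^sub>R norm (T v) \<in> {v \<in> V. norm v = 1}" by (simp add: subspace_scale[OF V])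
      qed
      show "{v \<in> V. norm v = 1} \<subseteq> (\<lambda>v. T v /\<^sub>R norm (T v)) ` {v \<in> V. norm v = r}"
      proof
        fix w assume w: "w \<in> {v \<in> V. norm v = 1}"
        then obtain v where v: "v \<in> V" "w = T v" using surj by (metis (mono_tags, lifting) imageE mem_Collect_eq)
        have "v \<noteq> 0" using v w linear_0[OF T(1)] by auto
        define v' where "v' = (r / norm v) *\<^sub>R v"
        have Tv: "T v' = (r / norm v) *\<^sub>R w" using v(2) T(1) by (simp add: v'_def linear_scale)
        then have "norm (T v') = r / norm v" using w r by simp
        then have "T v' /\<^sub>R norm (T v') = w" using Tv r \<open>v \<noteq> 0\<close> by simp
        moreover have "v' \<in> {v \<in> V. norm v = r}"
          using v(1) r \<open>v \<noteq> 0\<close> by (simp add: v'_def subspace_scale[OF V])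
        ultimately show "w \<in> (\<lambda>v. T v /\<^sub>R norm (T v)) ` {v \<in> V. norm v = r}" by force
      qed
    qed
  qed
qed


lemma proper_phi_map: "proper_map (planeC_top n) (top_of_set (Herm_sphere n)) (phi_map n)"
  by (rule continuous_imp_proper_map[OF compact_space_planeC _ continuous_phi_map])
    (intro Hausdorff_imp_kc_space Hausdorff_space_subtopology Hausdorff_space_euclidean)

lemma linear_corner: "linear (\<lambda>X :: omat. X $ 3 $ 1)"
  by (rule linearI) simp_all

theorem phi_map_fibration:
  assumes n: "n \<le> 3"
  shows "fibration_with_fibre (subtopology (planeC_top n) {p \<in> planeC n. phi_map n p \<in> plane_base n})
    (top_of_set (plane_base n)) (phi_map n) (top_of_set (unit_elements n))"
proof -
  define M where "M = {p \<in> planeC n. phi_map n p \<in> plane_base n}"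
  define XM where "XM = subtopology (planeC_top n) M"
  have topM: "topspace XM = M" by (auto simp: XM_def M_def)
  have base_sub: "plane_base n \<subseteq> Herm_sphere n" by (auto simp: plane_base_def)
  have sub: "subtopology (top_of_set (Herm_sphere n)) (plane_base n) = top_of_set (plane_base n)"
    using base_sub by (simp add: subtopology_subtopology Int_absorb1)
  have proper: "proper_map XM (top_of_set (plane_base n)) (phi_map n)"
    unfolding XM_def sub[symmetric] by (rule proper_map_restriction[OF proper_phi_map]) (simp add: M_def)
  have cont: "continuous_map XM (top_of_set (plane_base n)) (phi_map n)"
    using proper continuous_map_from_subtopology[OF continuous_phi_map, of n M]
    by (auto simp: XM_def continuous_map_in_subtopology M_def)
  have kcont: "continuous_map XM euclidean (kappa n)"
    unfolding XM_def by (rule continuous_map_from_subtopology[OF continuous_kappa])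
  have "\<exists>U. openin (top_of_set (plane_base n)) U \<and> y0 \<in> U \<and>
      (\<exists>k. homeomorphic_map (subtopology XM {x \<in> topspace XM. phi_map n x \<in> U})
              (prod_topology (subtopology (top_of_set (plane_base n)) U) (top_of_set (unit_elements n))) k \<and>
           (\<forall>x\<in>topspace XM. phi_map n x \<in> U \<longrightarrow> fst (k x) = phi_map n x))"
    if y0: "y0 \<in> plane_base n" for y0
  proof -
    obtain g0 h0 p0 q0 r0 where f0: "g0 \<in> rotations n" "h0 \<in> rotations n" "\<And>X. X \<in> Herm n \<Longrightarrow> h0 (g0 X) = X"
      "\<And>X. X \<in> Herm n \<Longrightarrow> g0 (h0 X) = X" "g0 y0 = mk p0 q0 r0 0 0 0" "p0 > r0" "r0 > q0"
      using base_frame[OF n y0] by metis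
    \<comment> \<open>The entry 31 in the frame of the base point; this frame stays fixed throughout
      the neighbourhood.\<close>
    define lc where "lc = (\<lambda>X. g0 X $ 3 $ 1)"
    have lin_l: "linear lc"
      unfolding lc_def using linear_compose[OF linear_rotations[OF f0(1)] linear_corner] by (simp add: o_def)
    have l_Alg: "lc X \<in> Alg n" if "X \<in> Herm n" for X
      using rotations_Herm[OF f0(1) that] unfolding lc_def by (simp add: Herm_def)
    have cont_l: "continuous_on S lc" for S
      using lin_l by (simp add: linear_continuous_on linear_conv_bounded_linear)
    have lk: "continuous_map XM euclidean (\<lambda>p. lc (kappa n p))"
      using continuous_map_compose[OF kcont, of euclidean lc] cont_l by (simp add: o_def)
    \<comment> \<open>The points where the projection to the fixed Peirce space degenerates.\<close>
    define Z where "Z = {p \<in> M. lc (kappa n p) = 0}"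
    have "closedin XM {p \<in> topspace XM. lc (kappa n p) \<in> {0}}"
      by (rule closedin_continuous_map_preimage[OF lk]) simp
    then have "closedin XM Z" unfolding topM Z_def by simp
    then have cl: "closedin (top_of_set (plane_base n)) (phi_map n ` Z)"
      using proper_imp_closed_map[OF proper] by (simp add: closed_map_def)
    \<comment> \<open>Removing the whole image, rather than a piece of the total space, leaves
      complete fibres; the image is closed because the map is proper.\<close>
    define U where "U = plane_base n - phi_map n ` Z"
    have openU: "openin (top_of_set (plane_base n)) U"
      unfolding U_def using cl openin_diff[OF openin_topspace cl] by simp
    have yU: "y0 \<in> U"
    proof -
      have "lc (kappa n p) \<noteq> 0" if p: "p \<in> M" "phi_map n p = y0" for p
      proof -
        have pC: "p \<in> planeC n" using p(1) by (simp add: M_def)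
        obtain b where b: "nf_data n h0 (1 / 3 - p0 / (3 * q0)) (1 / 3 - r0 / (3 * q0)) b"
          "p = line (nf h0 (1 / 3 - p0 / (3 * q0)) (1 / 3 - r0 / (3 * q0)) b)"
          "1 / 3 - r0 / (3 * q0) > 0" "1 / 3 - p0 / (3 * q0) > 1 / 3 - r0 / (3 * q0)"
          using fibre_nf[OF f0(1,2,3) pC _ f0(6,7)] f0(5) p(2) by metis
        define \<alpha> \<beta> where "\<alpha> = 1 / 3 - p0 / (3 * q0)" and "\<beta> = 1 / 3 - r0 / (3 * q0)"
        note b' = b[folded \<alpha>_def \<beta>_def]
        have bA: "b \<in> Alg n" "(norm b)\<^sup>2 = \<alpha> * \<beta>" using b'(1) by (simp_all add: nf_data_def)
        have "b \<noteq> 0" using bA(2) b'(3,4) by auto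
        have "lc (kappa n p) = (\<alpha> - \<beta>) *\<^sub>R b"
          unfolding b'(2) kappa_nf[OF b'(1)] linear_scale[OF lin_l] using f0(4)[of "mk 0 0 0 0 b 0"] bA(1) by (simp add: lc_def)
        then show ?thesis using \<open>b \<noteq> 0\<close> b'(4) by simp
      qed
      then show ?thesis using y0 by (auto simp: U_def Z_def)
    qed
    define W where "W = {x \<in> topspace XM. phi_map n x \<in> U}"
    have W: "W = {p \<in> planeC n. phi_map n p \<in> U}" unfolding W_def topM M_def U_def by auto
    have lnz: "lc (kappa n p) \<noteq> 0" if "p \<in> W" for p
      using that unfolding W_def topM U_def Z_def by blast
    define \<psi> where "\<psi> = (\<lambda>p. lc (kappa n p) /\<^sub>R norm (lc (kappa n p)))"
    define XW where "XW = subtopology XM W"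
    have topW: "topspace XW = W" unfolding XW_def W_def by auto
    have kH: "kappa n p \<in> Herm n" if p: "p \<in> planeC n" for p
    proof -
      obtain h \<alpha> \<beta> b where d: "nf_data n h \<alpha> \<beta> b" "p = line (nf h \<alpha> \<beta> b)" using planeC_nf[OF p] by metis
      then show ?thesis by (simp add: kappa_nf Herm_scaleR rotations_mk_Herm nf_data_def)
    qed
    have "continuous_map XW euclidean (\<lambda>p. lc (kappa n p))"
      unfolding XW_def by (rule continuous_map_from_subtopology[OF lk])
    then have lW: "continuous_map XW (top_of_set (- {0})) (\<lambda>p. lc (kappa n p))"
      using lnz by (auto simp: continuous_map_in_subtopology topW)
    have "continuous_on (- {0}) (\<lambda>v :: oct. v /\<^sub>R norm v)"
      by (intro continuous_on_scaleR continuous_on_inverse continuous_on_norm continuous_on_id) auto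
    then have "continuous_map (top_of_set (- {0})) euclidean (\<lambda>v :: oct. v /\<^sub>R norm v)" by simp
    from continuous_map_compose[OF lW this] have "continuous_map XW euclidean \<psi>" by (simp add: o_def \<psi>_def)
    moreover have psi_mem: "\<psi> p \<in> unit_elements n" if "p \<in> W" for p
      using that lnz[OF that] l_Alg[OF kH, of p] by (simp add: W \<psi>_def unit_elements_def Alg_scaleR)
    ultimately have psi: "continuous_map XW (top_of_set (unit_elements n)) \<psi>"
      by (auto simp: continuous_map_in_subtopology topW)
    have properW: "proper_map XW (subtopology (top_of_set (plane_base n)) U) (phi_map n)"
      unfolding XW_def by (rule proper_map_restriction[OF proper]) (simp add: W_def)
    have contW: "continuous_map XW (subtopology (top_of_set (plane_base n)) U) (phi_map n)"
      using continuous_map_from_subtopology[OF cont, of W]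
      unfolding XW_def continuous_map_in_subtopology[of _ "top_of_set (plane_base n)"] by (auto simp: W_def)
    have topU: "topspace (subtopology (top_of_set (plane_base n)) U) = U" by (auto simp: U_def)
    have fibre: "bij_betw \<psi> {p \<in> W. phi_map n p = y} (unit_elements n)" if y: "y \<in> U" for y
    proof -
      have yb: "y \<in> plane_base n" using y by (simp add: U_def)
      have yH: "y \<in> Herm n" using yb base_sub by (auto simp: Herm_sphere_def Herm_tr_def)
      obtain g h x1 x2 x3 where f: "g \<in> rotations n" "h \<in> rotations n" "\<And>X. X \<in> Herm n \<Longrightarrow> h (g X) = X"
        "\<And>X. X \<in> Herm n \<Longrightarrow> g (h X) = X" "g y = mk x1 x2 x3 0 0 0" "x1 > x3" "x3 > x2" "x1 + x2 + x3 = 0"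
        "x1\<^sup>2 + x2\<^sup>2 + x3\<^sup>2 = 2 / 3"
        using base_frame[OF n yb] by metis
      define \<alpha> \<beta> where "\<alpha> = 1 / 3 - x1 / (3 * x2)" and "\<beta> = 1 / 3 - x3 / (3 * x2)"
      have neg: "x2 < 0" using f(6-8) by linarith
      have ab: "\<beta> > 0" "\<alpha> > \<beta>" "\<alpha> + \<beta> = 1"
      proof -
        define u where "u = - 1 / (3 * x2)"
        have u: "u > 0" "u * x2 = - 1 / 3" using neg by (simp_all add: u_def divide_neg_neg)
        have ux: "\<alpha> = 1 / 3 + u * x1" "\<beta> = 1 / 3 + u * x3" by (simp_all add: \<alpha>_def \<beta>_def u_def)
        have "\<beta> = u * (x3 - x2)" "\<alpha> - \<beta> = u * (x1 - x3)" using u(2) by (simp_all add: ux algebra_simps)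
        moreover have "u * (x3 - x2) > 0" "u * (x1 - x3) > 0" using u(1) f(6,7) by simp_all
        ultimately show "\<beta> > 0" "\<alpha> > \<beta>" by linarith+
        have "\<alpha> + \<beta> = 2 / 3 + u * (x1 + x3)" by (simp add: ux algebra_simps)
        also have "x1 + x3 = - x2" using f(8) by simp
        finally show "\<alpha> + \<beta> = 1" using u(2) by simp
      qed
      \<comment> \<open>A linear comparison of the Peirce space at \<open>y\<close> with that at the
        base point, in coordinates of \<open>Alg n\<close>.\<close>
      define T where "T = (\<lambda>b. lc (h (mk 0 0 0 0 b 0)))"
      have linmk: "linear (\<lambda>b. mk 0 0 0 0 b 0)" by (rule linearI) (simp_all add: mk_arith)
      have linT: "linear T"
        unfolding T_def using linear_compose[OF linear_compose[OF linmk linear_rotations[OF f(2)]] lin_l] by (simp add: o_def)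
      have kap: "lc (kappa n (line (nf h \<alpha> \<beta> b))) = (\<alpha> - \<beta>) *\<^sub>R T b" if "nf_data n h \<alpha> \<beta> b" for b
        unfolding kappa_nf[OF that] linear_scale[OF lin_l] T_def ..
      define R where "R = {b \<in> Alg n. norm b = sqrt (\<alpha> * \<beta>)}"
      have R: "b \<in> R \<longleftrightarrow> nf_data n h \<alpha> \<beta> b" for b
      proof -
        have "norm b = sqrt (\<alpha> * \<beta>) \<longleftrightarrow> (norm b)\<^sup>2 = \<alpha> * \<beta>"
        proof
          assume "norm b = sqrt (\<alpha> * \<beta>)"
          then show "(norm b)\<^sup>2 = \<alpha> * \<beta>" using ab by simp
        next
          assume "(norm b)\<^sup>2 = \<alpha> * \<beta>"
          then show "norm b = sqrt (\<alpha> * \<beta>)" by (simp flip: \<open>(norm b)\<^sup>2 = \<alpha> * \<beta>\<close>)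
        qed
        then show ?thesis using f(2) ab by (auto simp: R_def nf_data_def)
      qed
      have phiR: "phi_map n (line (nf h \<alpha> \<beta> b)) = y" if "b \<in> R" for b
        unfolding \<alpha>_def \<beta>_def
        by (rule phi_map_fibre[where g = g, OF f(2) f(3)[OF yH] f(5,9) _ neg]) (use that R in \<open>simp_all add: \<alpha>_def \<beta>_def\<close>)
      have RW: "line (nf h \<alpha> \<beta> b) \<in> W" if "b \<in> R" for b
        using phiR[OF that] y line_nf_planeC[of n h \<alpha> \<beta> b] that R by (simp add: W)
      \<comment> \<open>A kernel vector scaled to the radius of the fibre would be a point of
        \<open>Z\<close> above \<open>y\<close>, against \<open>y \<in> U\<close>.\<close>
      have Tnz: "T b \<noteq> 0" if b: "b \<in> Alg n" "b \<noteq> 0" for b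
      proof
        assume "T b = 0"
        define b' where "b' = (sqrt (\<alpha> * \<beta>) / norm b) *\<^sub>R b"
        have "b' \<in> R" using b ab by (simp add: R_def b'_def Alg_scaleR)
        then have "lc (kappa n (line (nf h \<alpha> \<beta> b'))) \<noteq> 0" using lnz[OF RW] by blast
        moreover have "T b' = 0" using \<open>T b = 0\<close> by (simp add: b'_def linear_scale[OF linT])
        ultimately show False using kap[of b'] R \<open>b' \<in> R\<close> by simp
      qed
      have TA: "T ` Alg n \<subseteq> Alg n"
        unfolding T_def using l_Alg rotations_mk_Herm[OF f(2)] by blast
      have "sqrt (\<alpha> * \<beta>) > 0" using ab by simp
      from normalized_linear_bij[OF subspace_Alg linT TA Tnz this]
      have bT: "bij_betw (\<lambda>b. T b /\<^sub>R norm (T b)) R (unit_elements n)" by (simp add: R_def unit_elements_def)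
      have psiR: "\<psi> (line (nf h \<alpha> \<beta> b)) = T b /\<^sub>R norm (T b)" if "b \<in> R" for b
        using kap[of b] that R ab by (simp add: \<psi>_def)
      have img: "{p \<in> W. phi_map n p = y} = (\<lambda>b. line (nf h \<alpha> \<beta> b)) ` R"
      proof
        show "(\<lambda>b. line (nf h \<alpha> \<beta> b)) ` R \<subseteq> {p \<in> W. phi_map n p = y}" using RW phiR by blast
        show "{p \<in> W. phi_map n p = y} \<subseteq> (\<lambda>b. line (nf h \<alpha> \<beta> b)) ` R"
        proof
          fix p assume p: "p \<in> {p \<in> W. phi_map n p = y}"
          then have "p \<in> planeC n" "g (phi_map n p) = mk x1 x2 x3 0 0 0" using f(5) by (simp_all add: W)
          from fibre_nf[OF f(1,2,3) this f(6,7)] obtain b where "nf_data n h \<alpha> \<beta> b" "p = line (nf h \<alpha> \<beta> b)"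
            unfolding \<alpha>_def \<beta>_def by metis
          then show "p \<in> (\<lambda>b. line (nf h \<alpha> \<beta> b)) ` R" using R by blast
        qed
      qed
      have "bij_betw (\<lambda>b. \<psi> (line (nf h \<alpha> \<beta> b))) R (unit_elements n)"
        using bT psiR by (simp cong: bij_betw_cong)
      then have "inj_on (\<psi> \<circ> (\<lambda>b. line (nf h \<alpha> \<beta> b))) R" "\<psi> ` {p \<in> W. phi_map n p = y} = unit_elements n"
        unfolding img image_image by (simp_all add: bij_betw_def o_def)
      moreover from this(1) have "inj_on \<psi> {p \<in> W. phi_map n p = y}"
        unfolding img by (rule inj_on_imageI)
      ultimately show ?thesis by (simp add: bij_betw_def)
    qed
    have "bij_betw (\<lambda>p. (phi_map n p, \<psi> p)) W (U \<times> unit_elements n)"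
    proof (rule bij_betw_imageI)
      show "inj_on (\<lambda>p. (phi_map n p, \<psi> p)) W"
      proof (rule inj_onI)
        fix p q assume pq: "p \<in> W" "q \<in> W" "(phi_map n p, \<psi> p) = (phi_map n q, \<psi> q)"
        have "phi_map n q \<in> U" using pq by (simp add: W)
        from fibre[OF this] show "p = q" using pq by (auto simp: bij_betw_def inj_on_def)
      qed
      show "(\<lambda>p. (phi_map n p, \<psi> p)) ` W = U \<times> unit_elements n"
      proof
        show "(\<lambda>p. (phi_map n p, \<psi> p)) ` W \<subseteq> U \<times> unit_elements n"
        proof (rule image_subsetI)
          fix p assume "p \<in> W"
          then show "(phi_map n p, \<psi> p) \<in> U \<times> unit_elements n" using psi_mem by (simp add: W)
        qed
        show "U \<times> unit_elements n \<subseteq> (\<lambda>p. (phi_map n p, \<psi> p)) ` W"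
        proof
          fix yv assume "yv \<in> U \<times> unit_elements n"
          then obtain y v where yv: "yv = (y, v)" "y \<in> U" "v \<in> unit_elements n" by (rule SigmaE)
          have "v \<in> \<psi> ` {p \<in> W. phi_map n p = y}"
            unfolding bij_betw_imp_surj_on[OF fibre[OF yv(2)]] by (rule yv(3))
          then obtain p where "p \<in> W" "phi_map n p = y" "\<psi> p = v" by blast
          then show "yv \<in> (\<lambda>p. (phi_map n p, \<psi> p)) ` W" using yv(1) by blast
        qed
      qed
    qed
    then have bij: "bij_betw (\<lambda>p. (phi_map n p, \<psi> p)) (topspace XW)
        (topspace (subtopology (top_of_set (plane_base n)) U) \<times> topspace (top_of_set (unit_elements n)))"
      unfolding topW topU by simp
    have haus: "Hausdorff_space (subtopology (top_of_set (plane_base n)) U)" "Hausdorff_space (top_of_set (unit_elements n))"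
      by (simp_all add: Hausdorff_space_subtopology)
    have homeo: "homeomorphic_map (subtopology XM {x \<in> topspace XM. phi_map n x \<in> U})
        (prod_topology (subtopology (top_of_set (plane_base n)) U) (top_of_set (unit_elements n))) (\<lambda>p. (phi_map n p, \<psi> p))"
      using proper_continuous_trivialization[OF properW contW haus psi bij] unfolding XW_def W_def .
    show ?thesis
    proof (rule exI[of _ U], intro conjI openU yU, rule exI[of _ "\<lambda>p. (phi_map n p, \<psi> p)"], intro conjI homeo ballI impI)
      fix x
      show "fst (phi_map n x, \<psi> x) = phi_map n x" by (rule fst_conv)
    qed
  qed
  then show ?thesis
    using cont unfolding fibration_with_fibre_def XM_def M_def by simp
qed

theorem theoremB:
  fixes n :: nat
  assumes "n \<in> {0, 1, 2, 3}"
  shows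
    "top_of_set (Herm_sphere n) homeomorphic_space nsphere (3 * 2 ^ n + 1) \<and>
     continuous_map (planeC_top n) (top_of_set (Herm_sphere n)) (phi_map n) \<and>
     (\<forall>X\<in>proj_plane n. line (X, 0) \<in> planeC n \<and>
        phi_map n (line (X, 0)) = X - (1 / 3) *\<^sub>R one_mat) \<and>
     fibration_with_fibre
       (subtopology (planeC_top n) (planeC n - (real_points n \<union> infinity_points n)))
       (top_of_set (Herm_sphere n - (plane_tilde n \<union> uminus ` plane_tilde n)))
       (phi_map n)
       (top_of_set (unit_elements n)) \<and>
     phi_map n ` infinity_points n = uminus ` plane_tilde n \<and>
     top_of_set (unit_elements n) homeomorphic_space nsphere (2 ^ n - 1) \<and>
     (\<forall>g\<in>Grp n. \<forall>p\<in>planeC n. complexify g ` p \<in> planeC n \<and>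
        phi_map n (complexify g ` p) = g (phi_map n p))"
  proof (intro conjI ballI)
  have n: "n \<le> 3" using assms by auto
  show "top_of_set (Herm_sphere n) homeomorphic_space nsphere (3 * 2 ^ n + 1)"
    by (rule Herm_sphere_nsphere[OF n])
  show "continuous_map (planeC_top n) (top_of_set (Herm_sphere n)) (phi_map n)"
    by (rule continuous_phi_map)
  show "line (X, 0) \<in> planeC n" "phi_map n (line (X, 0)) = X - (1 / 3) *\<^sub>R one_mat"
    if "X \<in> proj_plane n" for X
    using phi_map_real_point[of X n] that unfolding proj_plane_idem1[OF n] by simp_all
  show "fibration_with_fibre
      (subtopology (planeC_top n) (planeC n - (real_points n \<union> infinity_points n)))
      (top_of_set (Herm_sphere n - (plane_tilde n \<union> uminus ` plane_tilde n)))
      (phi_map n) (top_of_set (unit_elements n))"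
    using phi_map_fibration[OF n] unfolding generic_points(1)[OF n] by (simp only: plane_base_def)
  show "phi_map n ` infinity_points n = uminus ` plane_tilde n"
    by (rule phi_map_infinity_points[OF n])
  show "top_of_set (unit_elements n) homeomorphic_space nsphere (2 ^ n - 1)"
    by (rule unit_elements_nsphere[OF n])
  show "complexify g ` p \<in> planeC n" "phi_map n (complexify g ` p) = g (phi_map n p)"
    if "g \<in> Grp n" "p \<in> planeC n" for g p
    using phi_map_equivariant[OF Grp_Aut_J[OF n that(1)] that(2)] by simp_all
qed

end
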